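(* The value function of the standard American put $$V(x)=\sup_{\tau\ge0}E_x\big[e^{-r\tau}(q-X_\tau)^+I_{\{\tau<\infty\}}\big],\qquad x\in(0,+\infty),$$ is non-decreasing with respect to the volatility $\sigma$: denoting by $V_{\sigma_i}$ the value function with volatility $\sigma_i$ (all other data equal), if $\sigma_1(x)\le\sigma_2(x)$ for all $x\in(0,+\infty)$, then $V_{\sigma_1}(x)\le V_{\sigma_2}(x)$ for all $x\in(0,+\infty)$. Consequently, the optimal price level $x_0$ is non-increasing with respect to $\sigma$.
   Context: Let $\mathcal I=(0,+\infty)$ and let $r>0$ be a constant. On a complete probability space with filtration $(\mathcal F_t)_{t\ge0}$ and an adapted standard one-dimensional Brownian motion $B$, the process $X$ with state space $\mathcal I$ satisfies $dX_t=\mu(X_t)dt+\sigma(X_t)dB_t$, $X_0=x\in\mathcal I$; $E_x=E[\cdot\mid X_0=x]$. Standing assumptions (for all coefficients considered): (i) $\mu:\mathcal I\to\mathbb R$ and $\sigma:\mathcal I\to(0,+\infty)$ are measurable and the SDE has a unique strong solution; (ii) $\theta(x)=rx-\mu(x)$ is non-decreasing on $\mathcal I$; (iii) $X$ is regular in $\mathcal I$ (every point of $\mathcal I$ is reached from every other with positive probability) and $0$ is a natural boundary. Let $\mathcal L=\frac12\sigma^2(x)\frac{d^2}{dx^2}+\mu(x)\frac{d}{dx}$. $\psi$ (resp. $\varphi$) denotes the positive strictly increasing (resp. strictly decreasing) $C^2$ solution, determined up to a positive factor, of $(\mathcal L-r)u=0$ on $\mathcal I$ such that, with $\tau_\kappa=\inf\{t\ge0:X_t=\kappa\}$,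 $E_x[e^{-r\tau_\kappa}]=\psi(x)/\psi(\kappa)$ for $x\le\kappa$ and $E_x[e^{-r\tau_\kappa}]=\varphi(x)/\varphi(\kappa)$ for $x\ge\kappa$. In this setting $\psi(0+)=0$, $\varphi(0+)=+\infty$, $\varphi(+\infty)=0$. It is further assumed that $\varphi$ is convex on $(0,+\infty)$. $q>0$ is a constant, and suprema are over $(\mathcal F_t)$-stopping times. The level $x_0\in(0,q)$ is the unique solution of $\varphi(x_0)+(q-x_0)\varphi'(x_0)=0$; one has $V(x)=q-x$ for $0<x\le x_0$ and $V(x)=(q-x_0)\varphi(x)/\varphi(x_0)$ for $x>x_0$, and the stopping region is $(0,x_0]$. *)

theory Defs
  imports "HOL-Probability.Probability"
begin

section \<open>Brownian basis\<close>

text \<open>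
  Time ranges over the extended half line: filtrations are indexed by \<^typ>\<open>ennreal\<close>, so that
  the library's \<^const>\<open>stopping_time\<close> covers stopping times with values in \<open>[0,\<infinity>]\<close> (at the index
  \<open>\<infinity>\<close> the stopping time condition is void). Processes are indexed by real time, and only
  their values at times \<open>t \<ge> 0\<close> matter.
\<close>

definition adapted :: "(ennreal \<Rightarrow> 'a measure) \<Rightarrow> (real \<Rightarrow> 'a \<Rightarrow> real) \<Rightarrow> bool" where
  "adapted F X \<longleftrightarrow> (\<forall>t\<ge>0. X t \<in> borel_measurable (F (ennreal t)))"

locale brownian_basis =
  prob_space M + complete_measure M + filtration "space M" F
  for M :: "'a measure" and F :: "ennreal \<Rightarrow> 'a measure" +
  fixes B :: "real \<Rightarrow> 'a \<Rightarrow> real"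
  assumes filtration_le: "sets (F t) \<subseteq> sets M"
    and B_adapted: "adapted F B"
    and B_zero: "AE \<omega> in M. B 0 \<omega> = 0"
    and B_continuous: "\<omega> \<in> space M \<Longrightarrow> continuous_on {0..} (\<lambda>t. B t \<omega>)"
    and B_gaussian: "0 \<le> s \<Longrightarrow> s < t \<Longrightarrow>
          distributed M lborel (\<lambda>\<omega>. B t \<omega> - B s \<omega>) (normal_density 0 (sqrt (t - s)))"
    and B_indep: "0 \<le> s \<Longrightarrow> s < t \<Longrightarrow>
          indep_set (sets (F (ennreal s)))
            (sets (vimage_algebra (space M) (\<lambda>\<omega>. B t \<omega> - B s \<omega>) borel))"

text \<open>The filtration generated by \<open>B\<close>, augmented by the null sets of \<open>M\<close>.\<close>

definition augmented_filtration ::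
    "'a measure \<Rightarrow> (real \<Rightarrow> 'a \<Rightarrow> real) \<Rightarrow> ennreal \<Rightarrow> 'a measure" where
  "augmented_filtration M B t = sigma (space M)
     ({B s -` A \<inter> space M | s A. 0 \<le> s \<and> ennreal s \<le> t \<and> A \<in> sets borel} \<union> null_sets M)"

section \<open>Ito integral\<close>

definition tends_to_0_in_prob ::
    "'a measure \<Rightarrow> (nat \<Rightarrow> 'a \<Rightarrow> ennreal) \<Rightarrow> bool" where
  "tends_to_0_in_prob M Y \<longleftrightarrow>
     (\<forall>e>0. (\<lambda>n. measure M {\<omega> \<in> space M. Y n \<omega> > e}) \<longlonglongrightarrow> 0)"

text \<open>
  An elementary integrand is \<open>\<Sum>i<N. \<xi> i * 1 (p i, p (i+1)]\<close>, with deterministic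
  \<open>0 \<le> p 0 \<le> \<dots> \<le> p N\<close> and \<open>\<xi> i\<close> bounded and measurable at time \<open>p i\<close>.
\<close>

definition elementary ::
    "'a measure \<Rightarrow> (ennreal \<Rightarrow> 'a measure) \<Rightarrow> nat \<Rightarrow> (nat \<Rightarrow> real) \<Rightarrow> (nat \<Rightarrow> 'a \<Rightarrow> real) \<Rightarrow> bool"
where
  "elementary M F N p \<xi> \<longleftrightarrow> 0 \<le> p 0 \<and>
     (\<forall>i<N. p i \<le> p (Suc i) \<and> \<xi> i \<in> borel_measurable (F (ennreal (p i))) \<and>
            (\<exists>C. \<forall>\<omega>\<in>space M. \<bar>\<xi> i \<omega>\<bar> \<le> C))"

definition elem_process ::
    "nat \<Rightarrow> (nat \<Rightarrow> real) \<Rightarrow> (nat \<Rightarrow> 'a \<Rightarrow> real) \<Rightarrow> real \<Rightarrow> 'a \<Rightarrow> real" where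
  "elem_process N p \<xi> t \<omega> = (\<Sum>i<N. \<xi> i \<omega> * indicator {p i<..p (Suc i)} t)"

definition elem_integral ::
    "(real \<Rightarrow> 'a \<Rightarrow> real) \<Rightarrow> nat \<Rightarrow> (nat \<Rightarrow> real) \<Rightarrow> (nat \<Rightarrow> 'a \<Rightarrow> real) \<Rightarrow> real \<Rightarrow> 'a \<Rightarrow> real"
where
  "elem_integral B N p \<xi> t \<omega> =
     (\<Sum>i<N. \<xi> i \<omega> * (B (min t (p (Suc i))) \<omega> - B (min t (p i)) \<omega>))"

text \<open>
  \<open>ito_integral M F B H I\<close>: \<open>H\<close> is jointly measurable and adapted with \<open>\<integral>\<^sub>0\<^sup>T H\<^sup>2 ds < \<infinity>\<close> a.s.,
  and \<open>I\<close> is a version with a.s. continuous paths of the process \<open>\<integral>\<^sub>0\<^sup>t H dB\<close>. The integral is the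
  limit in probability of the integrals of elementary integrands that approximate \<open>H\<close> in
  \<open>L\<^sup>2[0,T]\<close> in probability, for every \<open>T\<close>; the limit does not depend on the
  approximating sequence.
\<close>

definition ito_integral ::
    "'a measure \<Rightarrow> (ennreal \<Rightarrow> 'a measure) \<Rightarrow> (real \<Rightarrow> 'a \<Rightarrow> real) \<Rightarrow>
     (real \<Rightarrow> 'a \<Rightarrow> real) \<Rightarrow> (real \<Rightarrow> 'a \<Rightarrow> real) \<Rightarrow> bool" where
  "ito_integral M F B H I \<longleftrightarrow>
     (\<lambda>(t, \<omega>). H t \<omega>) \<in> borel_measurable (restrict_space borel {0..} \<Otimes>\<^sub>M M) \<and>
     adapted F H \<and>
     (AE \<omega> in M. \<forall>T\<ge>0. set_integrable lborel {0..T} (\<lambda>t. (H t \<omega>)\<^sup>2)) \<and>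
     (\<forall>t\<ge>0. I t \<in> borel_measurable M) \<and>
     (AE \<omega> in M. continuous_on {0..} (\<lambda>t. I t \<omega>)) \<and>
     (\<exists>N p \<xi>. (\<forall>n. elementary M F (N n) (p n) (\<xi> n)) \<and>
        (\<forall>T\<ge>0. tends_to_0_in_prob M (\<lambda>n \<omega>.
           \<integral>\<^sup>+t\<in>{0..T}. ennreal ((elem_process (N n) (p n) (\<xi> n) t \<omega> - H t \<omega>)\<^sup>2) \<partial>lborel)) \<and>
        (\<forall>t\<ge>0. tends_to_0_in_prob M (\<lambda>n \<omega>.
           ennreal \<bar>elem_integral B (N n) (p n) (\<xi> n) t \<omega> - I t \<omega>\<bar>)))"

section \<open>The diffusion\<close>

text \<open>
  Strong solution on the state space \<open>(0,\<infinity>)\<close>, started at \<open>x\<close>; strong means that the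
  solution is a functional of the driving Brownian motion, i.e. adapted to its augmented filtration.
\<close>

definition strong_solution ::
    "'a measure \<Rightarrow> (ennreal \<Rightarrow> 'a measure) \<Rightarrow> (real \<Rightarrow> 'a \<Rightarrow> real) \<Rightarrow>
     (real \<Rightarrow> real) \<Rightarrow> (real \<Rightarrow> real) \<Rightarrow> real \<Rightarrow> (real \<Rightarrow> 'a \<Rightarrow> real) \<Rightarrow> bool" where
  "strong_solution M F B \<mu> \<sigma> x X \<longleftrightarrow>
     adapted F X \<and> adapted (augmented_filtration M B) X \<and>
     (\<forall>\<omega>\<in>space M. continuous_on {0..} (\<lambda>t. X t \<omega>) \<and> (\<forall>t\<ge>0. X t \<omega> > 0)) \<and>
     (AE \<omega> in M. \<forall>t\<ge>0. set_integrable lborel {0..t} (\<lambda>s. \<mu> (X s \<omega>))) \<and>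
     (\<exists>I. ito_integral M F B (\<lambda>s \<omega>. \<sigma> (X s \<omega>)) I \<and>
        (AE \<omega> in M. \<forall>t\<ge>0. X t \<omega> = x + (LBINT s:{0..t}. \<mu> (X s \<omega>)) + I t \<omega>))"

definition unique_strong_solution ::
    "'a measure \<Rightarrow> (ennreal \<Rightarrow> 'a measure) \<Rightarrow> (real \<Rightarrow> 'a \<Rightarrow> real) \<Rightarrow>
     (real \<Rightarrow> real) \<Rightarrow> (real \<Rightarrow> real) \<Rightarrow> real \<Rightarrow> (real \<Rightarrow> 'a \<Rightarrow> real) \<Rightarrow> bool" where
  "unique_strong_solution M F B \<mu> \<sigma> x X \<longleftrightarrow>
     strong_solution M F B \<mu> \<sigma> x X \<and>
     (\<forall>Y. strong_solution M F B \<mu> \<sigma> x Y \<longrightarrow> (AE \<omega> in M. \<forall>t\<ge>0. Y t \<omega> = X t \<omega>))"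

definition hitting_time :: "(real \<Rightarrow> 'a \<Rightarrow> real) \<Rightarrow> real \<Rightarrow> 'a \<Rightarrow> ennreal" where
  "hitting_time X k \<omega> = Inf {ennreal t | t. 0 \<le> t \<and> X t \<omega> = k}"

text \<open>
  Below, \<open>X x\<close> is the solution started at \<open>x\<close>, so that \<open>E\<^sub>x\<close> and \<open>P\<^sub>x\<close> are expectation and
  probability under \<open>M\<close> of functionals of \<open>X x\<close>.
\<close>

definition regular_diffusion :: "'a measure \<Rightarrow> (real \<Rightarrow> real \<Rightarrow> 'a \<Rightarrow> real) \<Rightarrow> bool" where
  "regular_diffusion M X \<longleftrightarrow>
     (\<forall>x>0. \<forall>y>0. measure M {\<omega> \<in> space M. hitting_time (X x) y \<omega> < \<infinity>} > 0)"

text \<open>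
  Natural means neither exit nor entrance (Ito-McKean): \<open>0\<close> is not reached from the
  interior in finite time, and the interior is not reached from \<open>0\<close> in finite time.
\<close>

definition natural_at_0 :: "'a measure \<Rightarrow> (real \<Rightarrow> real \<Rightarrow> 'a \<Rightarrow> real) \<Rightarrow> bool" where
  "natural_at_0 M X \<longleftrightarrow>
     (\<forall>x>0. \<forall>t\<ge>0. ((\<lambda>y. measure M {\<omega> \<in> space M. hitting_time (X x) y \<omega> \<le> ennreal t})
         \<longlongrightarrow> 0) (at_right 0)) \<and>
     (\<forall>y>0. \<forall>t\<ge>0. ((\<lambda>x. measure M {\<omega> \<in> space M. hitting_time (X x) y \<omega> \<le> ennreal t})
         \<longlongrightarrow> 0) (at_right 0))"

locale admissible_diffusion =
  brownian_basis M F B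
  for M :: "'a measure" and F :: "ennreal \<Rightarrow> 'a measure" and B :: "real \<Rightarrow> 'a \<Rightarrow> real" +
  fixes r :: real and \<mu> \<sigma> :: "real \<Rightarrow> real" and X :: "real \<Rightarrow> real \<Rightarrow> 'a \<Rightarrow> real"
  assumes drift_measurable: "\<mu> \<in> borel_measurable (restrict_space borel {0<..})"
    and volatility_measurable: "\<sigma> \<in> borel_measurable (restrict_space borel {0<..})"
    and volatility_pos: "x > 0 \<Longrightarrow> \<sigma> x > 0"
    and solution: "x > 0 \<Longrightarrow> unique_strong_solution M F B \<mu> \<sigma> x (X x)"
    and theta_mono: "mono_on {0<..} (\<lambda>x. r * x - \<mu> x)"
    and regular: "regular_diffusion M X"
    and natural_boundary: "natural_at_0 M X"

section \<open>Fundamental solutions\<close>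

text \<open>Discount factor with the convention \<open>e\<^bsup>-r\<infinity>\<^esup> = 0\<close>.\<close>

definition discount :: "real \<Rightarrow> ennreal \<Rightarrow> real" where
  "discount r T = (if T = \<infinity> then 0 else exp (- r * enn2real T))"

definition C2_pos :: "(real \<Rightarrow> real) \<Rightarrow> bool" where
  "C2_pos u \<longleftrightarrow>
     (\<forall>x>0. u field_differentiable at x \<and> deriv u field_differentiable at x) \<and>
     continuous_on {0<..} (deriv (deriv u))"

definition generator :: "(real \<Rightarrow> real) \<Rightarrow> (real \<Rightarrow> real) \<Rightarrow> (real \<Rightarrow> real) \<Rightarrow> real \<Rightarrow> real" where
  "generator \<mu> \<sigma> u x = 1/2 * (\<sigma> x)\<^sup>2 * deriv (deriv u) x + \<mu> x * deriv u x"

definition r_harmonic :: "real \<Rightarrow> (real \<Rightarrow> real) \<Rightarrow> (real \<Rightarrow> real) \<Rightarrow> (real \<Rightarrow> real) \<Rightarrow> bool" where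
  "r_harmonic r \<mu> \<sigma> u \<longleftrightarrow> C2_pos u \<and> (\<forall>x>0. generator \<mu> \<sigma> u x - r * u x = 0)"

definition increasing_fundamental ::
    "'a measure \<Rightarrow> real \<Rightarrow> (real \<Rightarrow> real) \<Rightarrow> (real \<Rightarrow> real) \<Rightarrow> (real \<Rightarrow> real \<Rightarrow> 'a \<Rightarrow> real) \<Rightarrow>
     (real \<Rightarrow> real) \<Rightarrow> bool" where
  "increasing_fundamental M r \<mu> \<sigma> X \<psi> \<longleftrightarrow>
     r_harmonic r \<mu> \<sigma> \<psi> \<and> (\<forall>x>0. \<psi> x > 0) \<and> strict_mono_on {0<..} \<psi> \<and>
     (\<forall>x k. 0 < x \<and> x \<le> k \<longrightarrow>
        (\<integral>\<omega>. discount r (hitting_time (X x) k \<omega>) \<partial>M) = \<psi> x / \<psi> k)"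

definition decreasing_fundamental ::
    "'a measure \<Rightarrow> real \<Rightarrow> (real \<Rightarrow> real) \<Rightarrow> (real \<Rightarrow> real) \<Rightarrow> (real \<Rightarrow> real \<Rightarrow> 'a \<Rightarrow> real) \<Rightarrow>
     (real \<Rightarrow> real) \<Rightarrow> bool" where
  "decreasing_fundamental M r \<mu> \<sigma> X \<phi> \<longleftrightarrow>
     r_harmonic r \<mu> \<sigma> \<phi> \<and> (\<forall>x>0. \<phi> x > 0) \<and> strict_antimono_on {0<..} \<phi> \<and>
     (\<forall>x k. 0 < k \<and> k \<le> x \<longrightarrow>
        (\<integral>\<omega>. discount r (hitting_time (X x) k \<omega>) \<partial>M) = \<phi> x / \<phi> k)"

section \<open>The American put\<close>

text \<open>On \<open>{T = \<infinity>}\<close> the payoff vanishes because the discount factor does.\<close>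

definition put_payoff :: "real \<Rightarrow> real \<Rightarrow> (real \<Rightarrow> 'a \<Rightarrow> real) \<Rightarrow> ('a \<Rightarrow> ennreal) \<Rightarrow> 'a \<Rightarrow> real" where
  "put_payoff r q X T \<omega> = discount r (T \<omega>) * max 0 (q - X (enn2real (T \<omega>)) \<omega>)"

definition put_value ::
    "'a measure \<Rightarrow> (ennreal \<Rightarrow> 'a measure) \<Rightarrow> real \<Rightarrow> real \<Rightarrow> (real \<Rightarrow> real \<Rightarrow> 'a \<Rightarrow> real) \<Rightarrow>
     real \<Rightarrow> real" where
  "put_value M F r q X x = (SUP T\<in>{T. stopping_time F T}. (\<integral>\<omega>. put_payoff r q (X x) T \<omega> \<partial>M))"

definition optimal_level :: "real \<Rightarrow> (real \<Rightarrow> real) \<Rightarrow> real \<Rightarrow> bool" where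
  "optimal_level q \<phi> x0 \<longleftrightarrow> 0 < x0 \<and> x0 < q \<and> \<phi> x0 + (q - x0) * deriv \<phi> x0 = 0"

end

theory Submission
  imports Defs
begin

text \<open>
  Let \<open>a\<close> be an optimal level for the larger volatility \<open>\<sigma>2\<close>, and let \<open>W\<close> be the corresponding candidate,
  which is \<open>q - x\<close> up to \<open>a\<close> and a multiple of \<open>\<phi>2\<close> beyond, joined smoothly at \<open>a\<close>. As \<open>\<phi>2\<close> is convex, so
  is \<open>W\<close>, and therefore a smaller volatility only decreases the second order term of the generator applied
  to \<open>W\<close>. For \<open>\<sigma>2\<close> itself, \<open>W\<close> is a supersolution: beyond \<open>a\<close> by the equation of \<open>\<phi>2\<close>, and up to \<open>a\<close> because
  \<open>r * x - \<mu> x \<le> r * q\<close> there (\<open>theta_level\<close>). So the discounted \<open>W\<close> is a supermartingale along the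
  diffusion with volatility \<open>\<sigma>1\<close>, it dominates the payoff, and the value for \<open>\<sigma>1\<close> is at most \<open>W\<close>
  (\<open>put_value_le_candidate\<close>). Conversely, \<open>W\<close> is at most the value for \<open>\<sigma>2\<close>, being the reward of stopping
  at the first visit to \<open>min x a\<close> (\<open>put_value_ge_hitting\<close>). Optimal levels exist because \<open>\<phi>2\<close> is unbounded
  at the natural boundary \<open>0\<close> (\<open>optimal_level_exists\<close>).

  For the levels, suppose that \<open>a1 < a2\<close>. Between them \<open>W\<close>, with \<open>a = a2\<close>, equals \<open>q - x\<close>, while the reward of
  stopping at \<open>a1\<close> for \<open>\<sigma>1\<close> is at least \<open>q - x\<close> by convexity of \<open>\<phi>1\<close>. Both coincide by the first part, so
  \<open>\<phi>1\<close> is affine between the levels, and \<open>no_linear_piece\<close> shows by a Gronwall argument that it would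
  have to vanish at \<open>q\<close>.

  Most of the text proves the supermartingale property (\<open>verification\<close>). The Ito integral is given as a
  limit in probability of integrals of elementary integrands. In a window \<open>[lo, hi]\<close> the coefficients are
  bounded (\<open>coefficients_locally_bounded\<close>), and clipping the elementary integrands and the drift at this
  bound yields Ito processes for which Ito's formula in expectation follows from a Taylor expansion and
  the moments of Brownian increments (\<open>ito_small_interval\<close>, \<open>ito_expectation\<close>). While \<open>X\<close> stays in the
  window, these processes converge to \<open>X\<close> in probability (\<open>Z_tendsto\<close>), by the tail bound
  \<open>elem_integral_tail\<close>. Stopping times are approximated on a grid (\<open>grid_supermartingale\<close>), and Fatou's
  lemma removes the grid and the window. As \<open>W\<close> is only \<open>C\<^sup>1\<close>, it is replaced by bounded \<open>C\<^sup>2\<close> functions with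
  a smaller second derivative (\<open>candidate_approximation\<close>).
\<close>

text \<open>
  Cutting \<open>[a, b]\<close> into equal pieces of length below \<open>h\<close> bounds \<open>\<Phi> a b\<close> by \<open>e * (b - a)\<close> for
  every \<open>e\<close>. This turns local error estimates into exact identities: the defect of an identity between
  increments and integrals is additive in the interval, and it vanishes as soon as it is of smaller order
  than the length.
\<close>

lemma additive_interval_function_zero:
  fixes \<Phi> :: "real \<Rightarrow> real \<Rightarrow> real"
  assumes ab: "a \<le> b"
    and add: "\<And>s t v. a \<le> s \<Longrightarrow> s \<le> t \<Longrightarrow> t \<le> v \<Longrightarrow> v \<le> b \<Longrightarrow> \<Phi> s v = \<Phi> s t + \<Phi> t v"
    and small: "\<And>e. e > 0 \<Longrightarrow>
      \<exists>h>0. \<forall>s t. a \<le> s \<and> s \<le> t \<and> t \<le> b \<and> t - s \<le> h \<longrightarrow> \<bar>\<Phi> s t\<bar> \<le> e * (t - s)"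
  shows "\<Phi> a b = 0"
proof -
  have bound: "\<bar>\<Phi> a b\<bar> \<le> e * (b - a)" if e: "e > 0" for e
  proof -
    obtain h where h: "h > 0"
      and sm: "\<And>s t. a \<le> s \<Longrightarrow> s \<le> t \<Longrightarrow> t \<le> b \<Longrightarrow> t - s \<le> h \<Longrightarrow> \<bar>\<Phi> s t\<bar> \<le> e * (t - s)"
      using small[OF e] by blast
    obtain n :: nat where n: "(b - a) / h < real n" using reals_Archimedean2 by blast
    have n0: "n > 0" using n ab h by (metis divide_nonneg_pos diff_ge_0_iff_ge gr0I leD of_nat_0)
    define d where "d = (b - a) / real n"
    have d0: "d \<ge> 0" and dh: "d \<le> h" and nd: "real n * d = b - a"
      using ab n n0 h by (auto simp: d_def field_simps)
    have *: "k \<le> n \<Longrightarrow> \<bar>\<Phi> a (a + real k * d)\<bar> \<le> e * (real k * d)" for k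
    proof (induction k)
      case 0
      show ?case using sm[of a a] ab h by simp
    next
      case (Suc k)
      have le: "a + real (Suc k) * d \<le> b"
        using Suc.prems nd d0 mult_right_mono[of "real (Suc k)" "real n" d] by simp
      have "\<Phi> a (a + real (Suc k) * d) = \<Phi> a (a + real k * d) + \<Phi> (a + real k * d) (a + real (Suc k) * d)"
        using d0 le by (intro add) (auto simp: algebra_simps)
      moreover have "\<bar>\<Phi> (a + real k * d) (a + real (Suc k) * d)\<bar> \<le> e * d"
        using sm[of "a + real k * d" "a + real (Suc k) * d"] d0 dh le by (simp add: algebra_simps)
      ultimately show ?case using Suc by (auto simp: algebra_simps)
    qed
    show ?thesis using *[of n] nd by simp
  qed
  have "\<bar>\<Phi> a b\<bar> \<le> 0 + e" if "e > 0" for e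
  proof -
    have "\<bar>\<Phi> a b\<bar> \<le> (e / (b - a + 1)) * (b - a)"
      using that ab by (intro bound) auto
    also have "\<dots> \<le> e" using that ab by (simp add: field_simps)
    finally show ?thesis by simp
  qed
  then show ?thesis using field_le_epsilon[of "\<bar>\<Phi> a b\<bar>" 0] by simp
qed

section \<open>Integrals over short intervals\<close>

lemma set_integrable_bounded_Ioc:
  fixes g :: "real \<Rightarrow> real"
  assumes "g \<in> borel_measurable borel" and "\<And>u. \<bar>g u\<bar> \<le> K"
  shows "set_integrable lborel {s<..t} g"
  unfolding set_integrable_def
proof (rule Bochner_Integration.integrable_bound)
  show "integrable lborel (\<lambda>x. indicator {s<..t} x *\<^sub>R K)"
    by (intro integrable_scaleR_left integrable_real_indicator) (auto intro!: emeasure_bounded_finite[simplified])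
  show "(\<lambda>x. indicat_real {s<..t} x *\<^sub>R g x) \<in> borel_measurable lborel"
    using assms(1) by measurable
  show "AE x in lborel. norm (indicat_real {s<..t} x *\<^sub>R g x) \<le> norm (indicat_real {s<..t} x *\<^sub>R K)"
    using assms(2) by (auto simp: indicator_def intro!: AE_I2 order_trans[OF _ abs_ge_self])
qed

lemma set_integral_abs_le:
  fixes g :: "real \<Rightarrow> real"
  assumes "s \<le> t" and g: "set_integrable lborel {s<..t} g"
    and b: "\<And>u. s < u \<Longrightarrow> u \<le> t \<Longrightarrow> \<bar>g u\<bar> \<le> K"
  shows "\<bar>LBINT u:{s<..t}. g u\<bar> \<le> K * (t - s)"
proof -
  have "\<bar>LBINT u:{s<..t}. g u\<bar> \<le> (LBINT u:{s<..t}. \<bar>g u\<bar>)"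
    using set_integral_norm_bound[OF g] by simp
  also have "\<dots> \<le> (LBINT u:{s<..t}. K)"
    using b set_integrable_bounded_Ioc[of "\<lambda>_. K" "\<bar>K\<bar>" s t]
    by (intro set_integral_mono set_integrable_abs[OF g]) auto
  also have "\<dots> = K * (t - s)"
    using assms(1) by (subst set_integral_const) auto
  finally show ?thesis .
qed

lemma set_integral_Ioc_split:
  fixes g :: "real \<Rightarrow> real"
  assumes "s \<le> t" "t \<le> v" "set_integrable lborel {s<..v} g"
  shows "(LBINT u:{s<..v}. g u) = (LBINT u:{s<..t}. g u) + (LBINT u:{t<..v}. g u)"
proof -
  have eq: "{s<..v} = {s<..t} \<union> {t<..v}" using assms by auto
  show ?thesis unfolding eq
    by (intro set_integral_Un set_integrable_subset[OF assms(3)]) (use assms in auto)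
qed

text \<open>
  Integration by parts for \<open>exp (- r * t) * U t\<close>, where \<open>U\<close> is an indefinite integral of a merely
  measurable \<open>g\<close>. The product rule is not available pointwise, but the defect of the formula over a
  short interval is quadratic in its length, because \<open>U\<close> is Lipschitz.
\<close>

lemma discounted_increment:
  fixes U g :: "real \<Rightarrow> real"
  assumes ab: "a \<le> b" and r: "r \<ge> 0" and a0: "a \<ge> 0"
    and gm: "g \<in> borel_measurable borel" and gb: "\<And>u. \<bar>g u\<bar> \<le> G"
    and Um: "U \<in> borel_measurable borel" and Ub: "\<And>u. \<bar>U u\<bar> \<le> L"
    and inc: "\<And>s t. a \<le> s \<Longrightarrow> s \<le> t \<Longrightarrow> t \<le> b \<Longrightarrow> U t - U s = (LBINT u:{s<..t}. g u)"
  shows "exp (- r * b) * U b - exp (- r * a) * U a = (LBINT u:{a<..b}. exp (- r * u) * (g u - r * U u))"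
proof -
  define \<Phi> where "\<Phi> s t = exp (- r * t) * U t - exp (- r * s) * U s
      - (LBINT u:{s<..t}. exp (- r * max 0 u) * (g u - r * U u))" for s t
  have G0: "G \<ge> 0" using gb[of 0] by auto
  have int: "set_integrable lborel {s<..t} (\<lambda>u. exp (- r * max 0 u) * (g u - r * U u))" for s t
  proof (rule set_integrable_bounded_Ioc)
    show "(\<lambda>u. exp (- r * max 0 u) * (g u - r * U u)) \<in> borel_measurable borel"
      using gm Um by measurable
    fix u
    have "\<bar>g u - r * U u\<bar> \<le> \<bar>g u\<bar> + \<bar>r * U u\<bar>" by simp
    also have "\<dots> \<le> G + r * L"
      using gb[of u] mult_left_mono[OF Ub[of u] r] r by (simp add: abs_mult)
    finally have "\<bar>g u - r * U u\<bar> \<le> G + r * L" .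
    moreover have "exp (- r * max 0 u) \<le> 1" using r by simp
    ultimately show "\<bar>exp (- r * max 0 u) * (g u - r * U u)\<bar> \<le> 1 * (G + r * L)"
      unfolding abs_mult by (intro mult_mono) auto
  qed
  have "\<Phi> a b = 0"
  proof (rule additive_interval_function_zero[OF ab])
    show "\<Phi> s v = \<Phi> s t + \<Phi> t v" if "a \<le> s" "s \<le> t" "t \<le> v" "v \<le> b" for s t v
      unfolding \<Phi>_def using set_integral_Ioc_split[OF that(2,3) int] by simp
    fix e :: real assume e: "e > 0"
    define K where "K = 2 * r * G + 1"
    have K: "K > 0" using r G0 by (auto simp: K_def intro: add_nonneg_pos)
    show "\<exists>h>0. \<forall>s t. a \<le> s \<and> s \<le> t \<and> t \<le> b \<and> t - s \<le> h \<longrightarrow> \<bar>\<Phi> s t\<bar> \<le> e * (t - s)"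
    proof (intro exI[of _ "e / K"] conjI allI impI)
      show "e / K > 0" using e K by simp
      fix s t assume st: "a \<le> s \<and> s \<le> t \<and> t \<le> b \<and> t - s \<le> e / K"
      have s0: "s \<ge> 0" using st a0 by simp
      have lip: "\<bar>U u - U s\<bar> \<le> G * (u - s)" if "s \<le> u" "u \<le> t" for u
        unfolding inc[of s u, OF conjunct1[OF st] that(1) order_trans[OF that(2) conjunct1[OF conjunct2[OF conjunct2[OF st]]]]]
        using that(1) gb by (intro set_integral_abs_le set_integrable_bounded_Ioc[OF gm gb]) auto
      have ig: "set_integrable lborel {s<..t} g" by (rule set_integrable_bounded_Ioc[OF gm gb])
      have dexp: "exp (- r * t) - exp (- r * s) = (LBINT u:{s<..t}. - r * exp (- r * u))"
      proof -
        have "(LBINT u=s..t. - r * exp (- r * u)) = exp (- r * t) - exp (- r * s)"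
          by (rule interval_integral_FTC_finite)
            (auto intro!: continuous_intros derivative_eq_intros
              simp: has_real_derivative_iff_has_vector_derivative[symmetric])
        moreover have "(LBINT u=s..t. - r * exp (- r * u)) = (LBINT u:{s<..t}. - r * exp (- r * u))"
          using st by (subst interval_integral_Ioc) auto
        ultimately show ?thesis by simp
      qed
      have ie: "set_integrable lborel {s<..t} (\<lambda>u. - r * exp (- r * u))"
        using st by (intro set_integrable_subset[OF borel_integrable_atLeastAtMost'[of s t]])
          (auto intro!: continuous_intros)
      have i1: "set_integrable lborel {s<..t} (\<lambda>u. exp (- r * t) * g u)"
        and i2: "set_integrable lborel {s<..t} (\<lambda>u. U s * (- r * exp (- r * u)))"
        using set_integrable_mult_right[of "exp (- r * t)", OF ig] set_integrable_mult_right[of "U s", OF ie]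
        by blast+
      have "\<Phi> s t = exp (- r * t) * (U t - U s) + U s * (exp (- r * t) - exp (- r * s))
          - (LBINT u:{s<..t}. exp (- r * max 0 u) * (g u - r * U u))"
        by (simp add: \<Phi>_def algebra_simps)
      also have "\<dots> = (LBINT u:{s<..t}. exp (- r * t) * g u) + (LBINT u:{s<..t}. U s * (- r * exp (- r * u)))
          - (LBINT u:{s<..t}. exp (- r * max 0 u) * (g u - r * U u))"
        using st by (simp only: inc dexp set_integral_mult_right)
      also have "\<dots> = (LBINT u:{s<..t}. exp (- r * t) * g u + U s * (- r * exp (- r * u))
            - exp (- r * max 0 u) * (g u - r * U u))"
        using i1 i2 int[of s t]
        by (simp only: set_integral_diff(2)[OF set_integral_add(1)[OF i1 i2] int] set_integral_add(2)[OF i1 i2])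
      finally have \<Phi>: "\<Phi> s t = (LBINT u:{s<..t}. exp (- r * t) * g u + U s * (- r * exp (- r * u))
            - exp (- r * max 0 u) * (g u - r * U u))" .
      have "\<bar>\<Phi> s t\<bar> \<le> (K * (t - s)) * (t - s)"
        unfolding \<Phi>
      proof (rule set_integral_abs_le)
        show "set_integrable lborel {s<..t} (\<lambda>u. exp (- r * t) * g u + U s * (- r * exp (- r * u))
            - exp (- r * max 0 u) * (g u - r * U u))"
          by (intro set_integral_diff set_integral_add i1 i2 int)
        fix u assume u: "s < u" "u \<le> t"
        have "exp (- r * t) * g u + U s * (- r * exp (- r * u)) - exp (- r * max 0 u) * (g u - r * U u)
            = (exp (- r * t) - exp (- r * u)) * g u + (r * exp (- r * u)) * (U u - U s)"
          using u s0 by (simp add: algebra_simps)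
        also have "\<bar>\<dots>\<bar> \<le> \<bar>exp (- r * t) - exp (- r * u)\<bar> * G + r * (G * (u - s))"
        proof -
          have "exp (- r * u) \<le> 1" using r u s0 by simp
          then have "(r * exp (- r * u)) * \<bar>U u - U s\<bar> \<le> r * (G * (u - s))"
            using lip[of u] u r by (intro mult_mono) (auto simp: mult_left_le)
          then show ?thesis
            using mult_left_mono[OF gb[of u] abs_ge_zero, of "exp (- r * t) - exp (- r * u)"] r
            by (intro order_trans[OF abs_triangle_ineq] add_mono) (auto simp: abs_mult)
        qed
        also have "\<bar>exp (- r * t) - exp (- r * u)\<bar> \<le> r * (t - s)"
        proof -
          have "exp (- r * u) - exp (- r * t) = exp (- r * u) * (1 - exp (- r * (t - u)))"
            by (simp add: algebra_simps exp_diff exp_minus field_simps exp_add[symmetric])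
          also have "\<dots> \<le> 1 * (r * (t - u))"
            using u r s0 exp_ge_add_one_self[of "- r * (t - u)"] by (intro mult_mono) auto
          also have "\<dots> \<le> r * (t - s)" using u r by (simp add: mult_left_mono)
          finally show ?thesis using u r by (simp add: mult_left_mono)
        qed
        also have "r * (t - s) * G + r * (G * (u - s)) \<le> K * (t - s)"
        proof -
          have "r * (G * (u - s)) \<le> r * (G * (t - s))" using u r G0 by (intro mult_left_mono) auto
          then show ?thesis using st by (simp add: K_def algebra_simps)
        qed
        finally show "\<bar>exp (- r * t) * g u + U s * (- r * exp (- r * u))
            - exp (- r * max 0 u) * (g u - r * U u)\<bar> \<le> K * (t - s)"
          using G0 by (simp add: mult_right_mono)
      qed (use st in auto)
      also have "\<dots> \<le> e * (t - s)"
        using st K by (intro mult_right_mono) (auto simp: field_simps)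
      finally show "\<bar>\<Phi> s t\<bar> \<le> e * (t - s)" .
    qed
  qed
  moreover have "(LBINT u:{a<..b}. exp (- r * max 0 u) * (g u - r * U u))
      = (LBINT u:{a<..b}. exp (- r * u) * (g u - r * U u))"
    using a0 by (intro set_lebesgue_integral_cong) auto
  ultimately show ?thesis by (simp add: \<Phi>_def)
qed

section \<open>Test functions\<close>

text \<open>
  Test functions for the Ito formula. Uniform continuity of the second derivative makes the Taylor
  remainder small uniformly in the base point, hence uniformly over the positions of a process.
\<close>

locale bounded_C2 =
  fixes f f' f'' :: "real \<Rightarrow> real" and L :: real
  assumes f_deriv: "(f has_real_derivative f' z) (at z)"
    and f'_deriv: "(f' has_real_derivative f'' z) (at z)"
    and f_bound: "\<bar>f z\<bar> \<le> L" and f'_bound: "\<bar>f' z\<bar> \<le> L" and f''_bound: "\<bar>f'' z\<bar> \<le> L"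
    and f''_uniform: "uniformly_continuous_on UNIV f''"
begin

lemma L_nonneg: "L \<ge> 0"
  using f_bound[of 0] by simp

lemma f_measurable [measurable]: "f \<in> borel_measurable borel"
  by (intro borel_measurable_continuous_onI DERIV_continuous_on[where D=f'])
    (auto intro: has_field_derivative_at_within f_deriv)

lemma f'_measurable [measurable]: "f' \<in> borel_measurable borel"
  by (intro borel_measurable_continuous_onI DERIV_continuous_on[where D=f''])
    (auto intro: has_field_derivative_at_within f'_deriv)

lemma f''_measurable [measurable]: "f'' \<in> borel_measurable borel"
  by (intro borel_measurable_continuous_onI uniformly_continuous_imp_continuous f''_uniform)

lemma f_lipschitz: "\<bar>f y - f z\<bar> \<le> L * \<bar>y - z\<bar>"
  using field_differentiable_bound[of UNIV f f' L y z] f_deriv f'_bound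
  by (auto intro: has_field_derivative_at_within)

lemma f'_lipschitz: "\<bar>f' y - f' z\<bar> \<le> L * \<bar>y - z\<bar>"
  using field_differentiable_bound[of UNIV f' f'' L y z] f'_deriv f''_bound
  by (auto intro: has_field_derivative_at_within)

text \<open>
  A modulus of continuity of \<open>f''\<close>, up to a small constant, in two forms: the quadratic one is made for
  taking moments, the truncated linear one for convergence in probability.
\<close>

lemma f''_modulus:
  assumes "\<delta> > 0"
  obtains K where "K \<ge> 0" "\<And>y z. \<bar>f'' y - f'' z\<bar> \<le> \<delta> + K * (y - z)\<^sup>2"
    "\<And>y z. \<bar>f'' y - f'' z\<bar> \<le> \<delta> + K * min 1 \<bar>y - z\<bar>"
proof -
  obtain d where d: "d > 0" and ud: "\<And>y z. \<bar>y - z\<bar> < d \<Longrightarrow> \<bar>f'' y - f'' z\<bar> < \<delta>"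
    using f''_uniform assms unfolding uniformly_continuous_on_def
    by (metis UNIV_I dist_real_def)
  define d1 where "d1 = min d 1"
  have d1: "d1 > 0" "d1 \<le> 1" "d1 \<le> d" using d by (auto simp: d1_def)
  define K where "K = 2 * L / d1\<^sup>2"
  have K0: "K \<ge> 0" using L_nonneg by (simp add: K_def)
  have K1: "2 * L = K * d1\<^sup>2" "2 * L \<le> K * d1"
  proof -
    show "2 * L = K * d1\<^sup>2" using d1 by (simp add: K_def)
    moreover have "d1\<^sup>2 \<le> d1" using d1 by (simp add: power2_eq_square mult_left_le)
    ultimately show "2 * L \<le> K * d1" using K0 by (simp add: mult_left_mono)
  qed
  have far: "\<bar>f'' y - f'' z\<bar> \<le> 2 * L" for y z using f''_bound[of y] f''_bound[of z] by simp
  show thesis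
  proof (rule that[OF K0])
    fix y z
    show "\<bar>f'' y - f'' z\<bar> \<le> \<delta> + K * (y - z)\<^sup>2"
    proof (cases "\<bar>y - z\<bar> < d1")
      case True
      then show ?thesis using ud[of y z] d1 K0 by (simp add: add_increasing2)
    next
      case False
      then have "d1\<^sup>2 \<le> (y - z)\<^sup>2" using d1 by (simp add: abs_le_square_iff[symmetric])
      then have "K * d1\<^sup>2 \<le> K * (y - z)\<^sup>2" by (rule mult_left_mono[OF _ K0])
      then show ?thesis using far[of y z] K1 assms by simp
    qed
    show "\<bar>f'' y - f'' z\<bar> \<le> \<delta> + K * min 1 \<bar>y - z\<bar>"
    proof (cases "\<bar>y - z\<bar> < d1")
      case True
      then show ?thesis using ud[of y z] d1 K0 by (simp add: add_increasing2)
    next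
      case False
      then have "d1 \<le> min 1 \<bar>y - z\<bar>" using d1 by simp
      then have "K * d1 \<le> K * min 1 \<bar>y - z\<bar>" by (rule mult_left_mono[OF _ K0])
      then show ?thesis using far[of y z] K1 assms by linarith
    qed
  qed
qed

lemma f_taylor:
  assumes mod: "\<And>y z. \<bar>f'' y - f'' z\<bar> \<le> \<delta> + K * (y - z)\<^sup>2" and K: "K \<ge> 0"
  shows "\<bar>f y - f z - f' z * (y - z) - f'' z * (y - z)\<^sup>2 / 2\<bar> \<le> (\<delta> + K * (y - z)\<^sup>2) * (y - z)\<^sup>2 / 2"
proof (cases "y = z")
  case False
  define diff where "diff m = (if m = (0::nat) then f else if m = 1 then f' else f'')" for m
  have "\<exists>t. (if y < z then y < t \<and> t < z else z < t \<and> t < y) \<and>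
    f y = (\<Sum>m<2. (diff m z / fact m) * (y - z)^m) + (diff 2 t / fact 2) * (y - z)^2"
    using False
    by (intro Taylor[where a="min y z" and b="max y z"])
      (auto simp: diff_def less_2_cases_iff f_deriv f'_deriv)
  then obtain t where t: "if y < z then y < t \<and> t < z else z < t \<and> t < y"
    and eq: "f y = f z + f' z * (y - z) + f'' t / 2 * (y - z)\<^sup>2"
    by (auto simp: diff_def numeral_2_eq_2)
  have "\<bar>t - z\<bar> \<le> \<bar>y - z\<bar>" using t by (auto split: if_splits)
  then have "(t - z)\<^sup>2 \<le> (y - z)\<^sup>2" by (simp add: abs_le_square_iff)
  then have "\<bar>f'' t - f'' z\<bar> \<le> \<delta> + K * (y - z)\<^sup>2"
    using mod[of t z] mult_left_mono[OF _ K] by (meson add_left_mono order_trans)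
  moreover have "f y - f z - f' z * (y - z) - f'' z * (y - z)\<^sup>2 / 2 = (f'' t - f'' z) * ((y - z)\<^sup>2 / 2)"
    by (simp add: eq field_simps)
  ultimately show ?thesis
    using mult_right_mono[of "\<bar>f'' t - f'' z\<bar>" "\<delta> + K * (y - z)\<^sup>2" "(y - z)\<^sup>2 / 2"]
    by (simp only: abs_mult) simp
qed simp

end

section \<open>Continuous processes and Brownian increments\<close>

text \<open>
  With the time rounded down to the grid of mesh \<open>1 / (n + 1)\<close>, the process takes countably many
  measurable sections; continuity of the paths lets the mesh go to \<open>0\<close>.
\<close>

lemma borel_measurable_pair_continuous_process:
  fixes Y :: "real \<Rightarrow> 'a \<Rightarrow> real"
  assumes meas: "\<And>t. Y t \<in> borel_measurable N"
    and cont: "\<And>\<omega>. \<omega> \<in> space N \<Longrightarrow> continuous_on UNIV (\<lambda>t. Y t \<omega>)"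
  shows "(\<lambda>(\<omega>, t). Y t \<omega>) \<in> borel_measurable (N \<Otimes>\<^sub>M borel)"
proof -
  define q where "q n t = real_of_int \<lfloor>real (Suc n) * t\<rfloor> / real (Suc n)" for n and t :: real
  have q: "(\<lambda>n. q n t) \<longlonglongrightarrow> t" for t
  proof (rule LIMSEQ_I)
    fix e :: real assume "e > 0"
    then obtain n0 where n0: "1 / real (Suc n0) < e" using nat_approx_posE by blast
    have "norm (q n t - t) < e" if "n \<ge> n0" for n
    proof -
      have "\<bar>q n t - t\<bar> \<le> 1 / real (Suc n)"
      proof -
        have "q n t - t = (real_of_int \<lfloor>real (Suc n) * t\<rfloor> - real (Suc n) * t) / real (Suc n)"
          unfolding q_def by (simp add: diff_divide_distrib)
        moreover have "\<bar>real_of_int \<lfloor>real (Suc n) * t\<rfloor> - real (Suc n) * t\<bar> \<le> 1"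
          by linarith
        ultimately show ?thesis by (simp add: divide_right_mono)
      qed
      also have "\<dots> \<le> 1 / real (Suc n0)" using that by (simp add: frac_le)
      finally show ?thesis using n0 by simp
    qed
    then show "\<exists>no. \<forall>n\<ge>no. norm (q n t - t) < e" by blast
  qed
  show ?thesis
  proof (rule borel_measurable_LIMSEQ_real)
    fix p assume "p \<in> space (N \<Otimes>\<^sub>M (borel :: real measure))"
    then have "fst p \<in> space N" by (auto simp: space_pair_measure)
    then have "isCont (\<lambda>t. Y t (fst p)) (snd p)"
      using cont by (auto simp: continuous_on_eq_continuous_at)
    then have "(\<lambda>n. Y (q n (snd p)) (fst p)) \<longlonglongrightarrow> Y (snd p) (fst p)"
      by (rule isCont_tendsto_compose[OF _ q])
    then show "(\<lambda>n. Y (q n (snd p)) (fst p)) \<longlonglongrightarrow> (case p of (\<omega>, t) \<Rightarrow> Y t \<omega>)"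
      by (simp add: case_prod_beta)
  next
    fix n
    have "(\<lambda>p. Y (real_of_int i / real (Suc n)) (fst p)) \<in> borel_measurable (N \<Otimes>\<^sub>M borel)" for i :: int
      using meas by measurable
    then show "(\<lambda>p. Y (q n (snd p)) (fst p)) \<in> borel_measurable (N \<Otimes>\<^sub>M borel)"
      unfolding q_def
      by (rule measurable_compose_countable'[where I=UNIV and f="\<lambda>i p. Y (real_of_int i / real (Suc n)) (fst p)"]) 
        (auto intro: measurable_compose[OF measurable_snd])
  qed
qed

lemma Int_stable_vimages: "Int_stable {X -` A \<inter> S | A. A \<in> sets N}"
proof (rule Int_stableI)
  fix a b assume "a \<in> {X -` A \<inter> S | A. A \<in> sets N}" "b \<in> {X -` A \<inter> S | A. A \<in> sets N}"
  then obtain A A' where "a = X -` A \<inter> S" "A \<in> sets N" "b = X -` A' \<inter> S" "A' \<in> sets N" by auto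
  then have "a \<inter> b = X -` (A \<inter> A') \<inter> S" "A \<inter> A' \<in> sets N" by auto
  then show "a \<inter> b \<in> {X -` A \<inter> S | A. A \<in> sets N}" by blast
qed

context brownian_basis
begin

lemma measurable_F_M: "g \<in> borel_measurable (F (ennreal s)) \<Longrightarrow> g \<in> borel_measurable M"
  using measurable_mono[OF subset_refl refl filtration_le[of s]] space_F[of "ennreal s"] by auto

lemma measurable_F_mono:
  "s \<le> t \<Longrightarrow> g \<in> borel_measurable (F (ennreal s)) \<Longrightarrow> g \<in> borel_measurable (F (ennreal t))"
  using measurable_mono[OF subset_refl refl sets_F_mono[of "ennreal s" "ennreal t"]] space_F
  by (auto simp: ennreal_leI)

lemma sets_F_M: "A \<in> sets (F (ennreal s)) \<Longrightarrow> A \<in> sets M"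
  using filtration_le[of s] by auto

lemma B_measurable_F: "0 \<le> t \<Longrightarrow> B t \<in> borel_measurable (F (ennreal t))"
  using B_adapted by (auto simp: adapted_def)

lemma B_measurable: "0 \<le> t \<Longrightarrow> B t \<in> borel_measurable M"
  using B_measurable_F measurable_F_M by blast

lemma increment_integrable_power:
  assumes "0 \<le> s" "s \<le> t"
  shows "integrable M (\<lambda>\<omega>. (B t \<omega> - B s \<omega>) ^ k)"
proof (cases "s = t")
  case True
  then show ?thesis by (cases k) auto
next
  case False
  then have st: "s < t" using assms by simp
  have "integrable lborel (\<lambda>x. normal_density 0 (sqrt (t - s)) x *\<^sub>R x ^ k)"
    using integrable_normal_moment[of "sqrt (t - s)" 0 k] st by simp
  then show ?thesis
    using distributed_integrable[OF B_gaussian[OF assms(1) st], of "\<lambda>x. x ^ k"] by simp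
qed

lemma
  assumes "0 \<le> s" "s \<le> t"
  shows increment_mean: "(\<integral>\<omega>. B t \<omega> - B s \<omega> \<partial>M) = 0"
    and increment_variance: "(\<integral>\<omega>. (B t \<omega> - B s \<omega>)\<^sup>2 \<partial>M) = t - s"
    and increment_fourth_moment: "(\<integral>\<omega>. (B t \<omega> - B s \<omega>) ^ 4 \<partial>M) = 3 * (t - s)\<^sup>2"
proof -
  have "(\<integral>\<omega>. B t \<omega> - B s \<omega> \<partial>M) = 0 \<and> (\<integral>\<omega>. (B t \<omega> - B s \<omega>)\<^sup>2 \<partial>M) = t - s
    \<and> (\<integral>\<omega>. (B t \<omega> - B s \<omega>) ^ 4 \<partial>M) = 3 * (t - s)\<^sup>2"
  proof (cases "s = t")
    case False
    then have st: "s < t" using assms by simp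
    then have p: "sqrt (t - s) > 0" by simp
    note D = distributed_integral[OF B_gaussian[OF assms(1) st], symmetric]
    have "(\<integral>\<omega>. (B t \<omega> - B s \<omega>) ^ 1 \<partial>M) = 0"
      using integral_normal_moment_odd[OF p, of 0 0] by (subst D) auto
    moreover have "(\<integral>\<omega>. (B t \<omega> - B s \<omega>) ^ 2 \<partial>M) = t - s"
      using integral_normal_moment_even[OF p, of 0 1] st by (subst D) auto
    moreover have "(\<integral>\<omega>. (B t \<omega> - B s \<omega>) ^ 4 \<partial>M) = 3 * (t - s)\<^sup>2"
      using integral_normal_moment_even[OF p, of 0 2] st
      by (subst D) (auto simp: fact_numeral power_divide field_simps)
    ultimately show ?thesis by simp
  qed auto
  then show "(\<integral>\<omega>. B t \<omega> - B s \<omega> \<partial>M) = 0" "(\<integral>\<omega>. (B t \<omega> - B s \<omega>)\<^sup>2 \<partial>M) = t - s"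
    "(\<integral>\<omega>. (B t \<omega> - B s \<omega>) ^ 4 \<partial>M) = 3 * (t - s)\<^sup>2" by auto
qed

text \<open>
  Brownian increments after \<open>s\<close> are independent of what is known at \<open>s\<close>; the Taylor expansion below
  uses this for the powers \<open>k = 1\<close> and \<open>k = 2\<close>.
\<close>

lemma increment_indep_integral:
  assumes st: "0 \<le> s" "s \<le> t" and \<xi>: "\<xi> \<in> borel_measurable (F (ennreal s))" "integrable M \<xi>"
  shows "integrable M (\<lambda>\<omega>. \<xi> \<omega> * (B t \<omega> - B s \<omega>) ^ k)"
    and "(\<integral>\<omega>. \<xi> \<omega> * (B t \<omega> - B s \<omega>) ^ k \<partial>M) = (\<integral>\<omega>. \<xi> \<omega> \<partial>M) * (\<integral>\<omega>. (B t \<omega> - B s \<omega>) ^ k \<partial>M)"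
proof -
  have "integrable M (\<lambda>\<omega>. \<xi> \<omega> * (B t \<omega> - B s \<omega>) ^ k) \<and>
    (\<integral>\<omega>. \<xi> \<omega> * (B t \<omega> - B s \<omega>) ^ k \<partial>M) = (\<integral>\<omega>. \<xi> \<omega> \<partial>M) * (\<integral>\<omega>. (B t \<omega> - B s \<omega>) ^ k \<partial>M)"
  proof (cases "s = t")
    case True
    show ?thesis using \<xi> True by (cases k) (auto simp: prob_space)
  next
    case False
    then have lt: "s < t" using st by simp
    let ?b = "\<lambda>\<omega>. B t \<omega> - B s \<omega>"
    have [measurable]: "?b \<in> borel_measurable M" using B_measurable st by auto
    have bk: "(\<lambda>\<omega>. ?b \<omega> ^ k) \<in> borel_measurable M" by measurable
    have ind: "indep_var borel \<xi> borel (\<lambda>\<omega>. ?b \<omega> ^ k)"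
      unfolding indep_var_eq
    proof (intro conjI indep_set_sigma_sets)
      show "random_variable borel \<xi>" using \<xi> by auto
      show "random_variable borel (\<lambda>\<omega>. ?b \<omega> ^ k)" by (rule bk)
      show "indep_set {\<xi> -` A \<inter> space M |A. A \<in> sets borel} {(\<lambda>\<omega>. ?b \<omega> ^ k) -` A \<inter> space M |A. A \<in> sets borel}"
      proof (rule indep_setI)
        show "{\<xi> -` A \<inter> space M |A. A \<in> sets borel} \<subseteq> events"
          using \<xi> by (auto intro: measurable_sets)
        show "{(\<lambda>\<omega>. ?b \<omega> ^ k) -` A \<inter> space M |A. A \<in> sets borel} \<subseteq> events"
          using bk by (auto intro: measurable_sets)
        fix a b assume "a \<in> {\<xi> -` A \<inter> space M |A. A \<in> sets borel}"
          and "b \<in> {(\<lambda>\<omega>. ?b \<omega> ^ k) -` A \<inter> space M |A. A \<in> sets borel}"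
        then obtain A A' where a: "a = \<xi> -` A \<inter> space M" "A \<in> sets borel"
          and b: "b = (\<lambda>\<omega>. ?b \<omega> ^ k) -` A' \<inter> space M" "A' \<in> sets borel" by auto
        have "a \<in> sets (F (ennreal s))"
          using measurable_sets[OF \<xi>(1) a(2)] a(1) by (simp add: space_F)
        moreover have "(\<lambda>x::real. x ^ k) -` A' \<in> sets borel"
          using b(2) measurable_sets[of "\<lambda>x::real. x ^ k" borel borel A'] by simp
        then have "b \<in> sets (vimage_algebra (space M) ?b borel)"
          using in_vimage_algebra[of "(\<lambda>x. x ^ k) -` A'" borel ?b "space M"] b(1)
          by (simp add: vimage_def)
        ultimately show "prob (a \<inter> b) = prob a * prob b"
          by (rule indep_setD[OF B_indep[OF st(1) lt]])
      qed
      show "Int_stable {\<xi> -` A \<inter> space M |A. A \<in> sets borel}"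
        "Int_stable {(\<lambda>\<omega>. ?b \<omega> ^ k) -` A \<inter> space M |A. A \<in> sets borel}"
        by (rule Int_stable_vimages)+
    qed
    show ?thesis
      using indep_var_integrable[OF ind \<xi>(2)] indep_var_lebesgue_integral[OF ind \<xi>(2)]
        increment_integrable_power[OF st, of k] by auto
  qed
  then show "integrable M (\<lambda>\<omega>. \<xi> \<omega> * (B t \<omega> - B s \<omega>) ^ k)"
    and "(\<integral>\<omega>. \<xi> \<omega> * (B t \<omega> - B s \<omega>) ^ k \<partial>M) = (\<integral>\<omega>. \<xi> \<omega> \<partial>M) * (\<integral>\<omega>. (B t \<omega> - B s \<omega>) ^ k \<partial>M)"
    by auto
qed

end

section \<open>Ito's formula on a short interval\<close>

lemma (in prob_space) integrable_bounded:
  fixes g :: "'a \<Rightarrow> real"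
  assumes "\<And>\<omega>. \<omega> \<in> space M \<Longrightarrow> \<bar>g \<omega>\<bar> \<le> q" and "g \<in> borel_measurable M"
  shows "integrable M g"
  by (rule integrable_const_bound[where B=q]) (use assms in auto)

text \<open>
  Everything that Fubini's theorem says about a bounded, jointly measurable process on a bounded time
  interval, in one place because the parts are always used together.
\<close>

lemma (in prob_space) bounded_time_integral:
  fixes g :: "real \<Rightarrow> 'a \<Rightarrow> real"
  assumes g: "(\<lambda>p. g (fst p) (snd p)) \<in> borel_measurable (borel \<Otimes>\<^sub>M M)"
    and gball: "\<forall>u. \<forall>\<omega>\<in>space M. \<bar>g u \<omega>\<bar> \<le> K"
  shows expectation_measurable_time: "(\<lambda>u. \<integral>\<omega>. g u \<omega> \<partial>M) \<in> borel_measurable borel"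
    and expectation_bounded: "\<bar>\<integral>\<omega>. g u \<omega> \<partial>M\<bar> \<le> K"
    and integrable_at_time: "integrable M (g u)"
    and time_integral_measurable: "(\<lambda>\<omega>. LBINT u:{s<..t}. g u \<omega>) \<in> borel_measurable M"
    and fubini_time_integral:
      "(\<integral>\<omega>. (LBINT u:{s<..t}. g u \<omega>) \<partial>M) = (LBINT u:{s<..t}. (\<integral>\<omega>. g u \<omega> \<partial>M))"
    and set_integrable_path: "\<omega> \<in> space M \<Longrightarrow> set_integrable lborel {s<..t} (\<lambda>u. g u \<omega>)"
proof -
  have gb: "\<bar>g u \<omega>\<bar> \<le> K" if "\<omega> \<in> space M" for u \<omega> using gball that by blast
  have "K \<ge> 0" using gb not_empty by (metis abs_ge_zero order_trans ex_in_conv)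
  have g': "(\<lambda>p. g (snd p) (fst p)) \<in> borel_measurable (M \<Otimes>\<^sub>M borel)"
    using measurable_compose[OF measurable_Pair[OF measurable_snd measurable_fst] g] by simp
  show "(\<lambda>u. \<integral>\<omega>. g u \<omega> \<partial>M) \<in> borel_measurable borel"
    by (rule borel_measurable_lebesgue_integral) (use g in \<open>simp add: split_beta'\<close>)
  have gu: "g u \<in> borel_measurable M" for u
    using measurable_compose[OF measurable_Pair1'[of u borel M] g] by simp
  show int: "integrable M (g u)" for u
    by (rule integrable_const_bound[where B=K]) (use gu gb in auto)
  show "\<bar>\<integral>\<omega>. g u \<omega> \<partial>M\<bar> \<le> K" for u
  proof -
    have "\<bar>\<integral>\<omega>. g u \<omega> \<partial>M\<bar> \<le> (\<integral>\<omega>. \<bar>g u \<omega>\<bar> \<partial>M)" by (rule integral_abs_bound)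
    also have "\<dots> \<le> (\<integral>\<omega>. K \<partial>M)" using gb int by (intro integral_mono) auto
    finally show ?thesis by (simp add: prob_space)
  qed
  show "\<omega> \<in> space M \<Longrightarrow> set_integrable lborel {s<..t} (\<lambda>u. g u \<omega>)"
    using measurable_compose[OF measurable_Pair1'[of \<omega> M borel] g'] gb
    by (intro set_integrable_bounded_Ioc[where K=K]) auto
  interpret L: pair_sigma_finite lborel M ..
  have m: "(\<lambda>p. indicator {s<..t} (fst p) * g (fst p) (snd p)) \<in> borel_measurable (lborel \<Otimes>\<^sub>M M)"
  proof -
    have "(\<lambda>p. indicator {s<..t} (fst p) * g (fst p) (snd p)) \<in> borel_measurable (borel \<Otimes>\<^sub>M M)"
      using g by measurable
    then show ?thesis by (simp cong: measurable_cong_sets)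
  qed
  have fin: "emeasure (lborel \<Otimes>\<^sub>M M) ({s<..t} \<times> space M) < \<infinity>"
    by (subst emeasure_pair_measure_Times)
      (auto simp: emeasure_space_1 intro!: emeasure_bounded_finite[simplified])
  have I: "integrable (lborel \<Otimes>\<^sub>M M) (\<lambda>p. indicator {s<..t} (fst p) * g (fst p) (snd p))"
  proof (rule Bochner_Integration.integrable_bound[OF _ m])
    show "integrable (lborel \<Otimes>\<^sub>M M) (\<lambda>p. K * indicator ({s<..t} \<times> space M) p)"
      using fin by (intro integrable_mult_right integrable_real_indicator) auto
    show "AE p in lborel \<Otimes>\<^sub>M M. norm (indicator {s<..t} (fst p) * g (fst p) (snd p))
        \<le> norm (K * indicator ({s<..t} \<times> space M) p)"
      using gb \<open>K \<ge> 0\<close> by (intro AE_I2) (auto simp: space_pair_measure indicator_def)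
  qed
  have "(\<integral>\<omega>. (\<integral>u. indicator {s<..t} u * g u \<omega> \<partial>lborel) \<partial>M) = (\<integral>u. (\<integral>\<omega>. indicator {s<..t} u * g u \<omega> \<partial>M) \<partial>lborel)"
    using I by (intro L.Fubini_integral) (simp add: split_beta')
  then show "(\<integral>\<omega>. (LBINT u:{s<..t}. g u \<omega>) \<partial>M) = (LBINT u:{s<..t}. (\<integral>\<omega>. g u \<omega> \<partial>M))"
    by (simp add: set_lebesgue_integral_def)
  show "(\<lambda>\<omega>. LBINT u:{s<..t}. g u \<omega>) \<in> borel_measurable M"
    unfolding set_lebesgue_integral_def
    by (rule lborel.borel_measurable_lebesgue_integral) 
      (use g' in \<open>simp add: split_beta' cong: measurable_cong_sets\<close>, measurable)
qed

text \<open>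
  Replaces the Cauchy--Schwarz bound for \<open>E \<bar>y\<bar>\<close> and keeps square roots out of the estimates.
\<close>

lemma abs_le_add_square:
  fixes y :: real
  assumes "\<delta> > 0"
  shows "\<bar>y\<bar> \<le> \<delta> + y\<^sup>2 / \<delta>"
proof -
  have "0 \<le> (\<bar>y\<bar> - \<delta>)\<^sup>2 + \<bar>y\<bar> * \<delta>" using assms by simp
  then have "\<bar>y\<bar> * \<delta> \<le> \<delta>\<^sup>2 + y\<^sup>2" by (simp add: power2_diff algebra_simps)
  then show ?thesis using assms by (simp add: field_simps power2_eq_square)
qed

lemma taylor_rearrange:
  fixes i F p q D z b y :: real
  assumes "y = D + z * b"
  shows "i * F - i * p * D - (i * p * z) * b ^ 1 - (i * q * z\<^sup>2 / 2) * b ^ 2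
    = i * ((F - p * y - q * y\<^sup>2 / 2) + q * (y\<^sup>2 - (z * b)\<^sup>2) / 2)"
  by (simp add: assms field_simps power_mult_distrib)

context brownian_basis
begin

text \<open>
  Ito's formula on one short interval on which the diffusion coefficient is frozen at \<open>\<zeta>\<close>, up to an
  error. In the Taylor expansion of \<open>f\<close> at \<open>Z s\<close> the term linear in the Brownian increment has mean \<open>0\<close>,
  the quadratic one has mean proportional to \<open>t - s\<close>, and the remainder is governed by second and fourth
  moments of the increment. The constants do not depend on \<open>s\<close>, \<open>t\<close>, \<open>A\<close> or \<open>\<zeta>\<close>: with \<open>\<delta>\<close> chosen first
  and \<open>t - s\<close> afterwards, the error is of smaller order than \<open>t - s\<close>.
\<close>

lemma ito_small_interval:
  assumes test: "bounded_C2 f f' f'' L"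
    and \<delta>: "0 < \<delta>" and K: "0 \<le> K" and mod: "\<And>y z. \<bar>f'' y - f'' z\<bar> \<le> \<delta> + K * (y - z)\<^sup>2"
    and st: "0 \<le> s" "s \<le> t" "t - s \<le> 1" and A: "A \<in> sets (F (ennreal s))"
    and \<zeta>: "\<zeta> \<in> borel_measurable (F (ennreal s))" and \<zeta>b: "\<And>\<omega>. \<omega> \<in> space M \<Longrightarrow> \<bar>\<zeta> \<omega>\<bar> \<le> C"
    and \<beta>: "(\<lambda>p. \<beta> (fst p) (snd p)) \<in> borel_measurable (borel \<Otimes>\<^sub>M M)"
    and \<beta>b: "\<And>u \<omega>. \<omega> \<in> space M \<Longrightarrow> \<bar>\<beta> u \<omega>\<bar> \<le> C"
    and Zs: "Z s \<in> borel_measurable (F (ennreal s))"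
    and Z: "(\<lambda>p. Z (fst p) (snd p)) \<in> borel_measurable (borel \<Otimes>\<^sub>M M)"
    and Zinc: "\<And>u \<omega>. s \<le> u \<Longrightarrow> u \<le> t \<Longrightarrow> \<omega> \<in> space M \<Longrightarrow>
      Z u \<omega> = Z s \<omega> + (LBINT v:{s<..u}. \<beta> v \<omega>) + \<zeta> \<omega> * (B u \<omega> - B s \<omega>)"
  shows "\<bar>(\<integral>\<omega>. indicator A \<omega> * (f (Z t \<omega>) - f (Z s \<omega>)) \<partial>M)
      - (LBINT u:{s<..t}. \<integral>\<omega>. indicator A \<omega> * (f' (Z u \<omega>) * \<beta> u \<omega> + f'' (Z u \<omega>) * (\<zeta> \<omega>)\<^sup>2 / 2) \<partial>M)\<bar>
    \<le> (t - s) * ((3 * C\<^sup>2 + L * C\<^sup>2 + L * C) * \<delta>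
        + (18 * K * C ^ 4 + L * C\<^sup>2 / \<delta> + L * C\<^sup>2 + 4 * L * C ^ 3 / \<delta>) * (t - s))"
proof -
  interpret bounded_C2 f f' f'' L by (rule test)
  define d where "d = t - s"
  have d: "0 \<le> d" "d \<le> 1" using st by (auto simp: d_def)
  have C0: "C \<ge> 0" using \<zeta>b not_empty by (metis abs_ge_zero order_trans ex_in_conv)
  define b where "b u \<omega> = B u \<omega> - B s \<omega>" for u \<omega>
  have [measurable]: "A \<in> sets M" "\<zeta> \<in> borel_measurable M" "Z s \<in> borel_measurable M"
    using A \<zeta> Zs sets_F_M measurable_F_M by blast+
  have Zu[measurable]: "Z u \<in> borel_measurable M" for u
    using measurable_compose[OF measurable_Pair1'[of u borel M] Z] by simp
  have \<beta>u[measurable]: "\<beta> u \<in> borel_measurable M" for u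
    using measurable_compose[OF measurable_Pair1'[of u borel M] \<beta>] by simp
  note [measurable] = \<beta> Z
  have \<beta>ball: "\<forall>u. \<forall>\<omega>\<in>space M. \<bar>\<beta> u \<omega>\<bar> \<le> C" using \<beta>b by blast
  note \<beta>int = bounded_time_integral[OF \<beta> \<beta>ball]
  define D where "D u \<omega> = (LBINT v:{s<..u}. \<beta> v \<omega>)" for u \<omega>
  have Dm[measurable]: "D u \<in> borel_measurable M" for u
    unfolding D_def by (rule \<beta>int(4))
  have Db: "\<bar>D u \<omega>\<bar> \<le> C * (u - s)" if "s \<le> u" "\<omega> \<in> space M" for u \<omega>
    unfolding D_def using that by (intro set_integral_abs_le \<beta>int(6) \<beta>b) auto
  have Ds: "\<bar>D u \<omega>\<bar> \<le> C * d" if "s \<le> u" "u \<le> t" "\<omega> \<in> space M" for u \<omega>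
    using Db[OF that(1,3)] mult_left_mono[of "u - s" d C] that C0 by (simp add: d_def)
  have inc: "Z u \<omega> - Z s \<omega> = D u \<omega> + \<zeta> \<omega> * b u \<omega>" if "s \<le> u" "u \<le> t" "\<omega> \<in> space M" for u \<omega>
    using Zinc[OF that] by (simp add: D_def b_def)
  have bm: "b u \<in> borel_measurable M" if "s \<le> u" for u
    using that st B_measurable[of u] B_measurable[of s] unfolding b_def by auto
  have b2: "integrable M (\<lambda>\<omega>. (b u \<omega>)\<^sup>2)" "(\<integral>\<omega>. (b u \<omega>)\<^sup>2 \<partial>M) = u - s" if "s \<le> u" for u
    using increment_integrable_power[of s u 2] increment_variance[of s u] st that by (auto simp: b_def)
  have b4: "integrable M (\<lambda>\<omega>. (b t \<omega>) ^ 4)" "(\<integral>\<omega>. (b t \<omega>) ^ 4 \<partial>M) = 3 * d\<^sup>2"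
    using increment_integrable_power[of s t 4] increment_fourth_moment[of s t] st by (auto simp: b_def d_def)
  have sq: "(Z u \<omega> - Z s \<omega>)\<^sup>2 \<le> 2 * C\<^sup>2 * d\<^sup>2 + 2 * C\<^sup>2 * (b u \<omega>)\<^sup>2" if "s \<le> u" "u \<le> t" "\<omega> \<in> space M" for u \<omega>
  proof -
    have "(D u \<omega>)\<^sup>2 \<le> (C * d)\<^sup>2" using Ds[OF that] C0 d by (simp add: abs_le_square_iff[symmetric])
    moreover have "(\<zeta> \<omega> * b u \<omega>)\<^sup>2 \<le> C\<^sup>2 * (b u \<omega>)\<^sup>2"
      unfolding power_mult_distrib using \<zeta>b[OF that(3)] C0
      by (intro mult_right_mono) (auto simp: abs_le_square_iff[symmetric])
    moreover have "(D u \<omega> + \<zeta> \<omega> * b u \<omega>)\<^sup>2 \<le> 2 * (D u \<omega>)\<^sup>2 + 2 * (\<zeta> \<omega> * b u \<omega>)\<^sup>2"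
      using sum_squares_bound[of "D u \<omega>" "\<zeta> \<omega> * b u \<omega>"] by (simp add: power2_sum)
    ultimately show ?thesis unfolding inc[OF that] by (simp add: power_mult_distrib)
  qed
  have Esq: "integrable M (\<lambda>\<omega>. (Z u \<omega> - Z s \<omega>)\<^sup>2)" "(\<integral>\<omega>. (Z u \<omega> - Z s \<omega>)\<^sup>2 \<partial>M) \<le> 4 * C\<^sup>2 * d"
    if u: "s \<le> u" "u \<le> t" for u
  proof -
    have I: "integrable M (\<lambda>\<omega>. 2 * C\<^sup>2 * d\<^sup>2 + 2 * C\<^sup>2 * (b u \<omega>)\<^sup>2)" using b2[OF u(1)] by auto
    show I2: "integrable M (\<lambda>\<omega>. (Z u \<omega> - Z s \<omega>)\<^sup>2)"
      by (rule Bochner_Integration.integrable_bound[OF I]) (use sq[OF u] in \<open>auto intro!: AE_I2 order_trans[OF _ abs_ge_self]\<close>)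
    have "(\<integral>\<omega>. (Z u \<omega> - Z s \<omega>)\<^sup>2 \<partial>M) \<le> (\<integral>\<omega>. 2 * C\<^sup>2 * d\<^sup>2 + 2 * C\<^sup>2 * (b u \<omega>)\<^sup>2 \<partial>M)"
      using I I2 sq[OF u] by (intro integral_mono) auto
    also have "\<dots> = 2 * C\<^sup>2 * d\<^sup>2 + 2 * C\<^sup>2 * (u - s)"
      using b2[OF u(1)] by (simp add: prob_space)
    also have "\<dots> \<le> 2 * C\<^sup>2 * d + 2 * C\<^sup>2 * d"
      using d u by (intro add_mono mult_left_mono) (auto simp: power2_eq_square mult_left_le d_def)
    finally show "(\<integral>\<omega>. (Z u \<omega> - Z s \<omega>)\<^sup>2 \<partial>M) \<le> 4 * C\<^sup>2 * d" by (simp add: mult.commute mult.left_commute)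
  qed
  \<comment> \<open>Taylor expansion at the left end point, with all terms that do not cancel put in the error.\<close>
  define N where "N \<omega> = indicator A \<omega> * (f (Z t \<omega>) - f (Z s \<omega>)) - indicator A \<omega> * f' (Z s \<omega>) * D t \<omega>
      - (indicator A \<omega> * f' (Z s \<omega>) * \<zeta> \<omega>) * (b t \<omega>) ^ 1
      - (indicator A \<omega> * f'' (Z s \<omega>) * (\<zeta> \<omega>)\<^sup>2 / 2) * (b t \<omega>) ^ 2" for \<omega>
  \<comment> \<open>The pathwise bound of the Taylor error, sorted by powers of the Brownian increment.\<close>
  define Nb where "Nb \<omega> = (\<delta> * C\<^sup>2 * d\<^sup>2 + 4 * K * C ^ 4 * d ^ 4 + L * C\<^sup>2 * d * \<delta> + L * C\<^sup>2 * d\<^sup>2)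
      + (\<delta> * C\<^sup>2 + L * C\<^sup>2 * d / \<delta>) * (b t \<omega>)\<^sup>2 + 4 * K * C ^ 4 * (b t \<omega>) ^ 4" for \<omega>
  have NNb: "\<bar>N \<omega>\<bar> \<le> Nb \<omega>" if \<omega>: "\<omega> \<in> space M" for \<omega>
  proof -
    define y where "y = Z t \<omega> - Z s \<omega>"
    have y: "y = D t \<omega> + \<zeta> \<omega> * b t \<omega>" using inc[of t] st \<omega> by (simp add: y_def)
    have y2: "y\<^sup>2 \<le> 2 * C\<^sup>2 * d\<^sup>2 + 2 * C\<^sup>2 * (b t \<omega>)\<^sup>2" using sq[of t] st \<omega> by (simp add: y_def)
    have "(y\<^sup>2)\<^sup>2 \<le> (2 * C\<^sup>2 * d\<^sup>2 + 2 * C\<^sup>2 * (b t \<omega>)\<^sup>2)\<^sup>2" using y2 by (intro power_mono) auto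
    also have "\<dots> \<le> 2 * (2 * C\<^sup>2 * d\<^sup>2)\<^sup>2 + 2 * (2 * C\<^sup>2 * (b t \<omega>)\<^sup>2)\<^sup>2"
      using sum_squares_bound[of "2 * C\<^sup>2 * d\<^sup>2" "2 * C\<^sup>2 * (b t \<omega>)\<^sup>2"] unfolding power2_sum by linarith
    also have "\<dots> = 8 * C ^ 4 * d ^ 4 + 8 * C ^ 4 * (b t \<omega>) ^ 4"
      by (simp add: power_mult_distrib power_mult[symmetric])
    finally have y4: "(y\<^sup>2)\<^sup>2 \<le> 8 * C ^ 4 * d ^ 4 + 8 * C ^ 4 * (b t \<omega>) ^ 4" .
    have ty: "\<bar>f (Z t \<omega>) - f (Z s \<omega>) - f' (Z s \<omega>) * y - f'' (Z s \<omega>) * y\<^sup>2 / 2\<bar> \<le> (\<delta> + K * y\<^sup>2) * y\<^sup>2 / 2"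
      unfolding y_def by (rule f_taylor[OF mod K])
    have e1: "(\<delta> + K * y\<^sup>2) * y\<^sup>2 / 2 \<le> \<delta> * C\<^sup>2 * d\<^sup>2 + \<delta> * C\<^sup>2 * (b t \<omega>)\<^sup>2 + (4 * K * C ^ 4 * d ^ 4 + 4 * K * C ^ 4 * (b t \<omega>) ^ 4)"
      using mult_left_mono[OF y2, of "\<delta> / 2"] mult_left_mono[OF y4, of "K / 2"] \<delta> K
      by (simp add: algebra_simps power2_eq_square)
    have Dt: "\<bar>D t \<omega>\<bar> \<le> C * d" using Ds[of t] st \<omega> by simp
    have "\<bar>D t \<omega> * (\<zeta> \<omega> * b t \<omega>)\<bar> \<le> (C * d) * (C * (\<delta> + (b t \<omega>)\<^sup>2 / \<delta>))"
      unfolding abs_mult using Dt \<zeta>b[OF \<omega>] abs_le_add_square[OF \<delta>, of "b t \<omega>"] C0 d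
      by (intro mult_mono) auto
    moreover have "(D t \<omega>)\<^sup>2 \<le> (C * d)\<^sup>2" using Dt C0 d by (simp add: abs_le_square_iff[symmetric])
    moreover have "y\<^sup>2 - (\<zeta> \<omega> * b t \<omega>)\<^sup>2 = (D t \<omega>)\<^sup>2 + 2 * (D t \<omega> * (\<zeta> \<omega> * b t \<omega>))"
      unfolding y power2_sum by simp
    moreover have "0 \<le> (D t \<omega>)\<^sup>2" by simp
    ultimately have "\<bar>y\<^sup>2 - (\<zeta> \<omega> * b t \<omega>)\<^sup>2\<bar> \<le> 2 * ((C * d) * (C * (\<delta> + (b t \<omega>)\<^sup>2 / \<delta>))) + (C * d)\<^sup>2"
      by linarith
    then have bound_e2: "\<bar>f'' (Z s \<omega>)\<bar> * \<bar>y\<^sup>2 - (\<zeta> \<omega> * b t \<omega>)\<^sup>2\<bar> \<le> L * (2 * ((C * d) * (C * (\<delta> + (b t \<omega>)\<^sup>2 / \<delta>))) + (C * d)\<^sup>2)"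
      using f''_bound L_nonneg by (intro mult_mono) auto
    have e2: "\<bar>f'' (Z s \<omega>) * (y\<^sup>2 - (\<zeta> \<omega> * b t \<omega>)\<^sup>2) / 2\<bar> \<le> L * C\<^sup>2 * d * \<delta> + L * C\<^sup>2 * d / \<delta> * (b t \<omega>)\<^sup>2 + L * C\<^sup>2 * d\<^sup>2"
    proof -
      have "L * (2 * ((C * d) * (C * (\<delta> + (b t \<omega>)\<^sup>2 / \<delta>))) + (C * d)\<^sup>2)
          = 2 * (L * C\<^sup>2 * d * \<delta> + L * C\<^sup>2 * d / \<delta> * (b t \<omega>)\<^sup>2) + L * C\<^sup>2 * d\<^sup>2"
        by (simp add: algebra_simps power2_eq_square)
      moreover have "0 \<le> L * C\<^sup>2 * d\<^sup>2" using L_nonneg by simp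
      moreover have "\<bar>f'' (Z s \<omega>) * (y\<^sup>2 - (\<zeta> \<omega> * b t \<omega>)\<^sup>2) / 2\<bar>
          = \<bar>f'' (Z s \<omega>)\<bar> * \<bar>y\<^sup>2 - (\<zeta> \<omega> * b t \<omega>)\<^sup>2\<bar> / 2"
        unfolding abs_divide abs_mult by simp
      ultimately show ?thesis using bound_e2 by argo
    qed
    have "N \<omega> = indicator A \<omega> * ((f (Z t \<omega>) - f (Z s \<omega>) - f' (Z s \<omega>) * y - f'' (Z s \<omega>) * y\<^sup>2 / 2)
        + f'' (Z s \<omega>) * (y\<^sup>2 - (\<zeta> \<omega> * b t \<omega>)\<^sup>2) / 2)"
      unfolding N_def by (rule taylor_rearrange[OF y])
    then have "\<bar>N \<omega>\<bar> \<le> \<bar>f (Z t \<omega>) - f (Z s \<omega>) - f' (Z s \<omega>) * y - f'' (Z s \<omega>) * y\<^sup>2 / 2\<bar>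
        + \<bar>f'' (Z s \<omega>) * (y\<^sup>2 - (\<zeta> \<omega> * b t \<omega>)\<^sup>2) / 2\<bar>"
      by (auto simp: indicator_def)
    also have "\<dots> \<le> (\<delta> * C\<^sup>2 * d\<^sup>2 + \<delta> * C\<^sup>2 * (b t \<omega>)\<^sup>2 + (4 * K * C ^ 4 * d ^ 4 + 4 * K * C ^ 4 * (b t \<omega>) ^ 4))
        + (L * C\<^sup>2 * d * \<delta> + L * C\<^sup>2 * d / \<delta> * (b t \<omega>)\<^sup>2 + L * C\<^sup>2 * d\<^sup>2)"
      by (rule add_mono[OF order_trans[OF ty e1] e2])
    also have "\<dots> = Nb \<omega>" by (simp only: Nb_def distrib_right)
    finally show ?thesis .
  qed
  have Nbi: "integrable M Nb" unfolding Nb_def using b2[of t] b4 st by auto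
  have Nm: "N \<in> borel_measurable M" unfolding N_def using bm[of t] st by measurable
  have Ni: "integrable M N"
    by (rule Bochner_Integration.integrable_bound[OF Nbi Nm]) (use NNb in \<open>auto intro!: AE_I2 order_trans[OF _ abs_ge_self]\<close>)
  have EN: "\<bar>\<integral>\<omega>. N \<omega> \<partial>M\<bar> \<le> d * ((2 * C\<^sup>2 + L * C\<^sup>2) * \<delta> + (16 * K * C ^ 4 + L * C\<^sup>2 / \<delta> + L * C\<^sup>2) * d)"
  proof -
    have "\<bar>\<integral>\<omega>. N \<omega> \<partial>M\<bar> \<le> (\<integral>\<omega>. \<bar>N \<omega>\<bar> \<partial>M)" by (rule integral_abs_bound)
    also have "\<dots> \<le> (\<integral>\<omega>. Nb \<omega> \<partial>M)" using NNb Ni Nbi by (intro integral_mono) auto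
    also have "\<dots> = (\<delta> * C\<^sup>2 * d\<^sup>2 + 4 * K * C ^ 4 * d ^ 4 + L * C\<^sup>2 * d * \<delta> + L * C\<^sup>2 * d\<^sup>2)
      + (\<delta> * C\<^sup>2 + L * C\<^sup>2 * d / \<delta>) * d + 4 * K * C ^ 4 * (3 * d\<^sup>2)"
      unfolding Nb_def using b2[of t] b4 st by (simp add: prob_space d_def)
    also have "\<dots> \<le> (\<delta> * C\<^sup>2 * d + 4 * K * C ^ 4 * d\<^sup>2 + L * C\<^sup>2 * d * \<delta> + L * C\<^sup>2 * d\<^sup>2)
      + (\<delta> * C\<^sup>2 + L * C\<^sup>2 * d / \<delta>) * d + 4 * K * C ^ 4 * (3 * d\<^sup>2)"
    proof -
      have "d\<^sup>2 \<le> d" "d ^ 4 \<le> d\<^sup>2"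
        using d power_decreasing[of 1 2 d] power_decreasing[of 2 4 d] by auto
      then have "\<delta> * C\<^sup>2 * d\<^sup>2 \<le> \<delta> * C\<^sup>2 * d" "4 * K * C ^ 4 * d ^ 4 \<le> 4 * K * C ^ 4 * d\<^sup>2"
        using \<delta> K by (auto intro!: mult_left_mono)
      then show ?thesis by linarith
    qed
    also have "\<dots> = d * ((2 * C\<^sup>2 + L * C\<^sup>2) * \<delta> + (16 * K * C ^ 4 + L * C\<^sup>2 / \<delta> + L * C\<^sup>2) * d)"
      by (simp add: algebra_simps power2_eq_square)
    finally show ?thesis .
  qed
  have As: "(\<lambda>\<omega>. indicator A \<omega> :: real) \<in> borel_measurable (F (ennreal s))" using A by measurable
  have \<zeta>2: "(\<zeta> \<omega>)\<^sup>2 \<le> C\<^sup>2" if "\<omega> \<in> space M" for \<omega>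
    using \<zeta>b[OF that] C0 by (simp add: abs_le_square_iff[symmetric])
  have i1: "integrable M (\<lambda>\<omega>. indicator A \<omega> * (f (Z t \<omega>) - f (Z s \<omega>)))"
  proof (rule integrable_bounded[where q="2 * L"])
    fix \<omega>
    show "\<bar>indicator A \<omega> * (f (Z t \<omega>) - f (Z s \<omega>))\<bar> \<le> 2 * L"
      using f_bound[of "Z t \<omega>"] f_bound[of "Z s \<omega>"] L_nonneg by (auto simp: indicator_def)
  qed measurable
  have i2: "integrable M (\<lambda>\<omega>. indicator A \<omega> * f' (Z s \<omega>) * D t \<omega>)"
  proof (rule integrable_bounded[where q="L * (C * d)"])
    fix \<omega> assume "\<omega> \<in> space M"
    then show "\<bar>indicator A \<omega> * f' (Z s \<omega>) * D t \<omega>\<bar> \<le> L * (C * d)"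
      using Ds[of t \<omega>] st f'_bound[of "Z s \<omega>"] L_nonneg C0 d
      by (auto simp: indicator_def abs_mult intro!: mult_mono)
  qed measurable
  have x1: "(\<lambda>\<omega>. indicator A \<omega> * f' (Z s \<omega>) * \<zeta> \<omega>) \<in> borel_measurable (F (ennreal s))"
    using As Zs \<zeta> by measurable
  have x1i: "integrable M (\<lambda>\<omega>. indicator A \<omega> * f' (Z s \<omega>) * \<zeta> \<omega>)"
  proof (rule integrable_bounded[where q="L * C"])
    fix \<omega> assume "\<omega> \<in> space M"
    then show "\<bar>indicator A \<omega> * f' (Z s \<omega>) * \<zeta> \<omega>\<bar> \<le> L * C"
      using \<zeta>b[of \<omega>] f'_bound[of "Z s \<omega>"] L_nonneg C0 
      by (auto simp: indicator_def abs_mult intro!: mult_mono)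
  qed measurable
  have x2: "(\<lambda>\<omega>. indicator A \<omega> * f'' (Z s \<omega>) * (\<zeta> \<omega>)\<^sup>2 / 2) \<in> borel_measurable (F (ennreal s))"
    using As Zs \<zeta> by measurable
  have x2i: "integrable M (\<lambda>\<omega>. indicator A \<omega> * f'' (Z s \<omega>) * (\<zeta> \<omega>)\<^sup>2 / 2)"
  proof (rule integrable_bounded[where q="L * C\<^sup>2"])
    fix \<omega> assume w: "\<omega> \<in> space M"
    have "\<bar>f'' (Z s \<omega>)\<bar> * (\<zeta> \<omega>)\<^sup>2 \<le> L * C\<^sup>2" using \<zeta>2[OF w] f''_bound L_nonneg by (intro mult_mono) auto
    then show "\<bar>indicator A \<omega> * f'' (Z s \<omega>) * (\<zeta> \<omega>)\<^sup>2 / 2\<bar> \<le> L * C\<^sup>2"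
      using mult_nonneg_nonneg[OF L_nonneg zero_le_power2[of C]] by (auto simp: indicator_def abs_mult)
  qed measurable
  note J1 = increment_indep_integral[OF st(1,2) x1 x1i, of 1, folded b_def]
  note J2 = increment_indep_integral[OF st(1,2) x2 x2i, of 2, folded b_def]
  have m1: "(\<integral>\<omega>. (b t \<omega>) ^ 1 \<partial>M) = 0" using increment_mean[OF st(1,2)] by (simp add: b_def)
  have m2: "(\<integral>\<omega>. (b t \<omega>) ^ 2 \<partial>M) = d" using b2[of t] st by (simp add: d_def)
  have NE: "(\<integral>\<omega>. N \<omega> \<partial>M) = (\<integral>\<omega>. indicator A \<omega> * (f (Z t \<omega>) - f (Z s \<omega>)) \<partial>M)
      - (\<integral>\<omega>. indicator A \<omega> * f' (Z s \<omega>) * D t \<omega> \<partial>M)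
      - (\<integral>\<omega>. indicator A \<omega> * f'' (Z s \<omega>) * (\<zeta> \<omega>)\<^sup>2 / 2 \<partial>M) * d"
    unfolding N_def using i1 i2 J1 J2 m1 m2
    by (simp add: Bochner_Integration.integral_diff Bochner_Integration.integrable_diff)
  define G0 where "G0 u \<omega> = indicator A \<omega> * f' (Z s \<omega>) * \<beta> u \<omega> + indicator A \<omega> * f'' (Z s \<omega>) * (\<zeta> \<omega>)\<^sup>2 / 2" for u \<omega>
  define G1 where "G1 u \<omega> = indicator A \<omega> * (f' (Z u \<omega>) * \<beta> u \<omega> + f'' (Z u \<omega>) * (\<zeta> \<omega>)\<^sup>2 / 2)" for u \<omega>
  have FB: "\<bar>f' z * \<beta> u \<omega> + f'' z' * (\<zeta> \<omega>)\<^sup>2 / 2\<bar> \<le> L * C + L * C\<^sup>2" if "\<omega> \<in> space M" for u \<omega> z z'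
  proof -
    have "\<bar>f' z * \<beta> u \<omega>\<bar> \<le> L * C" unfolding abs_mult
      using f'_bound \<beta>b[OF that] L_nonneg by (intro mult_mono) auto
    moreover have "\<bar>f'' z' * (\<zeta> \<omega>)\<^sup>2\<bar> \<le> L * C\<^sup>2" unfolding abs_mult
      using f''_bound \<zeta>2[OF that] L_nonneg by (intro mult_mono) auto
    ultimately show ?thesis by linarith
  qed
  have Cb: "L * C + L * C\<^sup>2 \<ge> 0" using L_nonneg C0 by simp
  have G0b: "\<bar>G0 u \<omega>\<bar> \<le> L * C + L * C\<^sup>2" if "\<omega> \<in> space M" for u \<omega>
    using FB[OF that] Cb by (auto simp: G0_def indicator_def)
  have G1b: "\<bar>G1 u \<omega>\<bar> \<le> L * C + L * C\<^sup>2" if "\<omega> \<in> space M" for u \<omega>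
    using FB[OF that] Cb by (auto simp: G1_def indicator_def)
  have G0m: "(\<lambda>p. G0 (fst p) (snd p)) \<in> borel_measurable (borel \<Otimes>\<^sub>M M)" unfolding G0_def by measurable
  have G1m: "(\<lambda>p. G1 (fst p) (snd p)) \<in> borel_measurable (borel \<Otimes>\<^sub>M M)" unfolding G1_def by measurable
  note G0 = bounded_time_integral[of G0, OF G0m, of "L * C + L * C\<^sup>2", OF allI[OF ballI[OF G0b]]]
  note G1 = bounded_time_integral[of G1, OF G1m, of "L * C + L * C\<^sup>2", OF allI[OF ballI[OF G1b]]]
  have "(\<integral>\<omega>. indicator A \<omega> * f' (Z s \<omega>) * D t \<omega> \<partial>M) + (\<integral>\<omega>. indicator A \<omega> * f'' (Z s \<omega>) * (\<zeta> \<omega>)\<^sup>2 / 2 \<partial>M) * d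
      = (\<integral>\<omega>. (LBINT u:{s<..t}. G0 u \<omega>) \<partial>M)"
  proof -
    have "(LBINT u:{s<..t}. G0 u \<omega>) = indicator A \<omega> * f' (Z s \<omega>) * D t \<omega>
        + (indicator A \<omega> * f'' (Z s \<omega>) * (\<zeta> \<omega>)\<^sup>2 / 2) * d" if "\<omega> \<in> space M" for \<omega>
    proof -
      have "set_integrable lborel {s<..t} (\<lambda>u. indicator A \<omega> * f' (Z s \<omega>) * \<beta> u \<omega>)"
        by (rule set_integrable_mult_right[OF \<beta>int(6)[OF that]])
      moreover have "set_integrable lborel {s<..t} (\<lambda>u. indicator A \<omega> * f'' (Z s \<omega>) * (\<zeta> \<omega>)\<^sup>2 / 2)"
        by (rule set_integrable_bounded_Ioc[OF _ order_refl]) auto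
      ultimately show ?thesis
        unfolding G0_def D_def using st
        by (simp add: set_integral_add set_integral_const d_def emeasure_bounded_finite[simplified])
    qed
    then have "(\<integral>\<omega>. (LBINT u:{s<..t}. G0 u \<omega>) \<partial>M) = (\<integral>\<omega>. indicator A \<omega> * f' (Z s \<omega>) * D t \<omega>
        + (indicator A \<omega> * f'' (Z s \<omega>) * (\<zeta> \<omega>)\<^sup>2 / 2) * d \<partial>M)"
      by (intro Bochner_Integration.integral_cong) auto
    also have "\<dots> = (\<integral>\<omega>. indicator A \<omega> * f' (Z s \<omega>) * D t \<omega> \<partial>M)
        + (\<integral>\<omega>. (indicator A \<omega> * f'' (Z s \<omega>) * (\<zeta> \<omega>)\<^sup>2 / 2) * d \<partial>M)"
      by (intro Bochner_Integration.integral_add i2 integrable_mult_left x2i)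
    finally show ?thesis by simp
  qed
  then have "(\<integral>\<omega>. indicator A \<omega> * (f (Z t \<omega>) - f (Z s \<omega>)) \<partial>M) - (LBINT u:{s<..t}. \<integral>\<omega>. G1 u \<omega> \<partial>M)
      = (\<integral>\<omega>. N \<omega> \<partial>M) + ((LBINT u:{s<..t}. \<integral>\<omega>. G0 u \<omega> \<partial>M) - (LBINT u:{s<..t}. \<integral>\<omega>. G1 u \<omega> \<partial>M))"
    unfolding NE using G0(5)[of s t] by linarith
  also have "(LBINT u:{s<..t}. \<integral>\<omega>. G0 u \<omega> \<partial>M) - (LBINT u:{s<..t}. \<integral>\<omega>. G1 u \<omega> \<partial>M)
      = (LBINT u:{s<..t}. \<integral>\<omega>. G0 u \<omega> - G1 u \<omega> \<partial>M)"
    using G0 G1 by (subst set_integral_diff(2)[symmetric])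
      (auto intro!: set_integrable_bounded_Ioc[OF G0(1,2)] set_integrable_bounded_Ioc[OF G1(1,2)])
  finally have main: "(\<integral>\<omega>. indicator A \<omega> * (f (Z t \<omega>) - f (Z s \<omega>)) \<partial>M) - (LBINT u:{s<..t}. \<integral>\<omega>. G1 u \<omega> \<partial>M)
      = (\<integral>\<omega>. N \<omega> \<partial>M) + (LBINT u:{s<..t}. \<integral>\<omega>. G0 u \<omega> - G1 u \<omega> \<partial>M)" .
  define c where "c = L * C * (\<delta> + 4 * C\<^sup>2 * d / \<delta>) + C\<^sup>2 * (\<delta> + K * (4 * C\<^sup>2 * d)) / 2"
  have "\<bar>LBINT u:{s<..t}. \<integral>\<omega>. G0 u \<omega> - G1 u \<omega> \<partial>M\<bar> \<le> c * (t - s)"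
  proof (rule set_integral_abs_le[OF st(2)])
    show "set_integrable lborel {s<..t} (\<lambda>u. \<integral>\<omega>. G0 u \<omega> - G1 u \<omega> \<partial>M)"
    proof (rule set_integrable_bounded_Ioc)
      show "(\<lambda>u. \<integral>\<omega>. G0 u \<omega> - G1 u \<omega> \<partial>M) \<in> borel_measurable borel"
        using G0 G1 by simp
      show "\<bar>\<integral>\<omega>. G0 u \<omega> - G1 u \<omega> \<partial>M\<bar> \<le> 2 * (L * C + L * C\<^sup>2)" for u
        using G0(2,3)[of u] G1(2,3)[of u] by simp
    qed
    fix u assume u: "s < u" "u \<le> t"
    then have su: "s \<le> u" by simp
    define w where "w \<omega> = L * C * (\<delta> + (Z u \<omega> - Z s \<omega>)\<^sup>2 / \<delta>) + C\<^sup>2 * (\<delta> + K * (Z u \<omega> - Z s \<omega>)\<^sup>2) / 2" for \<omega>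
    have wi: "integrable M w" unfolding w_def using Esq(1)[OF su u(2)] by auto
    have gw: "\<bar>G0 u \<omega> - G1 u \<omega>\<bar> \<le> w \<omega>" if \<omega>: "\<omega> \<in> space M" for \<omega>
    proof -
      have "\<bar>f' (Z u \<omega>) - f' (Z s \<omega>)\<bar> \<le> L * (\<delta> + (Z u \<omega> - Z s \<omega>)\<^sup>2 / \<delta>)"
        using f'_lipschitz[of "Z u \<omega>" "Z s \<omega>"] mult_left_mono[OF abs_le_add_square[OF \<delta>, of "Z u \<omega> - Z s \<omega>"] L_nonneg]
        by linarith
      then have a1: "\<bar>(f' (Z u \<omega>) - f' (Z s \<omega>)) * \<beta> u \<omega>\<bar> \<le> L * (\<delta> + (Z u \<omega> - Z s \<omega>)\<^sup>2 / \<delta>) * C"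
        unfolding abs_mult using \<beta>b[OF \<omega>] by (intro mult_mono) auto
      have a2: "\<bar>(f'' (Z u \<omega>) - f'' (Z s \<omega>)) * (\<zeta> \<omega>)\<^sup>2\<bar> \<le> (\<delta> + K * (Z u \<omega> - Z s \<omega>)\<^sup>2) * C\<^sup>2"
        unfolding abs_mult using mod \<zeta>2[OF \<omega>] \<delta> K by (intro mult_mono) auto
      have "G0 u \<omega> - G1 u \<omega> = - indicator A \<omega> * ((f' (Z u \<omega>) - f' (Z s \<omega>)) * \<beta> u \<omega> + (f'' (Z u \<omega>) - f'' (Z s \<omega>)) * (\<zeta> \<omega>)\<^sup>2 / 2)"
        by (simp add: G0_def G1_def algebra_simps diff_divide_distrib)
      then have "\<bar>G0 u \<omega> - G1 u \<omega>\<bar> \<le> \<bar>(f' (Z u \<omega>) - f' (Z s \<omega>)) * \<beta> u \<omega>\<bar> + \<bar>(f'' (Z u \<omega>) - f'' (Z s \<omega>)) * (\<zeta> \<omega>)\<^sup>2\<bar> / 2"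
        by (auto simp: indicator_def)
      moreover have "w \<omega> = L * (\<delta> + (Z u \<omega> - Z s \<omega>)\<^sup>2 / \<delta>) * C + (\<delta> + K * (Z u \<omega> - Z s \<omega>)\<^sup>2) * C\<^sup>2 / 2"
        by (simp add: w_def)
      ultimately show ?thesis using a1 a2 by linarith
    qed
    have "\<bar>\<integral>\<omega>. G0 u \<omega> - G1 u \<omega> \<partial>M\<bar> \<le> (\<integral>\<omega>. \<bar>G0 u \<omega> - G1 u \<omega>\<bar> \<partial>M)" by (rule integral_abs_bound)
    also have "\<dots> \<le> (\<integral>\<omega>. w \<omega> \<partial>M)" using gw wi G0(3) G1(3) by (intro integral_mono) auto
    also have "\<dots> = L * C * (\<delta> + (\<integral>\<omega>. (Z u \<omega> - Z s \<omega>)\<^sup>2 \<partial>M) / \<delta>) + C\<^sup>2 * (\<delta> + K * (\<integral>\<omega>. (Z u \<omega> - Z s \<omega>)\<^sup>2 \<partial>M)) / 2"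
      unfolding w_def using Esq(1)[OF su u(2)] by (simp add: prob_space)
    also have "\<dots> \<le> c"
      unfolding c_def using Esq(2)[OF su u(2)] L_nonneg C0 \<delta> K
      by (intro add_mono mult_left_mono divide_right_mono) auto
    finally show "\<bar>\<integral>\<omega>. G0 u \<omega> - G1 u \<omega> \<partial>M\<bar> \<le> c" .
  qed
  with EN main have "\<bar>(\<integral>\<omega>. indicator A \<omega> * (f (Z t \<omega>) - f (Z s \<omega>)) \<partial>M) - (LBINT u:{s<..t}. \<integral>\<omega>. G1 u \<omega> \<partial>M)\<bar>
     \<le> d * ((2 * C\<^sup>2 + L * C\<^sup>2) * \<delta> + (16 * K * C ^ 4 + L * C\<^sup>2 / \<delta> + L * C\<^sup>2) * d) + c * d"
    by (simp add: d_def[symmetric])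
  also have "\<dots> \<le> d * ((3 * C\<^sup>2 + L * C\<^sup>2 + L * C) * \<delta>
        + (18 * K * C ^ 4 + L * C\<^sup>2 / \<delta> + L * C\<^sup>2 + 4 * L * C ^ 3 / \<delta>) * d)"
  proof -
    have "c = (C\<^sup>2 + L * C) * \<delta> + (2 * K * C ^ 4 + 4 * L * C ^ 3 / \<delta>) * d - C\<^sup>2 * \<delta> / 2"
      using \<delta> by (simp add: c_def field_simps power2_eq_square power3_eq_cube eval_nat_numeral)
    moreover have "0 \<le> C\<^sup>2 * \<delta>" using \<delta> by simp
    ultimately have "c \<le> (C\<^sup>2 + L * C) * \<delta> + (2 * K * C ^ 4 + 4 * L * C ^ 3 / \<delta>) * d" by linarith
    then have "c * d \<le> d * ((C\<^sup>2 + L * C) * \<delta> + (2 * K * C ^ 4 + 4 * L * C ^ 3 / \<delta>) * d)"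
      using mult_right_mono[OF _ d(1)] by (metis mult.commute)
    then show ?thesis by (simp add: algebra_simps)
  qed
  finally show ?thesis unfolding G1_def d_def .
qed

end

section \<open>Ito's formula for elementary integrands\<close>

lemma elementary_mono:
  assumes "elementary M F N p \<xi>" "i \<le> j" "j \<le> N"
  shows "p i \<le> p j"
  using assms(2,3)
proof (induction rule: dec_induct)
  case (step n)
  then have "p n \<le> p (Suc n)" using assms(1) by (auto simp: elementary_def)
  then show ?case using step by simp
qed simp

lemma elementary_nonneg: "elementary M F N p \<xi> \<Longrightarrow> i \<le> N \<Longrightarrow> 0 \<le> p i"
  using elementary_mono[of M F N p \<xi> 0 i] by (auto simp: elementary_def)

lemma elem_process_eq:
  assumes el: "elementary M F N p \<xi>" and i: "i < N" "p i < u" "u \<le> p (Suc i)"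
  shows "elem_process N p \<eta> u \<omega> = \<eta> i \<omega>"
proof -
  have "indicator {p j<..p (Suc j)} u = (if j = i then 1 else (0::real))" if j: "j < N" for j
  proof (cases j i rule: linorder_cases)
    case less
    then show ?thesis using elementary_mono[OF el, of "Suc j" i] i by (auto simp: indicator_def)
  next
    case greater
    then show ?thesis using elementary_mono[OF el, of "Suc i" j] i j by (auto simp: indicator_def)
  qed (use i in auto)
  then have "elem_process N p \<eta> u \<omega> = (\<Sum>j<N. \<eta> j \<omega> * (if j = i then 1 else 0))"
    unfolding elem_process_def by (intro sum.cong) auto
  also have "\<dots> = (\<Sum>j<N. if j = i then \<eta> j \<omega> else 0)" by (intro sum.cong) auto
  also have "\<dots> = \<eta> i \<omega>" using i by simp
  finally show ?thesis .
qed

lemma elem_process_outside: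
  assumes el: "elementary M F N p \<xi>" and u: "u \<le> p 0 \<or> p N < u"
  shows "elem_process N p \<eta> u \<omega> = 0"
  unfolding elem_process_def
proof (rule sum.neutral, rule ballI)
  fix j assume "j \<in> {..<N}"
  then have "p 0 \<le> p j" "p (Suc j) \<le> p N" using elementary_mono[OF el] by auto
  then show "\<eta> j \<omega> * indicator {p j<..p (Suc j)} u = 0" using u by (auto simp: indicator_def)
qed

lemma elem_process_cases:
  assumes "elementary M F N p \<xi>"
  obtains i where "i < N" "p i < u" "u \<le> p (Suc i)" | "u \<le> p 0 \<or> p N < u"
proof -
  have "u \<le> p 0 \<or> p n < u \<or> (\<exists>i<n. p i < u \<and> u \<le> p (Suc i))" for n
  proof (induction n)
    case (Suc n)
    then show ?case using less_Suc_eq by (metis linorder_not_le)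
  qed auto
  then show thesis using that by blast
qed

lemma elem_process_bound:
  assumes "elementary M F N p \<xi>" "0 \<le> C" "\<And>i. i < N \<Longrightarrow> \<bar>\<eta> i \<omega>\<bar> \<le> C"
  shows "\<bar>elem_process N p \<eta> u \<omega>\<bar> \<le> C"
  by (rule elem_process_cases[OF assms(1), of u])
    (use assms in \<open>auto simp: elem_process_eq[OF assms(1)] elem_process_outside[OF assms(1)]\<close>)

lemma elem_integral_increment:
  assumes el: "elementary M F N p \<xi>" and i: "i < N" "p i \<le> s" "s \<le> u" "u \<le> p (Suc i)"
  shows "elem_integral B N p \<eta> u \<omega> = elem_integral B N p \<eta> s \<omega> + \<eta> i \<omega> * (B u \<omega> - B s \<omega>)"
proof -
  have "\<eta> j \<omega> * (B (min u (p (Suc j))) \<omega> - B (min u (p j)) \<omega>)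
      = \<eta> j \<omega> * (B (min s (p (Suc j))) \<omega> - B (min s (p j)) \<omega>)
        + (if j = i then \<eta> i \<omega> * (B u \<omega> - B s \<omega>) else 0)" if j: "j < N" for j
  proof (cases j i rule: linorder_cases)
    case less
    then have "p (Suc j) \<le> p i" "p j \<le> p i" using elementary_mono[OF el] i by auto
    then show ?thesis using less i by (simp add: min_absorb2)
  next
    case equal
    then show ?thesis using i by (simp add: min_absorb1 min_absorb2 algebra_simps)
  next
    case greater
    then have "p (Suc i) \<le> p j" "p (Suc i) \<le> p (Suc j)" using elementary_mono[OF el] j by auto
    then show ?thesis using greater i by (simp add: min_absorb1)
  qed
  then have "elem_integral B N p \<eta> u \<omega> = (\<Sum>j<N. \<eta> j \<omega> * (B (min s (p (Suc j))) \<omega> - B (min s (p j)) \<omega>)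
        + (if j = i then \<eta> i \<omega> * (B u \<omega> - B s \<omega>) else 0))"
    unfolding elem_integral_def by (intro sum.cong) auto
  also have "\<dots> = elem_integral B N p \<eta> s \<omega> + (\<Sum>j<N. if j = i then \<eta> i \<omega> * (B u \<omega> - B s \<omega>) else 0)"
    by (simp add: elem_integral_def sum.distrib)
  also have "(\<Sum>j<N. if j = i then \<eta> i \<omega> * (B u \<omega> - B s \<omega>) else 0) = \<eta> i \<omega> * (B u \<omega> - B s \<omega>)"
    using i by simp
  finally show ?thesis .
qed

lemma elem_integral_outside:
  assumes el: "elementary M F N p \<xi>" and u: "s \<le> u" "u \<le> p 0 \<or> p N \<le> s"
  shows "elem_integral B N p \<eta> u \<omega> = elem_integral B N p \<eta> s \<omega>"
  unfolding elem_integral_def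
proof (rule sum.cong[OF refl])
  fix j assume "j \<in> {..<N}"
  then have "p 0 \<le> p j" "p (Suc j) \<le> p N" "p j \<le> p (Suc j)" using elementary_mono[OF el] by auto
  then show "\<eta> j \<omega> * (B (min u (p (Suc j))) \<omega> - B (min u (p j)) \<omega>)
      = \<eta> j \<omega> * (B (min s (p (Suc j))) \<omega> - B (min s (p j)) \<omega>)"
    using u by (elim disjE) (auto simp: min_absorb1 min_absorb2)
qed

lemma (in brownian_basis) elem_integral_adapted:
  assumes el: "elementary M F N p \<xi>" and t: "0 \<le> t"
    and \<eta>: "\<And>i. i < N \<Longrightarrow> \<eta> i \<in> borel_measurable (F (ennreal (p i)))"
  shows "elem_integral B N p \<eta> t \<in> borel_measurable (F (ennreal t))"
proof -
  have "(\<lambda>\<omega>. \<eta> i \<omega> * (B (min t (p (Suc i))) \<omega> - B (min t (p i)) \<omega>)) \<in> borel_measurable (F (ennreal t))"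
    if i: "i < N" for i
  proof (cases "p i \<le> t")
    case True
    have p0: "0 \<le> p i" "0 \<le> p (Suc i)" using elementary_nonneg[OF el] i by auto
    have "\<eta> i \<in> borel_measurable (F (ennreal t))" using measurable_F_mono[OF True \<eta>[OF i]] .
    moreover have "B (min t (p (Suc i))) \<in> borel_measurable (F (ennreal t))"
      "B (min t (p i)) \<in> borel_measurable (F (ennreal t))"
      using p0 t by (auto intro!: measurable_F_mono[OF _ B_measurable_F])
    ultimately show ?thesis by measurable
  next
    case False
    moreover have "p i \<le> p (Suc i)" using elementary_mono[OF el] i by auto
    ultimately show ?thesis by (simp add: min_absorb1)
  qed
  then show ?thesis unfolding elem_integral_def[abs_def] by (intro borel_measurable_sum) auto
qed

text \<open>
  Ito processes with bounded drift \<open>\<beta>\<close> and with a bounded elementary integrand \<open>\<zeta>\<close>. All stochastic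
  calculus is done for these; the diffusion itself is reached by a limit.
\<close>

locale elementary_ito_process = brownian_basis M F B
  for M :: "'a measure" and F B +
  fixes N :: nat and p :: "nat \<Rightarrow> real" and \<zeta> :: "nat \<Rightarrow> 'a \<Rightarrow> real"
    and \<beta> :: "real \<Rightarrow> 'a \<Rightarrow> real" and C x :: real
  assumes elementary: "elementary M F N p \<zeta>"
    and \<zeta>_bound: "i < N \<Longrightarrow> \<omega> \<in> space M \<Longrightarrow> \<bar>\<zeta> i \<omega>\<bar> \<le> C"
    and \<beta>_measurable: "(\<lambda>p. \<beta> (fst p) (snd p)) \<in> borel_measurable (borel \<Otimes>\<^sub>M M)"
    and \<beta>_bound: "\<omega> \<in> space M \<Longrightarrow> \<bar>\<beta> u \<omega>\<bar> \<le> C"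
    and \<beta>_adapted: "0 \<le> t \<Longrightarrow> (\<lambda>\<omega>. LBINT v:{0<..t}. \<beta> v \<omega>) \<in> borel_measurable (F (ennreal t))"
begin

text \<open>
  Truncating the time at \<open>0\<close> gives a process on the whole real line with continuous paths, so joint
  measurability can be discussed without restricting the time axis.
\<close>

definition Z :: "real \<Rightarrow> 'a \<Rightarrow> real" where
  "Z u \<omega> = x + (LBINT v:{0<..u}. \<beta> v \<omega>) + elem_integral B N p \<zeta> (max 0 u) \<omega>"

abbreviation H :: "real \<Rightarrow> 'a \<Rightarrow> real" where
  "H \<equiv> elem_process N p \<zeta>"

lemma C_nonneg: "0 \<le> C"
  using \<beta>_bound not_empty by (metis abs_ge_zero order_trans ex_in_conv)

lemma \<zeta>_measurable: "i < N \<Longrightarrow> \<zeta> i \<in> borel_measurable (F (ennreal (p i)))"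
  using elementary by (auto simp: elementary_def)

lemma \<beta>_ball: "\<forall>u. \<forall>\<omega>\<in>space M. \<bar>\<beta> u \<omega>\<bar> \<le> C"
  using \<beta>_bound by blast

lemmas \<beta>_integral = bounded_time_integral[OF \<beta>_measurable \<beta>_ball]

lemma H_bound: "\<omega> \<in> space M \<Longrightarrow> \<bar>H u \<omega>\<bar> \<le> C"
  by (intro elem_process_bound[OF elementary C_nonneg] \<zeta>_bound)

lemma H_measurable: "(\<lambda>p. H (fst p) (snd p)) \<in> borel_measurable (borel \<Otimes>\<^sub>M M)"
proof -
  have [measurable]: "i < N \<Longrightarrow> \<zeta> i \<in> borel_measurable M" for i
    using \<zeta>_measurable measurable_F_M by blast
  show ?thesis unfolding elem_process_def
  proof (intro borel_measurable_sum)
    fix i assume "i \<in> {..<N}"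
    then have [measurable]: "\<zeta> i \<in> borel_measurable M" by auto
    show "(\<lambda>q. \<zeta> i (snd q) * indicator {p i<..p (Suc i)} (fst q)) \<in> borel_measurable (borel \<Otimes>\<^sub>M M)"
      by measurable
  qed
qed

lemma Z_adapted: "0 \<le> t \<Longrightarrow> Z t \<in> borel_measurable (F (ennreal t))"
  unfolding Z_def[abs_def]
  by (intro borel_measurable_add \<beta>_adapted) (auto simp: elem_integral_adapted[OF elementary _ \<zeta>_measurable] max_absorb2)

lemma Z_max: "Z u = Z (max 0 u)"
  by (cases "u \<le> 0") (auto simp: Z_def max_def fun_eq_iff)

lemma Z_measurable_at: "Z t \<in> borel_measurable M"
  by (subst Z_max) (auto intro!: measurable_F_M[OF Z_adapted])

lemma Z_continuous:
  assumes \<omega>: "\<omega> \<in> space M"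
  shows "continuous_on UNIV (\<lambda>t. Z t \<omega>)"
proof -
  have Bc: "continuous_on UNIV (\<lambda>t. B (f t) \<omega>)"
    if "continuous_on UNIV f" "\<And>t. 0 \<le> f t" for f :: "real \<Rightarrow> real"
    by (rule continuous_on_compose2[OF B_continuous[OF \<omega>] that(1)]) (use that in auto)
  have "continuous_on UNIV (\<lambda>t. elem_integral B N p \<zeta> (max 0 t) \<omega>)"
    unfolding elem_integral_def
  proof (intro continuous_intros)
    fix i assume "i \<in> {..<N}"
    then have "0 \<le> p i" "0 \<le> p (Suc i)" using elementary_nonneg[OF elementary] by auto
    then show "continuous_on UNIV (\<lambda>t. B (min (max 0 t) (p (Suc i))) \<omega>)"
      "continuous_on UNIV (\<lambda>t. B (min (max 0 t) (p i)) \<omega>)"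
      by (auto intro!: Bc continuous_intros)
  qed
  moreover have "continuous_on UNIV (\<lambda>t. LBINT v:{0<..t}. \<beta> v \<omega>)"
  proof -
    have "\<bar>(LBINT v:{0<..t}. \<beta> v \<omega>) - (LBINT v:{0<..s}. \<beta> v \<omega>)\<bar> \<le> C * \<bar>t - s\<bar>" if "s \<le> t" for s t
    proof (cases "0 \<le> s")
      case True
      have "(LBINT v:{0<..t}. \<beta> v \<omega>) - (LBINT v:{0<..s}. \<beta> v \<omega>) = (LBINT v:{s<..t}. \<beta> v \<omega>)"
        using set_integral_Ioc_split[OF True that \<beta>_integral(6)[OF \<omega>]] by simp
      then show ?thesis
        using set_integral_abs_le[OF that \<beta>_integral(6)[OF \<omega>]] \<beta>_bound[OF \<omega>] that by simp
    next
      case False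
      then have "(LBINT v:{0<..s}. \<beta> v \<omega>) = 0" by (simp add: set_lebesgue_integral_def)
      moreover have "\<bar>LBINT v:{0<..t}. \<beta> v \<omega>\<bar> \<le> C * \<bar>t - s\<bar>"
      proof (cases "0 \<le> t")
        case True
        have "\<bar>LBINT v:{0<..t}. \<beta> v \<omega>\<bar> \<le> C * (t - 0)"
          using set_integral_abs_le[OF True \<beta>_integral(6)[OF \<omega>]] \<beta>_bound[OF \<omega>] by simp
        also have "\<dots> \<le> C * \<bar>t - s\<bar>" using C_nonneg False True by (intro mult_left_mono) auto
        finally show ?thesis .
      qed (use C_nonneg in \<open>simp add: set_lebesgue_integral_def\<close>)
      ultimately show ?thesis by simp
    qed
    then have "\<bar>(LBINT v:{0<..t}. \<beta> v \<omega>) - (LBINT v:{0<..s}. \<beta> v \<omega>)\<bar> \<le> C * \<bar>t - s\<bar>" for s t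
      by (cases "s \<le> t") (simp, subst abs_minus_commute, subst (2) abs_minus_commute, simp)
    then have "C-lipschitz_on UNIV (\<lambda>t. LBINT v:{0<..t}. \<beta> v \<omega>)"
      using C_nonneg by (intro lipschitz_onI) (simp_all add: dist_real_def)
    then show ?thesis by (rule lipschitz_on_continuous_on)
  qed
  ultimately show ?thesis unfolding Z_def by (intro continuous_intros)
qed

lemma Z_measurable: "(\<lambda>p. Z (fst p) (snd p)) \<in> borel_measurable (borel \<Otimes>\<^sub>M M)"
  using measurable_compose[OF measurable_Pair[OF measurable_snd measurable_fst]
      borel_measurable_pair_continuous_process[of Z M, OF Z_measurable_at Z_continuous]]
  by simp

text \<open>
  The defect of Ito's formula is additive over subintervals, and \<open>ito_small_interval\<close> bounds it by an
  arbitrarily small multiple of the length; hence it is \<open>0\<close>.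
\<close>

lemma ito_constant_integrand:
  assumes test: "bounded_C2 f f' f'' L" and st: "0 \<le> s" "s \<le> t" and A: "A \<in> sets (F (ennreal s))"
    and z: "z \<in> borel_measurable (F (ennreal s))" "\<And>\<omega>. \<omega> \<in> space M \<Longrightarrow> \<bar>z \<omega>\<bar> \<le> C"
    and zH: "\<And>u \<omega>. s < u \<Longrightarrow> u \<le> t \<Longrightarrow> \<omega> \<in> space M \<Longrightarrow> H u \<omega> = z \<omega>"
    and zI: "\<And>v u \<omega>. s \<le> v \<Longrightarrow> v \<le> u \<Longrightarrow> u \<le> t \<Longrightarrow> \<omega> \<in> space M \<Longrightarrow>
      elem_integral B N p \<zeta> u \<omega> = elem_integral B N p \<zeta> v \<omega> + z \<omega> * (B u \<omega> - B v \<omega>)"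
  shows "(\<integral>\<omega>. indicator A \<omega> * (f (Z t \<omega>) - f (Z s \<omega>)) \<partial>M)
      = (LBINT u:{s<..t}. \<integral>\<omega>. indicator A \<omega> * (f' (Z u \<omega>) * \<beta> u \<omega> + f'' (Z u \<omega>) * (H u \<omega>)\<^sup>2 / 2) \<partial>M)"
proof -
  interpret bounded_C2 f f' f'' L by (rule test)
  define G where "G u \<omega> = indicator A \<omega> * (f' (Z u \<omega>) * \<beta> u \<omega> + f'' (Z u \<omega>) * (z \<omega>)\<^sup>2 / 2)" for u \<omega>
  define \<Phi> where "\<Phi> v w = (\<integral>\<omega>. indicator A \<omega> * (f (Z w \<omega>) - f (Z v \<omega>)) \<partial>M) - (LBINT u:{v<..w}. \<integral>\<omega>. G u \<omega> \<partial>M)" for v w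
  have AM[measurable]: "A \<in> sets M" using A sets_F_M by blast
  note [measurable] = Z_measurable_at Z_measurable \<beta>_measurable measurable_F_M[OF z(1)]
  have z2: "(z \<omega>)\<^sup>2 \<le> C\<^sup>2" if "\<omega> \<in> space M" for \<omega>
    using z(2)[OF that] C_nonneg by (simp add: abs_le_square_iff[symmetric])
  have Gm: "(\<lambda>p. G (fst p) (snd p)) \<in> borel_measurable (borel \<Otimes>\<^sub>M M)" unfolding G_def by measurable
  have Gb: "\<forall>u. \<forall>\<omega>\<in>space M. \<bar>G u \<omega>\<bar> \<le> L * C + L * C\<^sup>2"
  proof (intro allI ballI)
    fix u \<omega> assume w: "\<omega> \<in> space M"
    have "\<bar>f' (Z u \<omega>) * \<beta> u \<omega>\<bar> \<le> L * C" unfolding abs_mult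
      using f'_bound \<beta>_bound[OF w] L_nonneg by (intro mult_mono) auto
    moreover have "\<bar>f'' (Z u \<omega>) * (z \<omega>)\<^sup>2\<bar> \<le> L * C\<^sup>2" unfolding abs_mult
      using f''_bound z2[OF w] L_nonneg by (intro mult_mono) auto
    ultimately have "\<bar>f' (Z u \<omega>) * \<beta> u \<omega> + f'' (Z u \<omega>) * (z \<omega>)\<^sup>2 / 2\<bar> \<le> L * C + L * C\<^sup>2" by linarith
    moreover have "0 \<le> L * C + L * C\<^sup>2" using L_nonneg C_nonneg by simp
    ultimately show "\<bar>G u \<omega>\<bar> \<le> L * C + L * C\<^sup>2" by (auto simp: G_def indicator_def)
  qed
  note GI = bounded_time_integral[of G, OF Gm Gb]
  have fi: "integrable M (\<lambda>\<omega>. indicator A \<omega> * (f (Z w \<omega>) - f (Z v \<omega>)))" for v w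
  proof (rule integrable_bounded[where q="2 * L"])
    fix \<omega>
    show "\<bar>indicator A \<omega> * (f (Z w \<omega>) - f (Z v \<omega>))\<bar> \<le> 2 * L"
      using f_bound[of "Z w \<omega>"] f_bound[of "Z v \<omega>"] L_nonneg by (auto simp: indicator_def)
  qed measurable
  have "\<Phi> s t = 0"
  proof (rule additive_interval_function_zero[OF st(2)])
    fix a b c assume abc: "s \<le> a" "a \<le> b" "b \<le> c" "c \<le> t"
    have "(\<integral>\<omega>. indicator A \<omega> * (f (Z c \<omega>) - f (Z a \<omega>)) \<partial>M)
      = (\<integral>\<omega>. indicator A \<omega> * (f (Z b \<omega>) - f (Z a \<omega>)) + indicator A \<omega> * (f (Z c \<omega>) - f (Z b \<omega>)) \<partial>M)"
      by (simp add: algebra_simps)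
    also have "\<dots> = (\<integral>\<omega>. indicator A \<omega> * (f (Z b \<omega>) - f (Z a \<omega>)) \<partial>M) + (\<integral>\<omega>. indicator A \<omega> * (f (Z c \<omega>) - f (Z b \<omega>)) \<partial>M)"
      by (rule Bochner_Integration.integral_add[OF fi fi])
    finally show "\<Phi> a c = \<Phi> a b + \<Phi> b c"
      using set_integral_Ioc_split[OF abc(2,3) set_integrable_bounded_Ioc[OF GI(1,2)]]
      by (simp add: \<Phi>_def)
  next
    fix e :: real assume e: "e > 0"
    define P where "P = 3 * C\<^sup>2 + L * C\<^sup>2 + L * C"
    have P: "P \<ge> 0" using L_nonneg C_nonneg by (simp add: P_def)
    \<comment> \<open>The part of the error linear in the modulus takes half of \<open>e\<close>, the part of higher order the other half.\<close>
    define \<delta> where "\<delta> = e / (2 * (P + 1))"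
    have \<delta>: "\<delta> > 0" using e P by (simp add: \<delta>_def)
    have P\<delta>: "P * \<delta> \<le> e / 2" using e P by (simp add: \<delta>_def field_simps)
    obtain K where K: "K \<ge> 0" "\<And>y z. \<bar>f'' y - f'' z\<bar> \<le> \<delta> + K * (y - z)\<^sup>2"
      using f''_modulus[OF \<delta>] by metis
    define Q where "Q = 18 * K * C ^ 4 + L * C\<^sup>2 / \<delta> + L * C\<^sup>2 + 4 * L * C ^ 3 / \<delta>"
    have Q: "Q \<ge> 0" using L_nonneg C_nonneg \<delta> K by (simp add: Q_def)
    define h where "h = min 1 (e / (2 * (Q + 1)))"
    have h: "h > 0" "h \<le> 1" using e Q by (auto simp: h_def)
    have Qh: "Q * h \<le> e / 2"
    proof -
      have "Q * h \<le> Q * (e / (2 * (Q + 1)))" using Q by (intro mult_left_mono) (auto simp: h_def)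
      also have "\<dots> \<le> e / 2" using e Q by (simp add: field_simps)
      finally show ?thesis .
    qed
    show "\<exists>h>0. \<forall>a b. s \<le> a \<and> a \<le> b \<and> b \<le> t \<and> b - a \<le> h \<longrightarrow> \<bar>\<Phi> a b\<bar> \<le> e * (b - a)"
    proof (intro exI[of _ h] conjI allI impI h(1))
      fix a b assume ab: "s \<le> a \<and> a \<le> b \<and> b \<le> t \<and> b - a \<le> h"
      have "\<bar>\<Phi> a b\<bar> \<le> (b - a) * (P * \<delta> + Q * (b - a))"
        unfolding \<Phi>_def G_def P_def Q_def
      proof (rule ito_small_interval[OF test \<delta> K])
        show "0 \<le> a" "a \<le> b" "b - a \<le> 1" using ab st h by auto
        show "A \<in> sets (F (ennreal a))"
          using A sets_F_mono[of "ennreal s" "ennreal a"] ab by (auto simp: ennreal_leI)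
        show "z \<in> borel_measurable (F (ennreal a))" using measurable_F_mono[OF _ z(1)] ab by simp
        show "Z a \<in> borel_measurable (F (ennreal a))" using Z_adapted ab st by simp
        fix u \<omega> assume u: "a \<le> u" "u \<le> b" and w: "\<omega> \<in> space M"
        have "elem_integral B N p \<zeta> u \<omega> = elem_integral B N p \<zeta> a \<omega> + z \<omega> * (B u \<omega> - B a \<omega>)"
          using zI[of a u \<omega>] ab u w by simp
        moreover have "(LBINT v:{0<..u}. \<beta> v \<omega>) = (LBINT v:{0<..a}. \<beta> v \<omega>) + (LBINT v:{a<..u}. \<beta> v \<omega>)"
          using ab st u by (intro set_integral_Ioc_split \<beta>_integral(6)[OF w]) auto
        ultimately show "Z u \<omega> = Z a \<omega> + (LBINT v:{a<..u}. \<beta> v \<omega>) + z \<omega> * (B u \<omega> - B a \<omega>)"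
          using ab st u by (simp add: Z_def max_absorb2)
      qed (use z \<beta>_measurable \<beta>_bound Z_measurable in auto)
      also have "\<dots> \<le> (b - a) * e"
      proof (rule mult_left_mono)
        have "Q * (b - a) \<le> Q * h" using ab Q by (intro mult_left_mono) auto
        then show "P * \<delta> + Q * (b - a) \<le> e" using P\<delta> Qh by linarith
      qed (use ab in auto)
      finally show "\<bar>\<Phi> a b\<bar> \<le> e * (b - a)" by (simp add: mult.commute)
    qed
  qed
  moreover have "(LBINT u:{s<..t}. \<integral>\<omega>. G u \<omega> \<partial>M)
      = (LBINT u:{s<..t}. \<integral>\<omega>. indicator A \<omega> * (f' (Z u \<omega>) * \<beta> u \<omega> + f'' (Z u \<omega>) * (H u \<omega>)\<^sup>2 / 2) \<partial>M)"
    unfolding G_def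
    by (intro set_lebesgue_integral_cong) (auto intro!: Bochner_Integration.integral_cong simp: zH)
  ultimately show ?thesis unfolding \<Phi>_def by simp
qed

text \<open>
  Ito's formula in expectation, restricted to an event \<open>A\<close> of the past: the interval is cut at the
  partition points of the elementary integrand, which are moved into \<open>[s, t]\<close> first. The remaining
  claims record the measurability and boundedness of the integrand for later use.
\<close>

lemma ito_expectation:
  assumes test: "bounded_C2 f f' f'' L" and st: "0 \<le> s" "s \<le> t" and A: "A \<in> sets (F (ennreal s))"
  shows "(\<integral>\<omega>. indicator A \<omega> * f (Z t \<omega>) \<partial>M) - (\<integral>\<omega>. indicator A \<omega> * f (Z s \<omega>) \<partial>M)
      = (LBINT u:{s<..t}. \<integral>\<omega>. indicator A \<omega> * (f' (Z u \<omega>) * \<beta> u \<omega> + f'' (Z u \<omega>) * (H u \<omega>)\<^sup>2 / 2) \<partial>M)"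
    and "(\<lambda>u. \<integral>\<omega>. indicator A \<omega> * (f' (Z u \<omega>) * \<beta> u \<omega> + f'' (Z u \<omega>) * (H u \<omega>)\<^sup>2 / 2) \<partial>M) \<in> borel_measurable borel"
    and "\<bar>\<integral>\<omega>. indicator A \<omega> * (f' (Z u \<omega>) * \<beta> u \<omega> + f'' (Z u \<omega>) * (H u \<omega>)\<^sup>2 / 2) \<partial>M\<bar> \<le> L * C + L * C\<^sup>2"
    and "\<omega> \<in> space M \<Longrightarrow> \<bar>f' (Z u \<omega>) * \<beta> u \<omega> + f'' (Z u \<omega>) * (H u \<omega>)\<^sup>2 / 2\<bar> \<le> L * C + L * C\<^sup>2"
    and "integrable M (\<lambda>\<omega>. indicator A \<omega> * (f' (Z u \<omega>) * \<beta> u \<omega> + f'' (Z u \<omega>) * (H u \<omega>)\<^sup>2 / 2))"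
proof -
  interpret bounded_C2 f f' f'' L by (rule test)
  define G where "G u \<omega> = indicator A \<omega> * (f' (Z u \<omega>) * \<beta> u \<omega> + f'' (Z u \<omega>) * (H u \<omega>)\<^sup>2 / 2)" for u \<omega>
  define J where "J w = (\<integral>\<omega>. indicator A \<omega> * f (Z w \<omega>) \<partial>M)" for w
  define I where "I v w = (LBINT u:{v<..w}. \<integral>\<omega>. G u \<omega> \<partial>M)" for v w
  have AM[measurable]: "A \<in> sets M" using A sets_F_M by blast
  note [measurable] = Z_measurable_at Z_measurable \<beta>_measurable H_measurable
  have Gm: "(\<lambda>p. G (fst p) (snd p)) \<in> borel_measurable (borel \<Otimes>\<^sub>M M)" unfolding G_def by measurable
  have gb: "\<bar>f' (Z u \<omega>) * \<beta> u \<omega> + f'' (Z u \<omega>) * (H u \<omega>)\<^sup>2 / 2\<bar> \<le> L * C + L * C\<^sup>2" if w: "\<omega> \<in> space M" for u \<omega>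
  proof -
    have "\<bar>f' (Z u \<omega>) * \<beta> u \<omega>\<bar> \<le> L * C" unfolding abs_mult
      using f'_bound \<beta>_bound[OF w] L_nonneg by (intro mult_mono) auto
    moreover have "(H u \<omega>)\<^sup>2 \<le> C\<^sup>2"
      using H_bound[OF w] C_nonneg by (simp add: abs_le_square_iff[symmetric])
    then have "\<bar>f'' (Z u \<omega>) * (H u \<omega>)\<^sup>2\<bar> \<le> L * C\<^sup>2" unfolding abs_mult
      using f''_bound L_nonneg by (intro mult_mono) auto
    ultimately show ?thesis by linarith
  qed
  have LC0: "0 \<le> L * C + L * C\<^sup>2" using L_nonneg C_nonneg by simp
  have Gb: "\<forall>u. \<forall>\<omega>\<in>space M. \<bar>G u \<omega>\<bar> \<le> L * C + L * C\<^sup>2"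
    using gb LC0 by (auto simp: G_def indicator_def)
  note GI = bounded_time_integral[of G, OF Gm Gb]
  have fi: "integrable M (\<lambda>\<omega>. indicator A \<omega> * f (Z w \<omega>))" for w
  proof (rule integrable_bounded[where q="L"])
    fix \<omega>
    show "\<bar>indicator A \<omega> * f (Z w \<omega>)\<bar> \<le> L"
      using f_bound[of "Z w \<omega>"] L_nonneg by (auto simp: indicator_def)
  qed measurable
  have J: "J w - J v = (\<integral>\<omega>. indicator A \<omega> * (f (Z w \<omega>) - f (Z v \<omega>)) \<partial>M)" for v w
    unfolding J_def by (subst Bochner_Integration.integral_diff[symmetric, OF fi fi]) (simp add: algebra_simps)
  have I_split: "I a c = I a b + I b c" if "a \<le> b" "b \<le> c" for a b c
    unfolding I_def by (rule set_integral_Ioc_split[OF that set_integrable_bounded_Ioc[OF GI(1,2)]])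
  define m where "m i = max s (min t (p i))" for i
  have m: "s \<le> m i" "m i \<le> t" for i using st by (auto simp: m_def)
  have Am: "A \<in> sets (F (ennreal v))" if "s \<le> v" for v
    using A sets_F_mono[of "ennreal s" "ennreal v"] that by (auto simp: ennreal_leI)
  have trivial: "J v - J v = I v v" for v by (simp add: I_def set_lebesgue_integral_def)
  have out: "J w - J v = I v w" if "s \<le> v" "v \<le> w" "w \<le> p 0 \<or> p N \<le> v" for v w
    unfolding J I_def G_def
  proof (rule ito_constant_integrand[OF test _ that(2) Am[OF that(1)], where z="\<lambda>_. 0"])
    show "H u \<omega> = 0" if "v < u" "u \<le> w" for u \<omega>
      using that \<open>w \<le> p 0 \<or> p N \<le> v\<close> by (intro elem_process_outside[OF elementary]) auto
    show "elem_integral B N p \<zeta> u \<omega> = elem_integral B N p \<zeta> v' \<omega> + 0 * (B u \<omega> - B v' \<omega>)"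
      if "v \<le> v'" "v' \<le> u" "u \<le> w" for v' u \<omega>
      using that \<open>w \<le> p 0 \<or> p N \<le> v\<close> elem_integral_outside[OF elementary, of v' u] by auto
  qed (use st that C_nonneg in auto)
  have ins: "J w - J v = I v w" if "s \<le> v" "v \<le> w" "i < N" "p i \<le> v" "w \<le> p (Suc i)" for v w i
    unfolding J I_def G_def
  proof (rule ito_constant_integrand[OF test _ that(2) Am[OF that(1)], where z="\<zeta> i"])
    show "H u \<omega> = \<zeta> i \<omega>" if "v < u" "u \<le> w" for u \<omega>
      using that \<open>i < N\<close> \<open>p i \<le> v\<close> \<open>w \<le> p (Suc i)\<close> by (intro elem_process_eq[OF elementary]) auto
    show "elem_integral B N p \<zeta> u \<omega> = elem_integral B N p \<zeta> v' \<omega> + \<zeta> i \<omega> * (B u \<omega> - B v' \<omega>)"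
      if "v \<le> v'" "v' \<le> u" "u \<le> w" for v' u \<omega>
      using that \<open>i < N\<close> \<open>p i \<le> v\<close> \<open>w \<le> p (Suc i)\<close> by (intro elem_integral_increment[OF elementary]) auto
    show "\<zeta> i \<in> borel_measurable (F (ennreal v))"
      using measurable_F_mono[OF that(4) \<zeta>_measurable[OF that(3)]] .
  qed (use st that \<zeta>_bound in auto)
  have step: "i \<le> N \<Longrightarrow> J (m i) - J s = I s (m i)" for i
  proof (induction i)
    case 0
    show ?case
    proof (cases "m 0 = s")
      case False
      then have "m 0 \<le> p 0" by (auto simp: m_def)
      then show ?thesis using m by (intro out) auto
    qed (use trivial in simp)
  next
    case (Suc i)
    have le: "m i \<le> m (Suc i)" using elementary_mono[OF elementary, of i "Suc i"] Suc.prems by (auto simp: m_def)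
    have "J (m (Suc i)) - J (m i) = I (m i) (m (Suc i))"
    proof (cases "m i = m (Suc i)")
      case False
      then have "p i \<le> m i" "m (Suc i) \<le> p (Suc i)" using le by (auto simp: m_def)
      then show ?thesis using m le Suc.prems by (intro ins) auto
    qed (use trivial in simp)
    then show ?case using Suc I_split[OF m(1)[of i] le] by simp
  qed
  have "J t - J (m N) = I (m N) t"
  proof (cases "m N = t")
    case False
    then have "p N \<le> m N" using st by (auto simp: m_def)
    then show ?thesis using m by (intro out) auto
  qed (use trivial in simp)
  then have "J t - J s = I s t" using step[of N] I_split[OF m[of N]] by simp
  then show "(\<integral>\<omega>. indicator A \<omega> * f (Z t \<omega>) \<partial>M) - (\<integral>\<omega>. indicator A \<omega> * f (Z s \<omega>) \<partial>M)
      = (LBINT u:{s<..t}. \<integral>\<omega>. indicator A \<omega> * (f' (Z u \<omega>) * \<beta> u \<omega> + f'' (Z u \<omega>) * (H u \<omega>)\<^sup>2 / 2) \<partial>M)"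
    by (simp add: J_def I_def G_def)
  show "(\<lambda>u. \<integral>\<omega>. indicator A \<omega> * (f' (Z u \<omega>) * \<beta> u \<omega> + f'' (Z u \<omega>) * (H u \<omega>)\<^sup>2 / 2) \<partial>M) \<in> borel_measurable borel"
    using GI(1) by (simp add: G_def)
  show "\<bar>\<integral>\<omega>. indicator A \<omega> * (f' (Z u \<omega>) * \<beta> u \<omega> + f'' (Z u \<omega>) * (H u \<omega>)\<^sup>2 / 2) \<partial>M\<bar> \<le> L * C + L * C\<^sup>2"
    using GI(2)[of u] by (simp add: G_def)
  show "\<omega> \<in> space M \<Longrightarrow> \<bar>f' (Z u \<omega>) * \<beta> u \<omega> + f'' (Z u \<omega>) * (H u \<omega>)\<^sup>2 / 2\<bar> \<le> L * C + L * C\<^sup>2"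
    by (rule gb)
  show "integrable M (\<lambda>\<omega>. indicator A \<omega> * (f' (Z u \<omega>) * \<beta> u \<omega> + f'' (Z u \<omega>) * (H u \<omega>)\<^sup>2 / 2))"
    using GI(3)[of u] by (simp add: G_def[abs_def])
qed

lemma discounted_ito_expectation:
  assumes test: "bounded_C2 f f' f'' L" and st: "0 \<le> s" "s \<le> t" and A: "A \<in> sets (F (ennreal s))"
    and r: "0 \<le> r"
  shows "exp (- r * t) * (\<integral>\<omega>. indicator A \<omega> * f (Z t \<omega>) \<partial>M) - exp (- r * s) * (\<integral>\<omega>. indicator A \<omega> * f (Z s \<omega>) \<partial>M)
      = (LBINT u:{s<..t}. exp (- r * u) * (\<integral>\<omega>. indicator A \<omega> *
          (f' (Z u \<omega>) * \<beta> u \<omega> + f'' (Z u \<omega>) * (H u \<omega>)\<^sup>2 / 2 - r * f (Z u \<omega>)) \<partial>M))" (is "?lhs = ?rhs")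
proof -
  interpret bounded_C2 f f' f'' L by (rule test)
  have AM[measurable]: "A \<in> sets M" using A sets_F_M by blast
  note [measurable] = Z_measurable_at Z_measurable
  define U where "U u = (\<integral>\<omega>. indicator A \<omega> * f (Z u \<omega>) \<partial>M)" for u
  have fb: "\<bar>indicator A \<omega> * f (Z u \<omega>)\<bar> \<le> L" for u \<omega>
    using f_bound[of "Z u \<omega>"] L_nonneg by (auto simp: indicator_def)
  have fm: "(\<lambda>p. indicator A (snd p) * f (Z (fst p) (snd p))) \<in> borel_measurable (borel \<Otimes>\<^sub>M M)"
    by measurable
  note UI = bounded_time_integral[of "\<lambda>u \<omega>. indicator A \<omega> * f (Z u \<omega>)", OF fm, of L]
  have "?lhs = (LBINT u:{s<..t}. exp (- r * u) *
      ((\<integral>\<omega>. indicator A \<omega> * (f' (Z u \<omega>) * \<beta> u \<omega> + f'' (Z u \<omega>) * (H u \<omega>)\<^sup>2 / 2) \<partial>M) - r * U u))"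
    unfolding U_def[symmetric]
  proof (rule discounted_increment[OF st(2) r st(1) ito_expectation(2,3)[OF test st A]])
    show "U \<in> borel_measurable borel" "\<bar>U u\<bar> \<le> L" for u
      using UI(1,2) fb unfolding U_def[abs_def] by auto
    show "U w - U v = (LBINT u:{v<..w}. \<integral>\<omega>. indicator A \<omega> * (f' (Z u \<omega>) * \<beta> u \<omega> + f'' (Z u \<omega>) * (H u \<omega>)\<^sup>2 / 2) \<partial>M)"
      if vw: "s \<le> v" "v \<le> w" "w \<le> t" for v w
      unfolding U_def
    proof (rule ito_expectation(1)[OF test _ vw(2)])
      show "0 \<le> v" using vw st by simp
      show "A \<in> sets (F (ennreal v))"
        using A sets_F_mono[of "ennreal s" "ennreal v"] vw by (auto simp: ennreal_leI)
    qed
  qed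
  also have "\<dots> = ?rhs"
  proof (rule set_lebesgue_integral_cong)
    show "\<forall>u. u \<in> {s<..t} \<longrightarrow> exp (- r * u) *
      ((\<integral>\<omega>. indicator A \<omega> * (f' (Z u \<omega>) * \<beta> u \<omega> + f'' (Z u \<omega>) * (H u \<omega>)\<^sup>2 / 2) \<partial>M) - r * U u)
      = exp (- r * u) * (\<integral>\<omega>. indicator A \<omega> *
          (f' (Z u \<omega>) * \<beta> u \<omega> + f'' (Z u \<omega>) * (H u \<omega>)\<^sup>2 / 2 - r * f (Z u \<omega>)) \<partial>M)"
    proof (intro allI impI)
      fix u
      have i: "integrable M (\<lambda>\<omega>. r * (indicator A \<omega> * f (Z u \<omega>)))" using UI(3)[of u] fb by simp
      have "(\<integral>\<omega>. indicator A \<omega> * (f' (Z u \<omega>) * \<beta> u \<omega> + f'' (Z u \<omega>) * (H u \<omega>)\<^sup>2 / 2) \<partial>M) - r * U u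
        = (\<integral>\<omega>. indicator A \<omega> * (f' (Z u \<omega>) * \<beta> u \<omega> + f'' (Z u \<omega>) * (H u \<omega>)\<^sup>2 / 2) \<partial>M) - (\<integral>\<omega>. r * (indicator A \<omega> * f (Z u \<omega>)) \<partial>M)"
        by (simp add: U_def)
      also have "\<dots> = (\<integral>\<omega>. indicator A \<omega> * (f' (Z u \<omega>) * \<beta> u \<omega> + f'' (Z u \<omega>) * (H u \<omega>)\<^sup>2 / 2)
          - r * (indicator A \<omega> * f (Z u \<omega>)) \<partial>M)"
        by (rule Bochner_Integration.integral_diff[symmetric, OF ito_expectation(5)[OF test st A] i])
      also have "\<dots> = (\<integral>\<omega>. indicator A \<omega> *
          (f' (Z u \<omega>) * \<beta> u \<omega> + f'' (Z u \<omega>) * (H u \<omega>)\<^sup>2 / 2 - r * f (Z u \<omega>)) \<partial>M)"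
        by (intro Bochner_Integration.integral_cong refl) (simp add: algebra_simps)
      finally show "exp (- r * u) *
        ((\<integral>\<omega>. indicator A \<omega> * (f' (Z u \<omega>) * \<beta> u \<omega> + f'' (Z u \<omega>) * (H u \<omega>)\<^sup>2 / 2) \<partial>M) - r * U u)
        = exp (- r * u) * (\<integral>\<omega>. indicator A \<omega> *
          (f' (Z u \<omega>) * \<beta> u \<omega> + f'' (Z u \<omega>) * (H u \<omega>)\<^sup>2 / 2 - r * f (Z u \<omega>)) \<partial>M)" by simp
    qed
  qed simp
  finally show ?thesis .
qed

end

section \<open>Moment and tail bounds for elementary integrals\<close>

context brownian_basis
begin

text \<open>
  The Ito isometry for elementary integrands, by adding one increment at a time: the mixed terms vanish
  because each increment is independent of the integral accumulated so far.
\<close>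

lemma elem_integral_second_moment:
  assumes el: "elementary M F N p G" and t: "0 \<le> t"
  shows "integrable M (\<lambda>\<omega>. (elem_integral B N p G t \<omega>)\<^sup>2)"
    and "(\<integral>\<omega>. (elem_integral B N p G t \<omega>)\<^sup>2 \<partial>M)
      = (\<integral>\<omega>. (\<Sum>i<N. (G i \<omega>)\<^sup>2 * (min t (p (Suc i)) - min t (p i))) \<partial>M)"
proof -
  define \<Delta> where "\<Delta> i = min t (p (Suc i)) - min t (p i)" for i
  have sub: "elementary M F n p G" if "n \<le> N" for n
    using el that by (auto simp: elementary_def)
  have Gm: "G i \<in> borel_measurable (F (ennreal (p i)))" if "i < N" for i
    using el that by (auto simp: elementary_def)
  have Gi: "integrable M (\<lambda>\<omega>. (G i \<omega>)\<^sup>2)" if i: "i < N" for i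
  proof -
    obtain C where C: "\<And>\<omega>. \<omega> \<in> space M \<Longrightarrow> \<bar>G i \<omega>\<bar> \<le> C" using el i unfolding elementary_def by blast
    have "(G i \<omega>)\<^sup>2 \<le> C\<^sup>2" if "\<omega> \<in> space M" for \<omega>
      using power_mono[OF C[OF that], of 2] by simp
    then show ?thesis
      using measurable_F_M[OF Gm[OF i]] by (intro integrable_bounded[where q="C\<^sup>2"]) auto
  qed
  have "n \<le> N \<Longrightarrow> integrable M (\<lambda>\<omega>. (elem_integral B n p G t \<omega>)\<^sup>2) \<and>
    (\<integral>\<omega>. (elem_integral B n p G t \<omega>)\<^sup>2 \<partial>M) = (\<integral>\<omega>. (\<Sum>i<n. (G i \<omega>)\<^sup>2 * \<Delta> i) \<partial>M)" for n
  proof (induction n)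
    case 0
    then show ?case by (simp add: elem_integral_def)
  next
    case (Suc n)
    then have n: "n < N" by simp
    have p0: "0 \<le> p n" "p n \<le> p (Suc n)" using elementary_nonneg[OF el] el n by (auto simp: elementary_def)
    define S where "S \<omega> = elem_integral B n p G t \<omega>" for \<omega>
    define b where "b \<omega> = B (min t (p (Suc n))) \<omega> - B (min t (p n)) \<omega>" for \<omega>
    have eq: "elem_integral B (Suc n) p G t \<omega> = S \<omega> + G n \<omega> * b \<omega>" for \<omega>
      by (simp add: elem_integral_def S_def b_def)
    have IH: "integrable M (\<lambda>\<omega>. (S \<omega>)\<^sup>2)" "(\<integral>\<omega>. (S \<omega>)\<^sup>2 \<partial>M) = (\<integral>\<omega>. (\<Sum>i<n. (G i \<omega>)\<^sup>2 * \<Delta> i) \<partial>M)"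
      using Suc by (auto simp: S_def)
    have sumi: "integrable M (\<lambda>\<omega>. \<Sum>i<n. (G i \<omega>)\<^sup>2 * \<Delta> i)"
      using Gi n by (intro Bochner_Integration.integrable_sum integrable_mult_left) auto
    show ?case
    proof (cases "p n < t")
      case False
      then have "b = (\<lambda>_. 0)" "\<Delta> n = 0" using p0 by (auto simp: b_def \<Delta>_def fun_eq_iff min_absorb1)
      then show ?thesis using IH by (simp add: eq)
    next
      case True
      then have mn: "min t (p n) = p n" by simp
      have st: "0 \<le> min t (p n)" "min t (p n) \<le> min t (p (Suc n))" using p0 t by auto
      have Sm: "S \<in> borel_measurable (F (ennreal (p n)))"
      proof -
        have "elem_integral B n p G t = elem_integral B n p G (p n)"
          using elem_integral_outside[OF sub[of n], of "p n" t] n True by (auto simp: fun_eq_iff)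
        then show ?thesis
          using elem_integral_adapted[OF sub[of n] p0(1), of G] Gm n by (simp add: S_def[abs_def])
      qed
      obtain C where C: "\<And>\<omega>. \<omega> \<in> space M \<Longrightarrow> \<bar>G n \<omega>\<bar> \<le> C" using el n unfolding elementary_def by blast
      have x1: "(\<lambda>\<omega>. 2 * (S \<omega> * G n \<omega>)) \<in> borel_measurable (F (ennreal (min t (p n))))"
        unfolding mn using Sm Gm[OF n] by measurable
      have x1i: "integrable M (\<lambda>\<omega>. 2 * (S \<omega> * G n \<omega>))"
      proof (rule Bochner_Integration.integrable_bound)
        show "integrable M (\<lambda>\<omega>. (S \<omega>)\<^sup>2 + (G n \<omega>)\<^sup>2)" using IH Gi[OF n] by auto
        show "AE \<omega> in M. norm (2 * (S \<omega> * G n \<omega>)) \<le> norm ((S \<omega>)\<^sup>2 + (G n \<omega>)\<^sup>2)"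
        proof (rule AE_I2)
          fix \<omega>
          have "\<bar>2 * (S \<omega> * G n \<omega>)\<bar> \<le> (S \<omega>)\<^sup>2 + (G n \<omega>)\<^sup>2"
            using sum_squares_bound[of "\<bar>S \<omega>\<bar>" "\<bar>G n \<omega>\<bar>"] by (simp add: abs_mult)
          then show "norm (2 * (S \<omega> * G n \<omega>)) \<le> norm ((S \<omega>)\<^sup>2 + (G n \<omega>)\<^sup>2)" by simp
        qed
      qed (use measurable_F_M[OF x1] in simp)
      have x2: "(\<lambda>\<omega>. (G n \<omega>)\<^sup>2) \<in> borel_measurable (F (ennreal (min t (p n))))"
        unfolding mn using Gm[OF n] by measurable
      note J1 = increment_indep_integral[OF st x1 x1i, of 1, folded b_def]
      note J2 = increment_indep_integral[OF st x2 Gi[OF n], of 2, folded b_def]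
      have m1: "(\<integral>\<omega>. b \<omega> \<partial>M) = 0" using increment_mean[OF st] by (simp add: b_def)
      have m2: "(\<integral>\<omega>. (b \<omega>)\<^sup>2 \<partial>M) = \<Delta> n" using increment_variance[OF st] by (simp add: b_def \<Delta>_def)
      have sq: "(S \<omega> + G n \<omega> * b \<omega>)\<^sup>2 = (S \<omega>)\<^sup>2 + (2 * (S \<omega> * G n \<omega>) * b \<omega> ^ 1 + (G n \<omega>)\<^sup>2 * (b \<omega>)\<^sup>2)" for \<omega>
        by (simp add: power2_sum power_mult_distrib algebra_simps)
      have "integrable M (\<lambda>\<omega>. (S \<omega> + G n \<omega> * b \<omega>)\<^sup>2)"
        unfolding sq using IH(1) J1(1) J2(1) by (intro Bochner_Integration.integrable_add)
      moreover have "(\<integral>\<omega>. (S \<omega> + G n \<omega> * b \<omega>)\<^sup>2 \<partial>M) = (\<integral>\<omega>. (S \<omega>)\<^sup>2 \<partial>M) + ((\<integral>\<omega>. 2 * (S \<omega> * G n \<omega>) * b \<omega> ^ 1 \<partial>M)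
          + (\<integral>\<omega>. (G n \<omega>)\<^sup>2 * (b \<omega>)\<^sup>2 \<partial>M))"
        unfolding sq
        by (subst Bochner_Integration.integral_add[OF IH(1) Bochner_Integration.integrable_add[OF J1(1) J2(1)]],
            subst Bochner_Integration.integral_add[OF J1(1) J2(1)]) simp
      moreover have "(\<integral>\<omega>. 2 * (S \<omega> * G n \<omega>) * b \<omega> ^ 1 \<partial>M) = 0" unfolding J1(2) using m1 by simp
      moreover have "(\<integral>\<omega>. (G n \<omega>)\<^sup>2 * (b \<omega>)\<^sup>2 \<partial>M) = (\<integral>\<omega>. (G n \<omega>)\<^sup>2 * \<Delta> n \<partial>M)"
        unfolding J2(2) m2 by simp
      moreover have "(\<integral>\<omega>. (\<Sum>i<Suc n. (G i \<omega>)\<^sup>2 * \<Delta> i) \<partial>M)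
          = (\<integral>\<omega>. (\<Sum>i<n. (G i \<omega>)\<^sup>2 * \<Delta> i) \<partial>M) + (\<integral>\<omega>. (G n \<omega>)\<^sup>2 * \<Delta> n \<partial>M)"
        using sumi Gi[OF n] by (simp add: Bochner_Integration.integral_add)
      ultimately show ?thesis unfolding eq IH(2) by simp
    qed
  qed
  from this[of N] show "integrable M (\<lambda>\<omega>. (elem_integral B N p G t \<omega>)\<^sup>2)"
    and "(\<integral>\<omega>. (elem_integral B N p G t \<omega>)\<^sup>2 \<partial>M)
      = (\<integral>\<omega>. (\<Sum>i<N. (G i \<omega>)\<^sup>2 * (min t (p (Suc i)) - min t (p i))) \<partial>M)"
    by (auto simp: \<Delta>_def)
qed

text \<open>
  An inequality of Lenglart type. The integrand is switched off as soon as its accumulated square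
  \<open>Q\<close> would exceed \<open>d\<close>. Since \<open>Q (Suc i)\<close> is known at the partition point \<open>p i\<close>, the result is again
  elementary; its integral has second moment at most \<open>d\<close> and agrees with the original one where
  \<open>Q N \<le> d\<close>. Integrals can thus be compared in probability although no moments are controlled.
\<close>

lemma elem_integral_tail:
  assumes el: "elementary M F N p G" and t: "0 \<le> t" and d: "0 < d" and e: "0 < e" and R: "R \<in> sets M"
  defines "Q \<equiv> \<lambda>n \<omega>. \<Sum>i<n. (G i \<omega>)\<^sup>2 * (min t (p (Suc i)) - min t (p i))"
  shows "measure M {\<omega> \<in> R. e < \<bar>elem_integral B N p G t \<omega>\<bar>} \<le> d / e\<^sup>2 + measure M {\<omega> \<in> R. d < Q N \<omega>}"
proof -
  have Gm: "G i \<in> borel_measurable (F (ennreal (p i)))" if "i < N" for i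
    using el that by (auto simp: elementary_def)
  have \<Delta>: "0 \<le> min t (p (Suc i)) - min t (p i)" if "i < N" for i
    using el that by (auto simp: elementary_def)
  have Qmono: "Q i \<omega> \<le> Q j \<omega>" if "i \<le> j" "j \<le> N" for i j \<omega>
    unfolding Q_def using that \<Delta> by (intro sum_mono2) (auto simp: \<Delta>)
  have Qm: "Q (Suc i) \<in> borel_measurable (F (ennreal (p i)))" if i: "i < N" for i
    unfolding Q_def
  proof (intro borel_measurable_sum borel_measurable_times borel_measurable_power borel_measurable_const)
    fix j assume "j \<in> {..<Suc i}"
    then show "G j \<in> borel_measurable (F (ennreal (p i)))"
      using measurable_F_mono[OF elementary_mono[OF el, of j i] Gm[of j]] i by auto
  qed
  \<comment> \<open>The sum up to \<open>i\<close> inclusive enters, so the accumulated square never jumps over \<open>d\<close>.\<close>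
  define G' where "G' i \<omega> = (if Q (Suc i) \<omega> \<le> d then G i \<omega> else 0)" for i \<omega>
  have el': "elementary M F N p G'"
    unfolding elementary_def
  proof (intro conjI allI impI)
    show "0 \<le> p 0" using el by (auto simp: elementary_def)
    fix i assume i: "i < N"
    show "p i \<le> p (Suc i)" using el i unfolding elementary_def by blast
    have "Measurable.pred (F (ennreal (p i))) (\<lambda>\<omega>. Q (Suc i) \<omega> \<le> d)"
      using Qm[OF i] by measurable
    then show "G' i \<in> borel_measurable (F (ennreal (p i)))"
      unfolding G'_def using Gm[OF i] by measurable
    obtain C where C: "\<forall>\<omega>\<in>space M. \<bar>G i \<omega>\<bar> \<le> C" using el i unfolding elementary_def by blast
    have "\<bar>G' i \<omega>\<bar> \<le> C" if "\<omega> \<in> space M" for \<omega>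
      using C that abs_ge_zero[of "G i \<omega>"] by (auto simp: G'_def intro: order_trans)
    then show "\<exists>C. \<forall>\<omega>\<in>space M. \<bar>G' i \<omega>\<bar> \<le> C" by blast
  qed
  have Q'le: "n \<le> N \<Longrightarrow> (\<Sum>i<n. (G' i \<omega>)\<^sup>2 * (min t (p (Suc i)) - min t (p i))) \<le> d" for n \<omega>
  proof (induction n)
    case 0
    then show ?case using d by simp
  next
    case (Suc n)
    show ?case
    proof (cases "Q (Suc n) \<omega> \<le> d")
      case True
      have "(\<Sum>i<Suc n. (G' i \<omega>)\<^sup>2 * (min t (p (Suc i)) - min t (p i))) \<le> Q (Suc n) \<omega>"
        unfolding Q_def using \<Delta> Suc.prems by (intro sum_mono mult_right_mono) (auto simp: G'_def)
      then show ?thesis using True by simp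
    next
      case False
      then show ?thesis using Suc by (simp add: G'_def)
    qed
  qed
  define S where "S = elem_integral B N p G' t"
  note sm = elem_integral_second_moment[OF el' t, folded S_def]
  have Sm[measurable]: "S \<in> borel_measurable M"
    unfolding S_def using el' t
    by (intro measurable_F_M[OF elem_integral_adapted[OF el']]) (auto simp: elementary_def)
  have G'm: "G' i \<in> borel_measurable M" if "i < N" for i
    using el' that measurable_F_M by (auto simp: elementary_def)
  have "(\<integral>\<omega>. (S \<omega>)\<^sup>2 \<partial>M) \<le> (\<integral>\<omega>. d \<partial>M)"
    unfolding sm(2)
  proof (rule integral_mono)
    show "integrable M (\<lambda>\<omega>. \<Sum>i<N. (G' i \<omega>)\<^sup>2 * (min t (p (Suc i)) - min t (p i)))"
    proof (rule integrable_bounded[where q=d])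
      show "\<bar>\<Sum>i<N. (G' i \<omega>)\<^sup>2 * (min t (p (Suc i)) - min t (p i))\<bar> \<le> d" for \<omega>
        using Q'le[of N \<omega>] \<Delta> by (subst abs_of_nonneg) (auto intro!: sum_nonneg mult_nonneg_nonneg)
    qed (use G'm in \<open>auto intro!: borel_measurable_sum\<close>)
  qed (use Q'le in auto)
  then have ES: "(\<integral>\<omega>. (S \<omega>)\<^sup>2 \<partial>M) \<le> d" by (simp add: prob_space)
  have "measure M {\<omega> \<in> space M. e\<^sup>2 \<le> (S \<omega>)\<^sup>2} \<le> (\<integral>\<omega>. (S \<omega>)\<^sup>2 \<partial>M) / e\<^sup>2"
    by (rule integral_Markov_inequality_measure[where A="{}", OF sm(1)]) (use e in auto)
  also have "\<dots> \<le> d / e\<^sup>2" using ES e by (simp add: divide_right_mono)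
  finally have markov: "measure M {\<omega> \<in> space M. e\<^sup>2 \<le> (S \<omega>)\<^sup>2} \<le> d / e\<^sup>2" .
  have QN[measurable]: "Q N \<in> borel_measurable M"
    unfolding Q_def using measurable_F_M[OF Gm] by (auto intro!: borel_measurable_sum)
  note [measurable] = R
  have "{\<omega> \<in> R. e < \<bar>elem_integral B N p G t \<omega>\<bar>} \<subseteq> {\<omega> \<in> space M. e\<^sup>2 \<le> (S \<omega>)\<^sup>2} \<union> {\<omega> \<in> R. d < Q N \<omega>}"
  proof
    fix \<omega> assume w: "\<omega> \<in> {\<omega> \<in> R. e < \<bar>elem_integral B N p G t \<omega>\<bar>}"
    then have wM: "\<omega> \<in> space M" using sets.sets_into_space[OF R] by auto
    show "\<omega> \<in> {\<omega> \<in> space M. e\<^sup>2 \<le> (S \<omega>)\<^sup>2} \<union> {\<omega> \<in> R. d < Q N \<omega>}"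
    proof (cases "d < Q N \<omega>")
      case False
      then have "G' i \<omega> = G i \<omega>" if "i < N" for i
        using Qmono[of "Suc i" N \<omega>] that by (auto simp: G'_def)
      then have "S \<omega> = elem_integral B N p G t \<omega>" unfolding S_def elem_integral_def by (intro sum.cong) auto
      then have "e \<le> \<bar>S \<omega>\<bar>" using w by simp
      then have "e\<^sup>2 \<le> (S \<omega>)\<^sup>2" using e power_mono[of e "\<bar>S \<omega>\<bar>" 2] by simp
      then show ?thesis using wM by simp
    qed (use w in simp)
  qed
  then have "measure M {\<omega> \<in> R. e < \<bar>elem_integral B N p G t \<omega>\<bar>}
      \<le> measure M ({\<omega> \<in> space M. e\<^sup>2 \<le> (S \<omega>)\<^sup>2} \<union> {\<omega> \<in> R. d < Q N \<omega>})"
    by (intro finite_measure_mono) (auto intro!: sets.Un)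
  also have "\<dots> \<le> measure M {\<omega> \<in> space M. e\<^sup>2 \<le> (S \<omega>)\<^sup>2} + measure M {\<omega> \<in> R. d < Q N \<omega>}"
    by (intro measure_Un_le) auto
  finally show ?thesis using markov by simp
qed

end

section \<open>Approximation of the diffusion in a window\<close>

text \<open>
  Reduces events about a whole continuous path to countably many times.
\<close>

lemma continuous_closed_rational:
  fixes g :: "real \<Rightarrow> real"
  assumes "continuous_on UNIV g" "closed S" "\<And>q::rat. g (of_rat q) \<in> S"
  shows "g v \<in> S"
proof (rule ccontr)
  assume "g v \<notin> S"
  then have "v \<in> g -` (- S)" by simp
  moreover have "open (g -` (- S))"
    using assms(1,2) by (intro open_vimage) (auto simp: open_Compl)
  ultimately obtain e where e: "e > 0" "ball v e \<subseteq> g -` (- S)" using openE by blast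
  obtain q :: rat where "v < of_rat q" "of_rat q < v + e" using of_rat_dense[of v "v + e"] e by auto
  then have "of_rat q \<in> ball v e" by (auto simp: dist_real_def)
  then show False using e assms(3) by blast
qed

lemma elem_integral_diff:
  "elem_integral B N p (\<lambda>i \<omega>. \<xi> i \<omega> - \<zeta> i \<omega>) t \<omega> = elem_integral B N p \<xi> t \<omega> - elem_integral B N p \<zeta> t \<omega>"
  by (simp only: elem_integral_def sum_subtractf[symmetric] left_diff_distrib)

lemma elem_process_comp:
  assumes "elementary M F N p \<xi>" "g 0 = 0"
  shows "elem_process N p (\<lambda>i \<omega>. g (\<eta> i \<omega>)) u \<omega> = g (elem_process N p \<eta> u \<omega>)"
  by (rule elem_process_cases[OF assms(1), of u])
    (use assms in \<open>auto simp: elem_process_eq[OF assms(1)] elem_process_outside[OF assms(1)]\<close>)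

lemma elem_square_integral:
  assumes el: "elementary M F N p \<xi>" and t: "0 \<le> t"
  shows "ennreal (\<Sum>i<N. (G i \<omega>)\<^sup>2 * (min t (p (Suc i)) - min t (p i)))
    = (\<integral>\<^sup>+u\<in>{0..t}. ennreal ((elem_process N p G u \<omega>)\<^sup>2) \<partial>lborel)"
proof -
  have pp: "0 \<le> p i" "p i \<le> p (Suc i)" if "i < N" for i
    using elementary_nonneg[OF el, of i] elementary_mono[OF el, of i "Suc i"] that by auto
  have eq: "{p i<..p (Suc i)} \<inter> {0..t} = {min t (p i)<..min t (p (Suc i))}" if "i < N" for i
    using pp[OF that] by auto
  have "(\<integral>\<^sup>+u\<in>{0..t}. ennreal ((elem_process N p G u \<omega>)\<^sup>2) \<partial>lborel)
    = (\<integral>\<^sup>+u. (\<Sum>i<N. ennreal ((G i \<omega>)\<^sup>2) * indicator {min t (p i)<..min t (p (Suc i))} u) \<partial>lborel)"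
  proof (rule nn_integral_cong)
    fix u
    have "(elem_process N p G u \<omega>)\<^sup>2 = elem_process N p (\<lambda>i \<omega>. (G i \<omega>)\<^sup>2) u \<omega>"
      using elem_process_comp[OF el, of "\<lambda>y. y\<^sup>2" G] by simp
    then have "ennreal ((elem_process N p G u \<omega>)\<^sup>2) = (\<Sum>i<N. ennreal ((G i \<omega>)\<^sup>2 * indicator {p i<..p (Suc i)} u))"
      by (subst sum_ennreal) (simp_all add: elem_process_def)
    then have "ennreal ((elem_process N p G u \<omega>)\<^sup>2) * indicator {0..t} u
      = (\<Sum>i<N. ennreal ((G i \<omega>)\<^sup>2 * indicator {p i<..p (Suc i)} u) * indicator {0..t} u)"
      by (simp only: sum_distrib_right)
    also have "\<dots> = (\<Sum>i<N. ennreal ((G i \<omega>)\<^sup>2) * indicator {min t (p i)<..min t (p (Suc i))} u)"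
      using eq by (intro sum.cong refl) (auto simp: indicator_def set_eq_iff)
    finally show "ennreal ((elem_process N p G u \<omega>)\<^sup>2) * indicator {0..t} u
      = (\<Sum>i<N. ennreal ((G i \<omega>)\<^sup>2) * indicator {min t (p i)<..min t (p (Suc i))} u)" .
  qed
  also have "\<dots> = (\<Sum>i<N. (\<integral>\<^sup>+u. ennreal ((G i \<omega>)\<^sup>2) * indicator {min t (p i)<..min t (p (Suc i))} u \<partial>lborel))"
    by (rule nn_integral_sum) simp
  also have "\<dots> = (\<Sum>i<N. ennreal ((G i \<omega>)\<^sup>2 * (min t (p (Suc i)) - min t (p i))))"
  proof (rule sum.cong[OF refl])
    fix i assume "i \<in> {..<N}"
    then have "min t (p i) \<le> min t (p (Suc i))" using pp[of i] by auto
    then show "(\<integral>\<^sup>+u. ennreal ((G i \<omega>)\<^sup>2) * indicator {min t (p i)<..min t (p (Suc i))} u \<partial>lborel)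
        = ennreal ((G i \<omega>)\<^sup>2 * (min t (p (Suc i)) - min t (p i)))"
      by (simp add: nn_integral_cmult ennreal_mult'')
  qed
  also have "\<dots> = ennreal (\<Sum>i<N. (G i \<omega>)\<^sup>2 * (min t (p (Suc i)) - min t (p i)))"
    using pp by (intro sum_ennreal mult_nonneg_nonneg) (auto simp: min_le_iff_disj)
  finally show ?thesis by simp
qed

text \<open>
  The diffusion seen through a window \<open>[lo, hi]\<close> on which both coefficients are bounded by \<open>C\<close>. The
  elementary integrands \<open>\<xi> n\<close> approximate \<open>\<sigma> (X t)\<close>, which may be unbounded, in probability only. Clipping
  all coefficients at \<open>C\<close> changes nothing while the path stays in the window and puts the approximations
  under the bounded theory.
\<close>

locale localized_diffusion = brownian_basis M F B
  for M :: "'a measure" and F B +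
  fixes \<mu> \<sigma> :: "real \<Rightarrow> real" and x :: real and X :: "real \<Rightarrow> 'a \<Rightarrow> real" and lo hi C :: real
    and Nn :: "nat \<Rightarrow> nat" and pn :: "nat \<Rightarrow> nat \<Rightarrow> real" and \<xi> :: "nat \<Rightarrow> nat \<Rightarrow> 'a \<Rightarrow> real"
    and I :: "real \<Rightarrow> 'a \<Rightarrow> real"
  assumes \<mu>_meas: "\<mu> \<in> borel_measurable (restrict_space borel {0<..})"
    and \<sigma>_meas: "\<sigma> \<in> borel_measurable (restrict_space borel {0<..})"
    and X_adapted: "0 \<le> t \<Longrightarrow> X t \<in> borel_measurable (F (ennreal t))"
    and X_continuous: "\<omega> \<in> space M \<Longrightarrow> continuous_on {0..} (\<lambda>t. X t \<omega>)"
    and X_pos: "\<omega> \<in> space M \<Longrightarrow> 0 \<le> t \<Longrightarrow> 0 < X t \<omega>"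
    and \<mu>_bound: "lo \<le> y \<Longrightarrow> y \<le> hi \<Longrightarrow> \<bar>\<mu> y\<bar> \<le> C"
    and \<sigma>_bound: "lo \<le> y \<Longrightarrow> y \<le> hi \<Longrightarrow> \<bar>\<sigma> y\<bar> \<le> C"
    and C_nonneg: "0 \<le> C"
    and elem: "elementary M F (Nn n) (pn n) (\<xi> n)"
    and approx: "0 \<le> T \<Longrightarrow> tends_to_0_in_prob M (\<lambda>n \<omega>. \<integral>\<^sup>+t\<in>{0..T}.
           ennreal ((elem_process (Nn n) (pn n) (\<xi> n) t \<omega> - \<sigma> (X t \<omega>))\<^sup>2) \<partial>lborel)"
    and approx_int: "0 \<le> t \<Longrightarrow> tends_to_0_in_prob M (\<lambda>n \<omega>.
           ennreal \<bar>elem_integral B (Nn n) (pn n) (\<xi> n) t \<omega> - I t \<omega>\<bar>)"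
    and I_meas: "0 \<le> t \<Longrightarrow> I t \<in> borel_measurable M"
    and sde: "AE \<omega> in M. \<forall>t\<ge>0. X t \<omega> = x + (LBINT s:{0..t}. \<mu> (X s \<omega>)) + I t \<omega>"
begin

definition clip :: "real \<Rightarrow> real" where "clip y = max (- C) (min C y)"
text \<open>
  The coefficients are given on the open half line only; the extension by \<open>0\<close> is Borel on the line.
\<close>

definition \<mu>0 :: "real \<Rightarrow> real" where "\<mu>0 y = (if 0 < y then \<mu> y else 0)"
definition \<sigma>0 :: "real \<Rightarrow> real" where "\<sigma>0 y = (if 0 < y then \<sigma> y else 0)"
definition \<beta> :: "real \<Rightarrow> 'a \<Rightarrow> real" where "\<beta> u \<omega> = clip (\<mu>0 (X (max 0 u) \<omega>))"
definition \<eta> :: "real \<Rightarrow> 'a \<Rightarrow> real" where "\<eta> u \<omega> = clip (\<sigma>0 (X (max 0 u) \<omega>))"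
definition \<zeta> :: "nat \<Rightarrow> nat \<Rightarrow> 'a \<Rightarrow> real" where "\<zeta> n i \<omega> = clip (\<xi> n i \<omega>)"
definition R :: "real \<Rightarrow> 'a set" where "R t = {\<omega> \<in> space M. \<forall>u\<in>{0..t}. X u \<omega> \<in> {lo..hi}}"

lemma clip_bound: "\<bar>clip y\<bar> \<le> C" and clip_0: "clip 0 = 0" and clip_id: "\<bar>y\<bar> \<le> C \<Longrightarrow> clip y = y"
  and clip_lip: "\<bar>clip y - clip z\<bar> \<le> \<bar>y - z\<bar>"
  and clip_dist: "\<bar>z\<bar> \<le> C \<Longrightarrow> \<bar>y - clip y\<bar> \<le> \<bar>y - z\<bar>"
  using C_nonneg by (auto simp: clip_def max_def min_def)

lemma clip_measurable [measurable]: "clip \<in> borel_measurable borel"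
  unfolding clip_def[abs_def] by measurable

lemma \<mu>0_measurable [measurable]: "\<mu>0 \<in> borel_measurable borel"
proof -
  have "(\<lambda>y. \<mu> y * indicator {0<..} y) \<in> borel_measurable borel"
    using \<mu>_meas by (subst (asm) borel_measurable_restrict_space_iff) (auto simp: mult.commute)
  moreover have "\<mu>0 = (\<lambda>y. \<mu> y * indicator {0<..} y)" by (auto simp: \<mu>0_def fun_eq_iff indicator_def)
  ultimately show ?thesis by simp
qed

lemma \<sigma>0_measurable [measurable]: "\<sigma>0 \<in> borel_measurable borel"
proof -
  have "(\<lambda>y. \<sigma> y * indicator {0<..} y) \<in> borel_measurable borel"
    using \<sigma>_meas by (subst (asm) borel_measurable_restrict_space_iff) (auto simp: mult.commute)
  moreover have "\<sigma>0 = (\<lambda>y. \<sigma> y * indicator {0<..} y)" by (auto simp: \<sigma>0_def fun_eq_iff indicator_def)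
  ultimately show ?thesis by simp
qed

lemma X_path:
  assumes "\<omega> \<in> space M" "continuous_on UNIV g" "\<And>u. 0 \<le> g u"
  shows "continuous_on UNIV (\<lambda>u. X (g u) \<omega>)"
  by (rule continuous_on_compose2[OF X_continuous[OF assms(1)] assms(2)]) (use assms in auto)

lemma X_joint: "(\<lambda>p. X (max 0 (fst p)) (snd p)) \<in> borel_measurable (borel \<Otimes>\<^sub>M M)"
proof -
  have "X (max 0 t) \<in> borel_measurable M" for t
    by (rule measurable_F_M[OF X_adapted]) simp
  from borel_measurable_pair_continuous_process[of "\<lambda>t. X (max 0 t)", OF this X_path]
  have "(\<lambda>p. X (max 0 (snd p)) (fst p)) \<in> borel_measurable (M \<Otimes>\<^sub>M borel)"
    by (simp add: split_beta' continuous_intros)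
  from measurable_compose[OF measurable_Pair[OF measurable_snd measurable_fst] this]
  show ?thesis by simp
qed

lemma \<beta>_meas: "(\<lambda>p. \<beta> (fst p) (snd p)) \<in> borel_measurable (borel \<Otimes>\<^sub>M M)"
  unfolding \<beta>_def using X_joint by measurable

lemma \<eta>_meas: "(\<lambda>p. \<eta> (fst p) (snd p)) \<in> borel_measurable (borel \<Otimes>\<^sub>M M)"
  unfolding \<eta>_def using X_joint by measurable

text \<open>
  For times up to \<open>t\<close> the path may be frozen at time \<open>t\<close>; the frozen process is jointly measurable with
  respect to the information at \<open>t\<close>, so Fubini's theorem gives an integral measurable at \<open>t\<close>.
\<close>

lemma \<beta>_adapted:
  assumes t: "0 \<le> t"
  shows "(\<lambda>\<omega>. LBINT v:{0<..t}. \<beta> v \<omega>) \<in> borel_measurable (F (ennreal t))"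
proof -
  have a: "X (max 0 (min t v)) \<in> borel_measurable (F (ennreal t))" for v
    using t by (intro measurable_F_mono[OF _ X_adapted]) auto
  have b: "continuous_on UNIV (\<lambda>v. X (max 0 (min t v)) \<omega>)" if "\<omega> \<in> space (F (ennreal t))" for \<omega>
    using that by (intro X_path) (auto simp: space_F intro!: continuous_intros)
  have "(\<lambda>(\<omega>, v). X (max 0 (min t v)) \<omega>) \<in> borel_measurable (F (ennreal t) \<Otimes>\<^sub>M borel)"
    by (rule borel_measurable_pair_continuous_process[of "\<lambda>v. X (max 0 (min t v))", OF a b])
  then have [measurable]: "(\<lambda>p. X (max 0 (min t (snd p))) (fst p)) \<in> borel_measurable (F (ennreal t) \<Otimes>\<^sub>M borel)"
    by (simp add: split_beta')
  have "(\<lambda>p. indicator {0<..t} (snd p) *\<^sub>R clip (\<mu>0 (X (max 0 (min t (snd p))) (fst p)))) \<in> borel_measurable (F (ennreal t) \<Otimes>\<^sub>M borel)"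
    by measurable
  then have "(\<lambda>(\<omega>, v). indicator {0<..t} v *\<^sub>R clip (\<mu>0 (X (max 0 (min t v)) \<omega>))) \<in> borel_measurable (F (ennreal t) \<Otimes>\<^sub>M lborel)"
    by (simp add: split_beta' cong: measurable_cong_sets)
  from lborel.borel_measurable_lebesgue_integral[OF this]
  have "(\<lambda>\<omega>. LBINT v:{0<..t}. clip (\<mu>0 (X (max 0 (min t v)) \<omega>))) \<in> borel_measurable (F (ennreal t))"
    by (simp add: set_lebesgue_integral_def)
  moreover have "(LBINT v:{0<..t}. clip (\<mu>0 (X (max 0 (min t v)) \<omega>))) = (LBINT v:{0<..t}. \<beta> v \<omega>)" for \<omega>
    by (rule set_lebesgue_integral_cong) (auto simp: \<beta>_def min_absorb2)
  ultimately show ?thesis by simp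
qed

lemma \<zeta>_elementary: "elementary M F (Nn n) (pn n) (\<zeta> n)"
  using elem[of n] clip_bound unfolding elementary_def \<zeta>_def[abs_def] by auto

sublocale E: elementary_ito_process M F B "Nn n" "pn n" "\<zeta> n" \<beta> C x for n
  by unfold_locales
    (use \<zeta>_elementary \<beta>_meas \<beta>_adapted clip_bound in \<open>auto simp: \<zeta>_def \<beta>_def\<close>)

abbreviation Zn :: "nat \<Rightarrow> real \<Rightarrow> 'a \<Rightarrow> real" where "Zn n \<equiv> E.Z n"
abbreviation Hn :: "nat \<Rightarrow> real \<Rightarrow> 'a \<Rightarrow> real" where "Hn n \<equiv> elem_process (Nn n) (pn n) (\<zeta> n)"

lemma R_sets:
  assumes t: "0 \<le> t"
  shows "R t \<in> sets (F (ennreal t))"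
proof -
  have eq: "R t = {\<omega> \<in> space (F (ennreal t)). \<forall>q::rat. X (max 0 (min t (of_rat q))) \<omega> \<in> {lo..hi}}"
  proof (intro set_eqI iffI)
    fix \<omega> assume "\<omega> \<in> R t"
    then show "\<omega> \<in> {\<omega> \<in> space (F (ennreal t)). \<forall>q::rat. X (max 0 (min t (of_rat q))) \<omega> \<in> {lo..hi}}"
      using t by (auto simp: R_def space_F)
  next
    fix \<omega> assume w: "\<omega> \<in> {\<omega> \<in> space (F (ennreal t)). \<forall>q::rat. X (max 0 (min t (of_rat q))) \<omega> \<in> {lo..hi}}"
    then have wM: "\<omega> \<in> space M" by (simp add: space_F)
    have "X (max 0 (min t v)) \<omega> \<in> {lo..hi}" for v
      by (rule continuous_closed_rational[OF X_path[OF wM]])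
        (use w in \<open>auto intro!: continuous_intros\<close>)
    from this have "X u \<omega> \<in> {lo..hi}" if "u \<in> {0..t}" for u
      using that by (metis atLeastAtMost_iff max_absorb2 min_absorb2)
    then show "\<omega> \<in> R t" using wM by (simp add: R_def)
  qed
  have [measurable]: "X (max 0 (min t v)) \<in> borel_measurable (F (ennreal t))" for v
    using t by (intro measurable_F_mono[OF _ X_adapted]) auto
  show ?thesis unfolding eq by measurable
qed

lemma R_M [measurable]: "R t \<in> sets M"
proof (cases "0 \<le> t")
  case True
  then show ?thesis using R_sets sets_F_M by blast
next
  case False
  then have "R t = space M" by (auto simp: R_def)
  then show ?thesis by simp
qed

lemma R_antimono: "s \<le> t \<Longrightarrow> R t \<subseteq> R s"
  by (auto simp: R_def)

lemma R_coefficients: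
  assumes "\<omega> \<in> R t" "0 \<le> u" "u \<le> t"
  shows "\<beta> u \<omega> = \<mu> (X u \<omega>)" "\<eta> u \<omega> = \<sigma> (X u \<omega>)" "\<bar>\<sigma> (X u \<omega>)\<bar> \<le> C" "X u \<omega> \<in> {lo..hi}"
  using assms X_pos[of \<omega> u] \<mu>_bound[of "X u \<omega>"] \<sigma>_bound[of "X u \<omega>"]
  by (auto simp: R_def \<beta>_def \<eta>_def \<mu>0_def \<sigma>0_def max_absorb2 clip_id)

definition err :: "nat \<Rightarrow> real \<Rightarrow> 'a \<Rightarrow> ennreal" where
  "err n T \<omega> = (\<integral>\<^sup>+t\<in>{0..T}. ennreal ((elem_process (Nn n) (pn n) (\<xi> n) t \<omega> - \<sigma> (X t \<omega>))\<^sup>2) \<partial>lborel)"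

lemma \<xi>_process_meas: "(\<lambda>p. elem_process (Nn n) (pn n) (\<xi> n) (fst p) (snd p)) \<in> borel_measurable (borel \<Otimes>\<^sub>M M)"
  unfolding elem_process_def
proof (intro borel_measurable_sum)
  fix i assume "i \<in> {..<Nn n}"
  then have [measurable]: "\<xi> n i \<in> borel_measurable M"
    using elem[of n] measurable_F_M by (auto simp: elementary_def)
  show "(\<lambda>q. \<xi> n i (snd q) * indicator {pn n i<..pn n (Suc i)} (fst q)) \<in> borel_measurable (borel \<Otimes>\<^sub>M M)"
    by measurable
qed

lemma err_measurable [measurable]: "err n T \<in> borel_measurable M"
proof -
  have eq: "err n T \<omega> = (\<integral>\<^sup>+t. ennreal ((elem_process (Nn n) (pn n) (\<xi> n) t \<omega> - \<sigma>0 (X (max 0 t) \<omega>))\<^sup>2) * indicator {0..T} t \<partial>lborel)"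
    if "\<omega> \<in> space M" for \<omega>
    unfolding err_def using X_pos[OF that] by (intro nn_integral_cong) (auto simp: indicator_def \<sigma>0_def max_absorb2)
  note m = measurable_compose[OF measurable_Pair[OF measurable_snd measurable_fst]]
  have [measurable]: "(\<lambda>p. elem_process (Nn n) (pn n) (\<xi> n) (snd p) (fst p)) \<in> borel_measurable (M \<Otimes>\<^sub>M borel)"
    "(\<lambda>p. X (max 0 (snd p)) (fst p)) \<in> borel_measurable (M \<Otimes>\<^sub>M borel)"
    using m[OF \<xi>_process_meas[of n]] m[OF X_joint] by simp_all
  have "(\<lambda>p. ennreal ((elem_process (Nn n) (pn n) (\<xi> n) (snd p) (fst p) - \<sigma>0 (X (max 0 (snd p)) (fst p)))\<^sup>2) * indicator {0..T} (snd p))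
      \<in> borel_measurable (M \<Otimes>\<^sub>M borel)"
    by measurable
  then have "(\<lambda>(\<omega>, t). ennreal ((elem_process (Nn n) (pn n) (\<xi> n) t \<omega> - \<sigma>0 (X (max 0 t) \<omega>))\<^sup>2) * indicator {0..T} t)
      \<in> borel_measurable (M \<Otimes>\<^sub>M lborel)"
    by (simp add: split_beta' cong: measurable_cong_sets)
  from lborel.borel_measurable_nn_integral[OF this] show ?thesis
    by (simp add: eq cong: measurable_cong)
qed

lemma err_tends: "0 \<le> T \<Longrightarrow> 0 < e \<Longrightarrow> (\<lambda>n. measure M {\<omega> \<in> space M. err n T \<omega> > ennreal e}) \<longlonglongrightarrow> 0"
  using approx[of T] unfolding tends_to_0_in_prob_def err_def by simp

text \<open>
  While the path stays in the window, clipping does not change the drift. What remains is the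
  approximation error of the integral of \<open>\<xi> n\<close> and the integral of the part of \<open>\<xi> n\<close> that was clipped off.
\<close>

lemma Z_difference:
  assumes t: "0 \<le> t"
  shows "AE \<omega> in M. \<omega> \<in> R t \<longrightarrow> \<bar>Zn n t \<omega> - X t \<omega>\<bar>
    \<le> \<bar>elem_integral B (Nn n) (pn n) (\<xi> n) t \<omega> - I t \<omega>\<bar>
      + \<bar>elem_integral B (Nn n) (pn n) (\<lambda>i \<omega>. \<xi> n i \<omega> - \<zeta> n i \<omega>) t \<omega>\<bar>"
  using sde
proof eventually_elim
  case (elim \<omega>)
  show ?case
  proof
    assume w: "\<omega> \<in> R t"
    have "(LBINT s:{0..t}. \<mu> (X s \<omega>)) = (LBINT s:{0..t}. \<beta> s \<omega>)"
      by (rule set_lebesgue_integral_cong) (use R_coefficients[OF w] in auto)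
    also have "\<dots> = (LBINT s:{0<..t}. \<beta> s \<omega>)"
    proof -
      have "AE s in lborel. indicator {0..t} s *\<^sub>R \<beta> s \<omega> = indicator {0<..t} s *\<^sub>R \<beta> s \<omega>"
        using AE_lborel_singleton[of "0::real"] by eventually_elim (auto simp: indicator_def)
      moreover have "\<omega> \<in> space M" using w by (simp add: R_def)
      then have "(\<lambda>s. \<beta> s \<omega>) \<in> borel_measurable borel"
        using measurable_compose[OF measurable_Pair2'[of \<omega> M borel] \<beta>_meas] by simp
      ultimately show ?thesis unfolding set_lebesgue_integral_def
        by (intro Bochner_Integration.integral_cong_AE) auto
    qed
    finally have "Zn n t \<omega> - X t \<omega> = elem_integral B (Nn n) (pn n) (\<zeta> n) t \<omega> - I t \<omega>"
      using elim t by (simp add: E.Z_def max_absorb2)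
    then show "\<bar>Zn n t \<omega> - X t \<omega>\<bar> \<le> \<bar>elem_integral B (Nn n) (pn n) (\<xi> n) t \<omega> - I t \<omega>\<bar>
      + \<bar>elem_integral B (Nn n) (pn n) (\<lambda>i \<omega>. \<xi> n i \<omega> - \<zeta> n i \<omega>) t \<omega>\<bar>"
      unfolding elem_integral_diff by linarith
  qed
qed

text \<open>
  On \<open>R t\<close> the true integrand lies in \<open>[- C, C]\<close>, so clipping moves \<open>\<xi> n\<close> by at most its distance to the
  true integrand. Hence the clipped part is small in \<open>L\<^sup>2[0, t]\<close> in probability, and so is its integral.
\<close>

lemma truncation_tail:
  assumes t: "0 \<le> t" and e: "0 < e"
  shows "measure M {\<omega> \<in> R t. e < \<bar>elem_integral B (Nn n) (pn n) (\<lambda>i \<omega>. \<xi> n i \<omega> - \<zeta> n i \<omega>) t \<omega>\<bar>}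
    \<le> e + measure M {\<omega> \<in> space M. err n t \<omega> > ennreal (e ^ 3)}"
proof -
  define G where "G i \<omega> = \<xi> n i \<omega> - \<zeta> n i \<omega>" for i \<omega>
  have elG: "elementary M F (Nn n) (pn n) G"
    unfolding elementary_def
  proof (intro conjI allI impI)
    show "0 \<le> pn n 0" using elem[of n] by (auto simp: elementary_def)
    fix i assume i: "i < Nn n"
    show "pn n i \<le> pn n (Suc i)" using elem[of n] i by (auto simp: elementary_def)
    have [measurable]: "\<xi> n i \<in> borel_measurable (F (ennreal (pn n i)))"
      using elem[of n] i by (auto simp: elementary_def)
    show "G i \<in> borel_measurable (F (ennreal (pn n i)))" unfolding G_def \<zeta>_def by measurable
    obtain D where D: "\<forall>\<omega>\<in>space M. \<bar>\<xi> n i \<omega>\<bar> \<le> D" using elem[of n] i unfolding elementary_def by blast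
    have "\<bar>G i \<omega>\<bar> \<le> D + C" if "\<omega> \<in> space M" for \<omega>
      using D that clip_bound[of "\<xi> n i \<omega>"] abs_triangle_ineq4[of "\<xi> n i \<omega>" "clip (\<xi> n i \<omega>)"]
      by (force simp: G_def \<zeta>_def)
    then show "\<exists>C. \<forall>\<omega>\<in>space M. \<bar>G i \<omega>\<bar> \<le> C" by blast
  qed
  define Q where "Q \<omega> = (\<Sum>i<Nn n. (G i \<omega>)\<^sup>2 * (min t (pn n (Suc i)) - min t (pn n i)))" for \<omega>
  have "{\<omega> \<in> R t. e ^ 3 < Q \<omega>} \<subseteq> {\<omega> \<in> space M. err n t \<omega> > ennreal (e ^ 3)}"
  proof
    fix \<omega> assume "\<omega> \<in> {\<omega> \<in> R t. e ^ 3 < Q \<omega>}"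
    then have w: "\<omega> \<in> R t" and q: "e ^ 3 < Q \<omega>" by auto
    have "ennreal (Q \<omega>) \<le> err n t \<omega>"
      unfolding Q_def elem_square_integral[OF elG t] err_def
    proof (rule nn_integral_mono)
      fix u
      show "ennreal ((elem_process (Nn n) (pn n) G u \<omega>)\<^sup>2) * indicator {0..t} u
        \<le> ennreal ((elem_process (Nn n) (pn n) (\<xi> n) u \<omega> - \<sigma> (X u \<omega>))\<^sup>2) * indicator {0..t} u"
      proof (cases "u \<in> {0..t}")
        case True
        have "elem_process (Nn n) (pn n) G u \<omega> = elem_process (Nn n) (pn n) (\<xi> n) u \<omega> - clip (elem_process (Nn n) (pn n) (\<xi> n) u \<omega>)"
          using elem_process_comp[OF elG, of "\<lambda>y. y - clip y" "\<xi> n"] clip_0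
          unfolding G_def \<zeta>_def by simp
        then have "\<bar>elem_process (Nn n) (pn n) G u \<omega>\<bar> \<le> \<bar>elem_process (Nn n) (pn n) (\<xi> n) u \<omega> - \<sigma> (X u \<omega>)\<bar>"
          using clip_dist[OF R_coefficients(3)[OF w]] True by simp
        then show ?thesis by (auto intro!: mult_right_mono ennreal_leI simp: abs_le_square_iff)
      qed simp
    qed
    moreover have "ennreal (e ^ 3) < ennreal (Q \<omega>)" using q e by (subst ennreal_less_iff) auto
    ultimately show "\<omega> \<in> {\<omega> \<in> space M. err n t \<omega> > ennreal (e ^ 3)}" using w by (auto simp: R_def)
  qed
  then have "measure M {\<omega> \<in> R t. e ^ 3 < Q \<omega>} \<le> measure M {\<omega> \<in> space M. err n t \<omega> > ennreal (e ^ 3)}"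
    by (intro finite_measure_mono) auto
  moreover have "e ^ 3 / e\<^sup>2 = e" using e by (simp add: power2_eq_square power3_eq_cube)
  ultimately show ?thesis
    using elem_integral_tail[OF elG t _ e R_M, of "e ^ 3" t] e unfolding Q_def[symmetric] G_def[symmetric] by simp
qed

lemma Z_tendsto:
  assumes t: "0 \<le> t"
  shows "(\<lambda>n. \<integral>\<omega>. indicator (R t) \<omega> * min 1 \<bar>Zn n t \<omega> - X t \<omega>\<bar> \<partial>M) \<longlonglongrightarrow> 0"
proof (rule LIMSEQ_I)
  fix \<epsilon> :: real assume \<epsilon>: "\<epsilon> > 0"
  define e where "e = \<epsilon> / 6"
  have e: "e > 0" using \<epsilon> by (simp add: e_def)
  define a where "a n = measure M {\<omega> \<in> space M. ennreal \<bar>elem_integral B (Nn n) (pn n) (\<xi> n) t \<omega> - I t \<omega>\<bar> > ennreal e}" for n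
  define b where "b n = measure M {\<omega> \<in> space M. err n t \<omega> > ennreal (e ^ 3)}" for n
  have lim: "(\<lambda>n. a n + b n) \<longlonglongrightarrow> 0 + 0"
    unfolding a_def b_def using approx_int[OF t] e
    by (intro tendsto_add err_tends[OF t]) (auto simp: tends_to_0_in_prob_def)
  have Xm[measurable]: "X t \<in> borel_measurable M" using measurable_F_M[OF X_adapted[OF t]] .
  note [measurable] = E.Z_measurable_at I_meas[OF t]
  have em[measurable]: "elem_integral B (Nn n) (pn n) (\<xi> n) t \<in> borel_measurable M" for n
    using elem[of n] by (intro measurable_F_M[OF elem_integral_adapted[OF elem[of n] t]]) (auto simp: elementary_def)
  have em2[measurable]: "elem_integral B (Nn n) (pn n) (\<lambda>i \<omega>. \<xi> n i \<omega> - \<zeta> n i \<omega>) t \<in> borel_measurable M" for n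
  proof -
    have "elem_integral B (Nn n) (pn n) (\<zeta> n) t \<in> borel_measurable M"
      using \<zeta>_elementary[of n] by (intro measurable_F_M[OF elem_integral_adapted[OF elem[of n] t]]) (auto simp: elementary_def)
    then show ?thesis unfolding elem_integral_diff[abs_def] by measurable
  qed
  have bound: "(\<integral>\<omega>. indicator (R t) \<omega> * min 1 \<bar>Zn n t \<omega> - X t \<omega>\<bar> \<partial>M) \<le> 3 * e + (a n + b n)" for n
  proof -
    define E1 where "E1 = {\<omega> \<in> space M. ennreal \<bar>elem_integral B (Nn n) (pn n) (\<xi> n) t \<omega> - I t \<omega>\<bar> > ennreal e}"
    define E2 where "E2 = {\<omega> \<in> R t. e < \<bar>elem_integral B (Nn n) (pn n) (\<lambda>i \<omega>. \<xi> n i \<omega> - \<zeta> n i \<omega>) t \<omega>\<bar>}"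
    have [measurable]: "E1 \<in> sets M" "E2 \<in> sets M" unfolding E1_def E2_def by measurable
    have "(\<integral>\<omega>. indicator (R t) \<omega> * min 1 \<bar>Zn n t \<omega> - X t \<omega>\<bar> \<partial>M) \<le> (\<integral>\<omega>. 2 * e + (indicator E1 \<omega> + indicator E2 \<omega>) \<partial>M)"
    proof (rule integral_mono_AE)
      show "integrable M (\<lambda>\<omega>. indicator (R t) \<omega> * min 1 \<bar>Zn n t \<omega> - X t \<omega>\<bar>)"
        by (rule integrable_bounded[where q=1]) (auto simp: indicator_def)
      show "integrable M (\<lambda>\<omega>. 2 * e + (indicator E1 \<omega> + indicator E2 \<omega>))" by (auto simp: emeasure_eq_measure)
      show "AE \<omega> in M. indicator (R t) \<omega> * min 1 \<bar>Zn n t \<omega> - X t \<omega>\<bar> \<le> 2 * e + (indicator E1 \<omega> + indicator E2 \<omega>)"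
        using Z_difference[OF t, of n]
      proof eventually_elim
        case (elim \<omega>)
        show ?case
        proof (cases "\<omega> \<in> R t \<and> \<omega> \<notin> E1 \<and> \<omega> \<notin> E2")
          case True
          then have "\<omega> \<in> space M" by (simp add: R_def)
          then have "\<bar>elem_integral B (Nn n) (pn n) (\<xi> n) t \<omega> - I t \<omega>\<bar> \<le> e"
            "\<bar>elem_integral B (Nn n) (pn n) (\<lambda>i \<omega>. \<xi> n i \<omega> - \<zeta> n i \<omega>) t \<omega>\<bar> \<le> e"
            using True e by (auto simp: E1_def E2_def not_less ennreal_le_iff)
          then show ?thesis using elim True by (auto simp: min_def)
        next
          case False
          then show ?thesis using e by (auto simp: indicator_def)
        qed
      qed
    qed
    also have "\<dots> = 2 * e + (measure M E1 + measure M E2)"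
      by (simp add: prob_space emeasure_eq_measure)
    also have "\<dots> \<le> 2 * e + (a n + (e + b n))"
      using truncation_tail[OF t e, of n] by (simp add: E1_def E2_def a_def b_def)
    finally show ?thesis by simp
  qed
  have nn: "0 \<le> (\<integral>\<omega>. indicator (R t) \<omega> * min 1 \<bar>Zn n t \<omega> - X t \<omega>\<bar> \<partial>M)" for n
    by (intro integral_nonneg_AE) (auto simp: indicator_def)
  obtain n0 where n0: "\<And>n. n \<ge> n0 \<Longrightarrow> norm (a n + b n - 0) < e"
    using LIMSEQ_D[OF lim[simplified] e] by (auto)
  have "norm ((\<integral>\<omega>. indicator (R t) \<omega> * min 1 \<bar>Zn n t \<omega> - X t \<omega>\<bar> \<partial>M) - 0) < \<epsilon>" if "n \<ge> n0" for n
    using bound[of n] nn[of n] n0[OF that] e unfolding e_def real_norm_def by linarith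
  then show "\<exists>no. \<forall>n\<ge>no. norm ((\<integral>\<omega>. indicator (R t) \<omega> * min 1 \<bar>Zn n t \<omega> - X t \<omega>\<bar> \<partial>M) - 0) < \<epsilon>" by blast
qed

lemma H_eta_joint: "(\<lambda>p. \<bar>Hn n (fst p) (snd p) - \<eta> (fst p) (snd p)\<bar>) \<in> borel_measurable (borel \<Otimes>\<^sub>M M)"
  using E.H_measurable[of n] \<eta>_meas by measurable

lemma H_eta_bound: "\<omega> \<in> space M \<Longrightarrow> \<bar>Hn n u \<omega> - \<eta> u \<omega>\<bar> \<le> 2 * C"
  using E.H_bound[of \<omega> n u] clip_bound[of "\<sigma>0 (X (max 0 u) \<omega>)"] by (simp add: \<eta>_def)

text \<open>
  Clipping is a contraction and makes the integrands bounded, which upgrades the convergence in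
  probability to convergence in mean.
\<close>

lemma H_tendsto:
  assumes T: "0 \<le> T"
  shows "(\<lambda>n. LBINT u:{0<..T}. \<integral>\<omega>. \<bar>Hn n u \<omega> - \<eta> u \<omega>\<bar> \<partial>M) \<longlonglongrightarrow> 0"
proof (rule LIMSEQ_I)
  fix \<epsilon> :: real assume \<epsilon>: "\<epsilon> > 0"
  define \<delta> where "\<delta> = \<epsilon> / (4 * (T + 1))"
  have \<delta>: "\<delta> > 0" and \<delta>T: "\<delta> * T \<le> \<epsilon> / 4" using \<epsilon> T by (auto simp: \<delta>_def field_simps)
  define e where "e = \<delta> * \<epsilon> / 4"
  have e: "e > 0" using \<epsilon> \<delta> by (simp add: e_def)
  define b where "b n = measure M {\<omega> \<in> space M. err n T \<omega> > ennreal e}" for n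
  have blim: "b \<longlonglongrightarrow> 0" unfolding b_def by (rule err_tends[OF T e])
  have ball1: "\<forall>u. \<forall>\<omega>\<in>space M. \<bar>\<bar>Hn n u \<omega> - \<eta> u \<omega>\<bar>\<bar> \<le> 2 * C" for n using H_eta_bound by simp
  have m2: "(\<lambda>p. (Hn n (fst p) (snd p) - \<eta> (fst p) (snd p))\<^sup>2) \<in> borel_measurable (borel \<Otimes>\<^sub>M M)" for n
    using E.H_measurable[of n] \<eta>_meas by measurable
  have ball2: "\<forall>u. \<forall>\<omega>\<in>space M. \<bar>(Hn n u \<omega> - \<eta> u \<omega>)\<^sup>2\<bar> \<le> 4 * C\<^sup>2" for n
    using power_mono[OF H_eta_bound, of _ n _ 2] by (simp add: power_mult_distrib)
  have bound: "(LBINT u:{0<..T}. \<integral>\<omega>. \<bar>Hn n u \<omega> - \<eta> u \<omega>\<bar> \<partial>M) \<le> \<epsilon> / 2 + (4 * C\<^sup>2 * T / \<delta>) * b n" for n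
  proof -
    note B1 = bounded_time_integral[of "\<lambda>u \<omega>. \<bar>Hn n u \<omega> - \<eta> u \<omega>\<bar>", OF H_eta_joint ball1]
    note B2 = bounded_time_integral[of "\<lambda>u \<omega>. (Hn n u \<omega> - \<eta> u \<omega>)\<^sup>2", OF m2 ball2]
    define V where "V \<omega> = (LBINT u:{0<..T}. (Hn n u \<omega> - \<eta> u \<omega>)\<^sup>2)" for \<omega>
    define E where "E = {\<omega> \<in> space M. err n T \<omega> > ennreal e}"
    have [measurable]: "E \<in> sets M" unfolding E_def by measurable
    have Vm[measurable]: "V \<in> borel_measurable M" unfolding V_def by (rule B2(4))
    have V0: "0 \<le> V \<omega>" for \<omega>
      unfolding V_def set_lebesgue_integral_def by (intro integral_nonneg_AE) auto
    have V4: "V \<omega> \<le> 4 * C\<^sup>2 * T" if "\<omega> \<in> space M" for \<omega>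
      using set_integral_abs_le[OF T B2(6)[OF that], of "4 * C\<^sup>2"] ball2[of n] that V0[of \<omega>] by (simp add: V_def)
    have Verr: "ennreal (V \<omega>) \<le> err n T \<omega>" if w: "\<omega> \<in> space M" for \<omega>
    proof -
      have "ennreal (V \<omega>) = (\<integral>\<^sup>+u. ennreal (indicator {0<..T} u *\<^sub>R (Hn n u \<omega> - \<eta> u \<omega>)\<^sup>2) \<partial>lborel)"
        unfolding V_def set_lebesgue_integral_def
        using B2(6)[OF w, of 0 T] by (intro nn_integral_eq_integral[symmetric]) (auto simp: set_integrable_def)
      also have "\<dots> \<le> err n T \<omega>"
        unfolding err_def
      proof (rule nn_integral_mono)
        fix u
        show "ennreal (indicator {0<..T} u *\<^sub>R (Hn n u \<omega> - \<eta> u \<omega>)\<^sup>2)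
          \<le> ennreal ((elem_process (Nn n) (pn n) (\<xi> n) u \<omega> - \<sigma> (X u \<omega>))\<^sup>2) * indicator {0..T} u"
        proof (cases "u \<in> {0<..T}")
          case True
          have "Hn n u \<omega> = clip (elem_process (Nn n) (pn n) (\<xi> n) u \<omega>)"
            unfolding \<zeta>_def using elem_process_comp[OF elem, of clip n "\<xi> n"] clip_0 by simp
          moreover have "\<eta> u \<omega> = clip (\<sigma> (X u \<omega>))"
            using X_pos[OF w, of u] True by (simp add: \<eta>_def \<sigma>0_def max_absorb2)
          ultimately have "\<bar>Hn n u \<omega> - \<eta> u \<omega>\<bar> \<le> \<bar>elem_process (Nn n) (pn n) (\<xi> n) u \<omega> - \<sigma> (X u \<omega>)\<bar>"
            using clip_lip by simp
          then show ?thesis using True by (auto intro!: ennreal_leI simp: abs_le_square_iff)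
        qed (auto simp: indicator_def)
      qed
      finally show ?thesis .
    qed
    have VE: "V \<omega> \<le> e + 4 * C\<^sup>2 * T * indicator E \<omega>" if w: "\<omega> \<in> space M" for \<omega>
    proof (cases "\<omega> \<in> E")
      case False
      then have "ennreal (V \<omega>) \<le> ennreal e" using Verr[OF w] w by (auto simp: E_def not_less)
      then show ?thesis using False e by (simp add: ennreal_le_iff)
    qed (use V4[OF w] e in simp)
    have "(LBINT u:{0<..T}. \<integral>\<omega>. \<bar>Hn n u \<omega> - \<eta> u \<omega>\<bar> \<partial>M) = (\<integral>\<omega>. (LBINT u:{0<..T}. \<bar>Hn n u \<omega> - \<eta> u \<omega>\<bar>) \<partial>M)"
      using B1(5)[of 0 T] by simp
    also have "\<dots> \<le> (\<integral>\<omega>. \<delta> * T + (e + 4 * C\<^sup>2 * T * indicator E \<omega>) / \<delta> \<partial>M)"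
    proof (rule integral_mono)
      show "integrable M (\<lambda>\<omega>. LBINT u:{0<..T}. \<bar>Hn n u \<omega> - \<eta> u \<omega>\<bar>)"
      proof (rule integrable_bounded[where q="2 * C * T"])
        show "(\<lambda>\<omega>. LBINT u:{0<..T}. \<bar>Hn n u \<omega> - \<eta> u \<omega>\<bar>) \<in> borel_measurable M" by (rule B1(4))
        fix \<omega> assume w: "\<omega> \<in> space M"
        show "\<bar>LBINT u:{0<..T}. \<bar>Hn n u \<omega> - \<eta> u \<omega>\<bar>\<bar> \<le> 2 * C * T"
          using set_integral_abs_le[OF T B1(6)[OF w], of "2 * C"] ball1[of n] w by simp
      qed
      show "integrable M (\<lambda>\<omega>. \<delta> * T + (e + 4 * C\<^sup>2 * T * indicator E \<omega>) / \<delta>)" by (auto simp: emeasure_eq_measure)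
      fix \<omega> assume w: "\<omega> \<in> space M"
      have i2: "set_integrable lborel {0<..T} (\<lambda>u. \<delta> + (Hn n u \<omega> - \<eta> u \<omega>)\<^sup>2 / \<delta>)"
        using B2(6)[OF w, of 0 T] set_integrable_bounded_Ioc[of "\<lambda>_. \<delta>" "\<delta>" 0 T] \<delta>
        by (intro set_integral_add set_integrable_divide) auto
      have "(LBINT u:{0<..T}. \<bar>Hn n u \<omega> - \<eta> u \<omega>\<bar>) \<le> (LBINT u:{0<..T}. \<delta> + (Hn n u \<omega> - \<eta> u \<omega>)\<^sup>2 / \<delta>)"
        using abs_le_add_square[OF \<delta>] by (intro set_integral_mono B1(6)[OF w] i2) auto
      also have "\<dots> = \<delta> * T + V \<omega> / \<delta>"
        unfolding V_def using B2(6)[OF w, of 0 T] set_integrable_bounded_Ioc[of "\<lambda>_. \<delta>" "\<delta>" 0 T] \<delta> T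
        by (subst set_integral_add) (auto simp: set_integral_const emeasure_bounded_finite[simplified])
      also have "\<dots> \<le> \<delta> * T + (e + 4 * C\<^sup>2 * T * indicator E \<omega>) / \<delta>"
        using VE[OF w] \<delta> by (simp add: divide_right_mono)
      finally show "(LBINT u:{0<..T}. \<bar>Hn n u \<omega> - \<eta> u \<omega>\<bar>) \<le> \<delta> * T + (e + 4 * C\<^sup>2 * T * indicator E \<omega>) / \<delta>" .
    qed
    also have "\<dots> = \<delta> * T + (e + 4 * C\<^sup>2 * T * measure M E) / \<delta>"
      by (simp add: prob_space emeasure_eq_measure)
    also have "\<dots> = \<delta> * T + e / \<delta> + (4 * C\<^sup>2 * T / \<delta>) * b n"
      by (simp add: add_divide_distrib b_def E_def)
    also have "e / \<delta> = \<epsilon> / 4" using \<delta> by (simp add: e_def)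
    finally show ?thesis using \<delta>T by simp
  qed
  have nn: "0 \<le> (LBINT u:{0<..T}. \<integral>\<omega>. \<bar>Hn n u \<omega> - \<eta> u \<omega>\<bar> \<partial>M)" for n
    unfolding set_lebesgue_integral_def by (intro integral_nonneg_AE) (auto intro!: mult_nonneg_nonneg integral_nonneg_AE)
  have "(\<lambda>n. (4 * C\<^sup>2 * T / \<delta>) * b n) \<longlonglongrightarrow> (4 * C\<^sup>2 * T / \<delta>) * 0" by (intro tendsto_intros blim)
  then obtain n0 where n0: "\<And>n. n \<ge> n0 \<Longrightarrow> norm ((4 * C\<^sup>2 * T / \<delta>) * b n - 0) < \<epsilon> / 2"
    using LIMSEQ_D[of "\<lambda>n. (4 * C\<^sup>2 * T / \<delta>) * b n" 0 "\<epsilon> / 2"] \<epsilon> by auto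
  have "norm ((LBINT u:{0<..T}. \<integral>\<omega>. \<bar>Hn n u \<omega> - \<eta> u \<omega>\<bar> \<partial>M) - 0) < \<epsilon>" if "n \<ge> n0" for n
    using bound[of n] nn[of n] n0[OF that] unfolding real_norm_def by linarith
  then show "\<exists>no. \<forall>n\<ge>no. norm ((LBINT u:{0<..T}. \<integral>\<omega>. \<bar>Hn n u \<omega> - \<eta> u \<omega>\<bar> \<partial>M) - 0) < \<epsilon>" by blast
qed

end

section \<open>The supermartingale inequality along a grid\<close>

text \<open>
  Continuity of the generator, applied to \<open>f\<close>, in the position and in the volatility; the drift value
  \<open>b\<close> is common to both sides because it is taken along the true path.
\<close>

lemma (in bounded_C2) generator_difference:
  assumes mod: "\<And>y z. \<bar>f'' y - f'' z\<bar> \<le> \<delta> + K * min 1 \<bar>y - z\<bar>" and \<delta>: "0 \<le> \<delta>" and K: "0 \<le> K" and r: "0 \<le> r"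
    and b: "\<bar>b\<bar> \<le> C" and g: "\<bar>g\<bar> \<le> C" and c: "\<bar>c\<bar> \<le> C"
  shows "\<bar>(f' z * b + f'' z * g\<^sup>2 / 2 - r * f z) - (f' y * b + f'' y * c\<^sup>2 / 2 - r * f y)\<bar>
    \<le> C\<^sup>2 * \<delta> / 2 + (2 * L * C + C\<^sup>2 * K / 2 + 2 * r * L) * min 1 \<bar>z - y\<bar> + L * C * \<bar>g - c\<bar>"
proof -
  define w where "w = min 1 \<bar>z - y\<bar>"
  have C0: "0 \<le> C" using b by simp
  have one: "\<bar>v\<bar> \<le> 2 * L * w" if "\<bar>v\<bar> \<le> L * \<bar>z - y\<bar>" "\<bar>v\<bar> \<le> 2 * L" for v
  proof (cases "\<bar>z - y\<bar> \<le> 1")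
    case True
    then show ?thesis using that L_nonneg mult_nonneg_nonneg[OF L_nonneg abs_ge_zero[of "z - y"]]
      by (auto simp: w_def)
  qed (use that in \<open>auto simp: w_def\<close>)
  have f: "\<bar>f z - f y\<bar> \<le> 2 * L * w"
    using f_lipschitz[of z y] f_bound[of z] f_bound[of y] by (intro one) auto
  have f1: "\<bar>f' z - f' y\<bar> \<le> 2 * L * w"
    using f'_lipschitz[of z y] f'_bound[of z] f'_bound[of y] by (intro one) auto
  have t1: "\<bar>(f' z - f' y) * b\<bar> \<le> 2 * L * w * C"
    unfolding abs_mult using f1 b by (intro mult_mono) auto
  have t2: "\<bar>r * (f z - f y)\<bar> \<le> r * (2 * L * w)"
    unfolding abs_mult using f r by (intro mult_mono) auto
  have c2: "c\<^sup>2 \<le> C\<^sup>2" using c C0 by (simp add: abs_le_square_iff[symmetric])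
  have t3: "\<bar>(f'' z - f'' y) * c\<^sup>2\<bar> \<le> (\<delta> + K * w) * C\<^sup>2"
    unfolding abs_mult w_def using mod[of z y] c2 \<delta> K by (intro mult_mono) auto
  have "\<bar>(g - c) * (g + c)\<bar> \<le> \<bar>g - c\<bar> * (2 * C)"
    unfolding abs_mult using g c by (intro mult_left_mono) auto
  then have "\<bar>f'' z\<bar> * \<bar>(g - c) * (g + c)\<bar> \<le> L * (\<bar>g - c\<bar> * (2 * C))"
    using f''_bound L_nonneg by (intro mult_mono) auto
  then have t4: "\<bar>f'' z * ((g - c) * (g + c))\<bar> \<le> 2 * (L * C * \<bar>g - c\<bar>)" by (simp add: abs_mult mult_ac)
  have eq: "(f' z * b + f'' z * g\<^sup>2 / 2 - r * f z) - (f' y * b + f'' y * c\<^sup>2 / 2 - r * f y)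
    = (f' z - f' y) * b + (f'' z * ((g - c) * (g + c))) / 2 + ((f'' z - f'' y) * c\<^sup>2) / 2 - r * (f z - f y)"
    by (simp add: algebra_simps power2_eq_square diff_divide_distrib add_divide_distrib)
  have "\<bar>(f' z * b + f'' z * g\<^sup>2 / 2 - r * f z) - (f' y * b + f'' y * c\<^sup>2 / 2 - r * f y)\<bar>
    \<le> 2 * L * w * C + L * C * \<bar>g - c\<bar> + (\<delta> + K * w) * C\<^sup>2 / 2 + r * (2 * L * w)"
    unfolding eq using t1 t2 t3 t4 by linarith
  also have "\<dots> = C\<^sup>2 * \<delta> / 2 + (2 * L * C + C\<^sup>2 * K / 2 + 2 * r * L) * w + L * C * \<bar>g - c\<bar>"
    by (simp add: algebra_simps add_divide_distrib)
  finally show ?thesis by (simp add: w_def)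
qed

context localized_diffusion
begin

lemma Z_0: "Zn n 0 \<omega> = x"
proof -
  have "0 \<le> pn n i" if "i \<le> Nn n" for i using elementary_nonneg[OF elem that] .
  then have "elem_integral B (Nn n) (pn n) (\<zeta> n) 0 \<omega> = 0"
    unfolding elem_integral_def by (intro sum.neutral) (auto simp: min_absorb1)
  then show ?thesis by (simp add: E.Z_def set_lebesgue_integral_def)
qed

lemma X_Z_joint: "(\<lambda>p. indicator S (snd p) * min 1 \<bar>Zn n (fst p) (snd p) - X (max 0 (fst p)) (snd p)\<bar>)
    \<in> borel_measurable (borel \<Otimes>\<^sub>M M)" if "S \<in> sets M"
  using E.Z_measurable[of n] X_joint that by measurable

text \<open>
  The event \<open>R t\<close> at the right end point is contained in every \<open>R u\<close> with \<open>u \<le> t\<close>; using it instead of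
  \<open>R u\<close> keeps the integrand measurable in \<open>u\<close>.
\<close>

lemma window_tendsto:
  assumes st: "0 \<le> s" "s \<le> t"
  shows "(\<lambda>n. LBINT u:{s<..t}. \<integral>\<omega>. indicator (R t) \<omega> * min 1 \<bar>Zn n u \<omega> - X (max 0 u) \<omega>\<bar> \<partial>M) \<longlonglongrightarrow> 0"
proof -
  define w where "w n u = (\<integral>\<omega>. indicator (R t) \<omega> * min 1 \<bar>Zn n u \<omega> - X (max 0 u) \<omega>\<bar> \<partial>M)" for n u
  have ball: "\<forall>u. \<forall>\<omega>\<in>space M. \<bar>indicator (R t) \<omega> * min 1 \<bar>Zn n u \<omega> - X (max 0 u) \<omega>\<bar>\<bar> \<le> 1" for n
    by (auto simp: indicator_def)
  have wm: "w n \<in> borel_measurable borel" and wb: "\<bar>w n u\<bar> \<le> 1" for n u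
    using bounded_time_integral(1,2)[of "\<lambda>u \<omega>. indicator (R t) \<omega> * min 1 \<bar>Zn n u \<omega> - X (max 0 u) \<omega>\<bar>", OF X_Z_joint[OF R_M] ball]
    by (auto simp: w_def[abs_def])
  have lim: "(\<lambda>n. w n u) \<longlonglongrightarrow> 0" if u: "s < u" "u \<le> t" for u
  proof (rule tendsto_sandwich[OF _ _ tendsto_const Z_tendsto[of u]])
    show "\<forall>\<^sub>F n in sequentially. 0 \<le> w n u"
      unfolding w_def by (intro always_eventually allI integral_nonneg_AE) (auto simp: indicator_def)
    have "w n u \<le> (\<integral>\<omega>. indicator (R u) \<omega> * min 1 \<bar>Zn n u \<omega> - X u \<omega>\<bar> \<partial>M)" for n
      unfolding w_def
    proof (rule integral_mono)
      have [measurable]: "X (max 0 u) \<in> borel_measurable M"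
        by (rule measurable_F_M[OF X_adapted]) simp
      have [measurable]: "X u \<in> borel_measurable M"
        using u st by (intro measurable_F_M[OF X_adapted]) simp
      note [measurable] = E.Z_measurable_at
      show "integrable M (\<lambda>\<omega>. indicator (R t) \<omega> * min 1 \<bar>Zn n u \<omega> - X (max 0 u) \<omega>\<bar>)"
        "integrable M (\<lambda>\<omega>. indicator (R u) \<omega> * min 1 \<bar>Zn n u \<omega> - X u \<omega>\<bar>)"
        by (auto intro!: integrable_bounded[where q=1] simp: indicator_def)
      fix \<omega>
      show "indicator (R t) \<omega> * min 1 \<bar>Zn n u \<omega> - X (max 0 u) \<omega>\<bar> \<le> indicator (R u) \<omega> * min 1 \<bar>Zn n u \<omega> - X u \<omega>\<bar>"
        using R_antimono[OF u(2)] u st by (auto simp: indicator_def max_absorb2)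
    qed
    then show "\<forall>\<^sub>F n in sequentially. w n u \<le> (\<integral>\<omega>. indicator (R u) \<omega> * min 1 \<bar>Zn n u \<omega> - X u \<omega>\<bar> \<partial>M)" by simp
    show "0 \<le> u" using u st by simp
  qed
  have "(\<lambda>n. \<integral>u. indicator {s<..t} u *\<^sub>R w n u \<partial>lborel) \<longlonglongrightarrow> (\<integral>u. 0 \<partial>(lborel :: real measure))"
  proof (rule integral_dominated_convergence[where w="indicator {s<..t}"])
    show "integrable lborel (indicator {s<..t} :: real \<Rightarrow> real)"
      by (intro integrable_real_indicator) (auto intro!: emeasure_bounded_finite[simplified])
    show "AE u in lborel. (\<lambda>n. indicator {s<..t} u *\<^sub>R w n u) \<longlonglongrightarrow> 0"
      using lim by (intro AE_I2) (auto simp: indicator_def)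
    show "AE u in lborel. norm (indicator {s<..t} u *\<^sub>R w n u) \<le> indicator {s<..t} u" for n
      using wb by (intro AE_I2) (auto simp: indicator_def)
  qed (use wm in measurable)
  then show ?thesis by (simp add: set_lebesgue_integral_def w_def)
qed

lemma volatility_window_tendsto:
  assumes st: "0 \<le> s" "s \<le> t"
  shows "(\<lambda>n. LBINT u:{s<..t}. \<integral>\<omega>. \<bar>Hn n u \<omega> - \<eta> u \<omega>\<bar> \<partial>M) \<longlonglongrightarrow> 0"
proof (rule tendsto_sandwich[OF _ _ tendsto_const H_tendsto[of t]])
  have ball: "\<forall>u. \<forall>\<omega>\<in>space M. \<bar>\<bar>Hn n u \<omega> - \<eta> u \<omega>\<bar>\<bar> \<le> 2 * C" for n using H_eta_bound by simp
  have nn: "0 \<le> (LBINT u:{a<..b}. \<integral>\<omega>. \<bar>Hn n u \<omega> - \<eta> u \<omega>\<bar> \<partial>M)" for a b n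
    unfolding set_lebesgue_integral_def by (intro integral_nonneg_AE) (auto intro!: mult_nonneg_nonneg integral_nonneg_AE)
  show "\<forall>\<^sub>F n in sequentially. 0 \<le> (LBINT u:{s<..t}. \<integral>\<omega>. \<bar>Hn n u \<omega> - \<eta> u \<omega>\<bar> \<partial>M)" using nn by simp
  have "(LBINT u:{s<..t}. \<integral>\<omega>. \<bar>Hn n u \<omega> - \<eta> u \<omega>\<bar> \<partial>M) \<le> (LBINT u:{0<..t}. \<integral>\<omega>. \<bar>Hn n u \<omega> - \<eta> u \<omega>\<bar> \<partial>M)" for n
    using set_integral_Ioc_split[OF st, of "\<lambda>u. \<integral>\<omega>. \<bar>Hn n u \<omega> - \<eta> u \<omega>\<bar> \<partial>M"] nn[of 0 s n]
      set_integrable_bounded_Ioc[OF bounded_time_integral(1,2)[of "\<lambda>u \<omega>. \<bar>Hn n u \<omega> - \<eta> u \<omega>\<bar>", OF H_eta_joint ball]]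
    by simp
  then show "\<forall>\<^sub>F n in sequentially. (LBINT u:{s<..t}. \<integral>\<omega>. \<bar>Hn n u \<omega> - \<eta> u \<omega>\<bar> \<partial>M)
    \<le> (LBINT u:{0<..t}. \<integral>\<omega>. \<bar>Hn n u \<omega> - \<eta> u \<omega>\<bar> \<partial>M)" by simp
  show "0 \<le> t" using st by simp
qed

text \<open>
  On \<open>A \<inter> R t\<close> the generator along the approximation is close to the one along \<open>X\<close>, which is at most
  \<open>\<epsilon>\<close>. On \<open>A - R t\<close> only its global bound is available; this costs a multiple of
  \<open>measure M (R s) - measure M (R t)\<close>, and these differences telescope over a grid.
\<close>

lemma discounted_increment_bound:
  assumes test: "bounded_C2 f f' f'' L" and r: "0 \<le> r" and \<epsilon>: "0 \<le> \<epsilon>"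
    and gen: "\<And>y. lo \<le> y \<Longrightarrow> y \<le> hi \<Longrightarrow> (\<sigma> y)\<^sup>2 * f'' y / 2 + \<mu> y * f' y - r * f y \<le> \<epsilon>"
    and st: "0 \<le> s" "s \<le> t" and A: "A \<in> sets (F (ennreal s))" "A \<subseteq> R s"
    and mod: "\<And>y z. \<bar>f'' y - f'' z\<bar> \<le> \<delta> + K * min 1 \<bar>y - z\<bar>" and \<delta>: "0 \<le> \<delta>" and K: "0 \<le> K"
  shows "exp (- r * t) * (\<integral>\<omega>. indicator A \<omega> * f (Zn n t \<omega>) \<partial>M) - exp (- r * s) * (\<integral>\<omega>. indicator A \<omega> * f (Zn n s \<omega>) \<partial>M)
    \<le> (\<epsilon> + C\<^sup>2 * \<delta> / 2 + (L * C + L * C\<^sup>2 + r * L) * (measure M (R s) - measure M (R t))) * (t - s)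
      + (2 * L * C + C\<^sup>2 * K / 2 + 2 * r * L) * (LBINT u:{s<..t}. \<integral>\<omega>. indicator (R t) \<omega> * min 1 \<bar>Zn n u \<omega> - X (max 0 u) \<omega>\<bar> \<partial>M)
      + L * C * (LBINT u:{s<..t}. \<integral>\<omega>. \<bar>Hn n u \<omega> - \<eta> u \<omega>\<bar> \<partial>M)"
proof -
  interpret bounded_C2 f f' f'' L by (rule test)
  define c where "c = 2 * L * C + C\<^sup>2 * K / 2 + 2 * r * L"
  define Gb where "Gb = L * C + L * C\<^sup>2 + r * L"
  have c0: "0 \<le> c" and Gb0: "0 \<le> Gb" using L_nonneg C_nonneg K r by (auto simp: c_def Gb_def)
  have AM[measurable]: "A \<in> sets M" using A sets_F_M by blast
  define w where "w u = (\<integral>\<omega>. indicator (R t) \<omega> * min 1 \<bar>Zn n u \<omega> - X (max 0 u) \<omega>\<bar> \<partial>M)" for u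
  define v where "v u = (\<integral>\<omega>. \<bar>Hn n u \<omega> - \<eta> u \<omega>\<bar> \<partial>M)" for u
  have ball: "\<forall>u. \<forall>\<omega>\<in>space M. \<bar>indicator (R t) \<omega> * min 1 \<bar>Zn n u \<omega> - X (max 0 u) \<omega>\<bar>\<bar> \<le> 1"
    by (auto simp: indicator_def)
  note W = bounded_time_integral[of "\<lambda>u \<omega>. indicator (R t) \<omega> * min 1 \<bar>Zn n u \<omega> - X (max 0 u) \<omega>\<bar>", OF X_Z_joint[OF R_M] ball]
  have ball2: "\<forall>u. \<forall>\<omega>\<in>space M. \<bar>\<bar>Hn n u \<omega> - \<eta> u \<omega>\<bar>\<bar> \<le> 2 * C" using H_eta_bound by simp
  note V = bounded_time_integral[of "\<lambda>u \<omega>. \<bar>Hn n u \<omega> - \<eta> u \<omega>\<bar>", OF H_eta_joint ball2]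
  have w0: "0 \<le> w u" and v0: "0 \<le> v u" for u
    unfolding w_def v_def by (auto intro!: integral_nonneg_AE simp: indicator_def)
  define Gen where "Gen u \<omega> = indicator A \<omega> * (f' (Zn n u \<omega>) * \<beta> u \<omega> + f'' (Zn n u \<omega>) * (Hn n u \<omega>)\<^sup>2 / 2 - r * f (Zn n u \<omega>))" for u \<omega>
  note [measurable] = E.Z_measurable_at[of n] E.Z_measurable[of n] E.H_measurable[of n] \<beta>_meas
  have GenGb: "\<bar>f' (Zn n u \<omega>) * \<beta> u \<omega> + f'' (Zn n u \<omega>) * (Hn n u \<omega>)\<^sup>2 / 2 - r * f (Zn n u \<omega>)\<bar> \<le> Gb"
    if "\<omega> \<in> space M" for u \<omega>
  proof -
    have "\<bar>r * f (Zn n u \<omega>)\<bar> \<le> r * L" unfolding abs_mult using r f_bound by (intro mult_mono) auto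
    then show ?thesis using E.ito_expectation(4)[OF test st A(1), of \<omega> n u] that by (simp add: Gb_def)
  qed
  have Genm: "(\<lambda>p. Gen (fst p) (snd p)) \<in> borel_measurable (borel \<Otimes>\<^sub>M M)" unfolding Gen_def by measurable
  have Genball: "\<forall>u. \<forall>\<omega>\<in>space M. \<bar>Gen u \<omega>\<bar> \<le> Gb" using GenGb Gb0 by (auto simp: Gen_def indicator_def)
  note G = bounded_time_integral[of Gen, OF Genm Genball]
  define k0 where "k0 = \<epsilon> + C\<^sup>2 * \<delta> / 2 + Gb * (measure M (R s) - measure M (R t))"
  have Rst: "measure M (R t) \<le> measure M (R s)" using R_antimono[OF st(2)] by (intro finite_measure_mono) auto
  have k00: "0 \<le> k0" using \<epsilon> \<delta> Gb0 Rst by (simp add: k0_def)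
  have pt: "(\<integral>\<omega>. Gen u \<omega> \<partial>M) \<le> k0 + c * w u + L * C * v u" if u: "s < u" "u \<le> t" for u
  proof -
    have "(\<integral>\<omega>. Gen u \<omega> \<partial>M) \<le> (\<integral>\<omega>. (\<epsilon> + C\<^sup>2 * \<delta> / 2) + (c * (indicator (R t) \<omega> * min 1 \<bar>Zn n u \<omega> - X (max 0 u) \<omega>\<bar>)
       + (L * C * \<bar>Hn n u \<omega> - \<eta> u \<omega>\<bar> + Gb * (indicator (R s) \<omega> - indicator (R t) \<omega>))) \<partial>M)"
    proof (rule integral_mono[OF G(3)])
      show "integrable M (\<lambda>\<omega>. (\<epsilon> + C\<^sup>2 * \<delta> / 2) + (c * (indicator (R t) \<omega> * min 1 \<bar>Zn n u \<omega> - X (max 0 u) \<omega>\<bar>)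
       + (L * C * \<bar>Hn n u \<omega> - \<eta> u \<omega>\<bar> + Gb * (indicator (R s) \<omega> - indicator (R t) \<omega>))))"
        using W(3)[of u] V(3)[of u] by (auto simp: emeasure_eq_measure)
      fix \<omega> assume wM: "\<omega> \<in> space M"
      have LC: "0 \<le> L * C * \<bar>Hn n u \<omega> - \<eta> u \<omega>\<bar>" using L_nonneg C_nonneg by simp
      show "Gen u \<omega> \<le> (\<epsilon> + C\<^sup>2 * \<delta> / 2) + (c * (indicator (R t) \<omega> * min 1 \<bar>Zn n u \<omega> - X (max 0 u) \<omega>\<bar>)
       + (L * C * \<bar>Hn n u \<omega> - \<eta> u \<omega>\<bar> + Gb * (indicator (R s) \<omega> - indicator (R t) \<omega>)))"
      proof (cases "\<omega> \<in> A")
        case False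
        have "indicator (R t) \<omega> \<le> (indicator (R s) \<omega> :: real)" using R_antimono[OF st(2)] by (auto simp: indicator_def)
        then have "0 \<le> Gb * (indicator (R s) \<omega> - indicator (R t) \<omega>)" using Gb0 by simp
        moreover have "0 \<le> c * (indicator (R t) \<omega> * min 1 \<bar>Zn n u \<omega> - X (max 0 u) \<omega>\<bar>)" using c0 by (auto simp: indicator_def)
        moreover have "0 \<le> \<epsilon> + C\<^sup>2 * \<delta> / 2" using \<epsilon> \<delta> by simp
        ultimately show ?thesis using False LC by (simp add: Gen_def)
      next
        case inA: True
        show ?thesis
        proof (cases "\<omega> \<in> R t")
          case True
          have u0: "0 \<le> u" using u st by simp
          note co = R_coefficients[OF True u0 u(2)]
          define y where "y = X u \<omega>"
          have yX: "X (max 0 u) \<omega> = y" using u0 by (simp add: y_def max_absorb2)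
          have "\<bar>(f' (Zn n u \<omega>) * \<beta> u \<omega> + f'' (Zn n u \<omega>) * (Hn n u \<omega>)\<^sup>2 / 2 - r * f (Zn n u \<omega>))
              - (f' y * \<beta> u \<omega> + f'' y * (\<eta> u \<omega>)\<^sup>2 / 2 - r * f y)\<bar>
            \<le> C\<^sup>2 * \<delta> / 2 + c * min 1 \<bar>Zn n u \<omega> - y\<bar> + L * C * \<bar>Hn n u \<omega> - \<eta> u \<omega>\<bar>"
            unfolding c_def
            by (rule generator_difference[OF mod \<delta> K r])
              (use E.H_bound[OF wM] clip_bound in \<open>auto simp: \<beta>_def \<eta>_def\<close>)
          moreover have "f' y * \<beta> u \<omega> + f'' y * (\<eta> u \<omega>)\<^sup>2 / 2 - r * f y \<le> \<epsilon>"
            using gen[of y] co by (simp add: y_def mult.commute add.commute)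
          ultimately show ?thesis using inA True A(2) by (auto simp: Gen_def yX)
        next
          case False
          have "\<omega> \<in> R s" using inA A(2) by auto
          then show ?thesis using GenGb[OF wM, of u] inA False LC \<epsilon> \<delta> by (simp add: Gen_def add_increasing)
        qed
      qed
    qed
    also have "\<dots> = k0 + c * w u + L * C * v u"
      using W(3)[of u] V(3)[of u] by (simp add: k0_def w_def v_def prob_space emeasure_eq_measure algebra_simps)
    finally show ?thesis .
  qed
  have wi: "set_integrable lborel {s<..t} w" and vi: "set_integrable lborel {s<..t} v"
    unfolding w_def[abs_def] v_def[abs_def]
    by (rule set_integrable_bounded_Ioc[OF W(1,2)], rule set_integrable_bounded_Ioc[OF V(1,2)])
  have ki: "set_integrable lborel {s<..t} (\<lambda>u. k0)" by (rule set_integrable_bounded_Ioc[OF _ order_refl]) simp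
  have ei: "set_integrable lborel {s<..t} (\<lambda>u. exp (- r * u) * (\<integral>\<omega>. Gen u \<omega> \<partial>M))"
  proof -
    have "set_integrable lborel {s<..t} (\<lambda>u. exp (- r * max 0 u) * (\<integral>\<omega>. Gen u \<omega> \<partial>M))"
    proof (rule set_integrable_bounded_Ioc)
      show "(\<lambda>u. exp (- r * max 0 u) * (\<integral>\<omega>. Gen u \<omega> \<partial>M)) \<in> borel_measurable borel" using G(1) by measurable
      fix u
      have "exp (- r * max 0 u) \<le> 1" using r by simp
      then show "\<bar>exp (- r * max 0 u) * (\<integral>\<omega>. Gen u \<omega> \<partial>M)\<bar> \<le> 1 * Gb"
        unfolding abs_mult using G(2)[of u] by (intro mult_mono) auto
    qed
    moreover have "set_integrable lborel {s<..t} (\<lambda>u. exp (- r * max 0 u) * (\<integral>\<omega>. Gen u \<omega> \<partial>M))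
      = set_integrable lborel {s<..t} (\<lambda>u. exp (- r * u) * (\<integral>\<omega>. Gen u \<omega> \<partial>M))"
      using st by (intro set_integrable_cong) auto
    ultimately show ?thesis by simp
  qed
  have si: "set_integrable lborel {s<..t} (\<lambda>u. k0 + c * w u + L * C * v u)"
    by (intro set_integral_add ki set_integrable_mult_right wi vi)
  have "(LBINT u:{s<..t}. exp (- r * u) * (\<integral>\<omega>. Gen u \<omega> \<partial>M)) \<le> (LBINT u:{s<..t}. k0 + c * w u + L * C * v u)"
  proof (rule set_integral_mono[OF ei si])
    fix u assume "u \<in> {s<..t}"
    then have u: "s < u" "u \<le> t" by auto
    have b0: "0 \<le> k0 + c * w u + L * C * v u" using k00 c0 w0 v0 L_nonneg C_nonneg by simp
    have "exp (- r * u) * (\<integral>\<omega>. Gen u \<omega> \<partial>M) \<le> exp (- r * u) * (k0 + c * w u + L * C * v u)"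
      using pt[OF u] by (intro mult_left_mono) auto
    also have "\<dots> \<le> 1 * (k0 + c * w u + L * C * v u)"
      using b0 r u st by (intro mult_right_mono) auto
    finally show "exp (- r * u) * (\<integral>\<omega>. Gen u \<omega> \<partial>M) \<le> k0 + c * w u + L * C * v u" by simp
  qed
  also have "\<dots> = k0 * (t - s) + c * (LBINT u:{s<..t}. w u) + L * C * (LBINT u:{s<..t}. v u)"
  proof -
    have "(LBINT u:{s<..t}. k0) = k0 * (t - s)" using st
      by (subst set_integral_const) (auto simp: emeasure_bounded_finite[simplified])
    moreover have "(LBINT u:{s<..t}. k0 + c * w u + L * C * v u)
      = (LBINT u:{s<..t}. k0) + (LBINT u:{s<..t}. c * w u) + (LBINT u:{s<..t}. L * C * v u)"
      by (subst set_integral_add(2)[OF set_integral_add(1)[OF ki set_integrable_mult_right[OF wi]] set_integrable_mult_right[OF vi]],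
          subst set_integral_add(2)[OF ki set_integrable_mult_right[OF wi]]) simp
    ultimately show ?thesis by (simp only: set_integral_mult_right)
  qed
  finally show ?thesis
    unfolding E.discounted_ito_expectation[OF test st A(1) r] Gen_def[symmetric]
    by (simp add: k0_def Gb_def c_def w_def v_def)
qed

text \<open>
  Stopping at the first grid time that is not before \<open>T\<close>, unless the path has left the window: \<open>D k\<close> is
  the event that this happens at the \<open>k\<close>-th grid time. The event that the process is still running at a
  grid time belongs to the past, so the increments of the discounted test function along the
  approximations are controlled by \<open>discounted_increment_bound\<close>; then \<open>n\<close> tends to infinity.
\<close>

lemma grid_supermartingale:
  assumes test: "bounded_C2 f f' f'' L" and f0: "\<And>z. 0 \<le> f z" and r: "0 \<le> r" and \<epsilon>: "0 \<le> \<epsilon>"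
    and gen: "\<And>y. lo \<le> y \<Longrightarrow> y \<le> hi \<Longrightarrow> (\<sigma> y)\<^sup>2 * f'' y / 2 + \<mu> y * f' y - r * f y \<le> \<epsilon>"
    and T: "stopping_time F T" and h: "0 < h"
  defines "D \<equiv> \<lambda>k. {\<omega> \<in> R (real k * h). T \<omega> \<le> ennreal (real k * h) \<and> (k = 0 \<or> ennreal (real (k - 1) * h) < T \<omega>)}"
  shows "(\<integral>\<omega>. (\<Sum>k<K. indicator (D k) \<omega> * (exp (- r * (real k * h)) * f (X (real k * h) \<omega>))) \<partial>M)
    \<le> f x + \<epsilon> * (real K * h) + (L * C + L * C\<^sup>2 + r * L) * h"
    and "D k \<in> sets M"
proof -
  interpret bounded_C2 f f' f'' L by (rule test)
  define t where "t k = real k * h" for k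
  have t0: "0 \<le> t k" and tS: "t k \<le> t (Suc k)" "t (Suc k) - t k = h" for k
    using h by (auto simp: t_def algebra_simps)
  define Gb where "Gb = L * C + L * C\<^sup>2 + r * L"
  have Gb0: "0 \<le> Gb" using L_nonneg C_nonneg r by (auto simp: Gb_def)
  define a where "a k = exp (- r * t k)" for k
  have a: "0 \<le> a k" "a k \<le> 1" for k using t0 r by (auto simp: a_def)
  define A where "A k = {\<omega> \<in> R (t k). ennreal (t k) < T \<omega>}" for k
  have AF: "A k \<in> sets (F (ennreal (t k)))" for k
  proof -
    have "{\<omega> \<in> space (F (ennreal (t k))). ennreal (t k) < T \<omega>} \<in> sets (F (ennreal (t k)))"
      using stopping_timeD2[OF T, of "ennreal (t k)"] by (simp add: pred_def)
    moreover have "A k = R (t k) \<inter> {\<omega> \<in> space (F (ennreal (t k))). ennreal (t k) < T \<omega>}"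
      by (auto simp: A_def R_def space_F)
    ultimately show ?thesis using sets.Int[OF R_sets[OF t0[of k]]] by metis
  qed
  have AM[measurable]: "A k \<in> sets M" for k using AF sets_F_M by blast
  have AR: "A k \<subseteq> R (t k)" for k by (auto simp: A_def)
  have D_eq: "D k = {\<omega> \<in> R (t k). T \<omega> \<le> ennreal (t k) \<and> (k = 0 \<or> ennreal (t (k - 1)) < T \<omega>)}" for k
    by (simp add: D_def t_def)
  have DM[measurable]: "D k \<in> sets M" for k
  proof -
    have tm: "{\<omega> \<in> space M. ennreal (t j) < T \<omega>} \<in> sets M" for j
    proof -
      have "{\<omega> \<in> space (F (ennreal (t j))). ennreal (t j) < T \<omega>} \<in> sets (F (ennreal (t j)))"
        using stopping_timeD2[OF T, of "ennreal (t j)"] by (simp add: pred_def)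
      from sets_F_M[OF this] show ?thesis by (simp add: space_F)
    qed
    have eq: "D k = R (t k) \<inter> (space M - {\<omega> \<in> space M. ennreal (t k) < T \<omega>}) \<inter>
        (if k = 0 then space M else {\<omega> \<in> space M. ennreal (t (k - 1)) < T \<omega>})"
      unfolding D_eq R_def by (cases "k = 0") (force simp: not_less)+
    show ?thesis unfolding eq
      by (intro sets.Int R_M sets.Diff sets.top tm) (simp add: tm)
  qed
  show "D k \<in> sets M" by (rule DM)
  note [measurable] = E.Z_measurable_at
  have Xm[measurable]: "X (t k) \<in> borel_measurable M" for k by (rule measurable_F_M[OF X_adapted[OF t0]])
  have int: "integrable M (\<lambda>\<omega>. indicator S \<omega> * f (g \<omega>))" if "S \<in> sets M" "g \<in> borel_measurable M" for S and g :: "'a \<Rightarrow> real"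
  proof (rule integrable_bounded[where q=L])
    show "\<bar>indicator S \<omega> * f (g \<omega>)\<bar> \<le> L" for \<omega>
      using f_bound[of "g \<omega>"] L_nonneg by (auto simp: indicator_def)
  qed (use that in measurable)
  define lhs where "lhs n = (\<Sum>k<K. a k * (\<integral>\<omega>. indicator (D k) \<omega> * f (Zn n (t k) \<omega>) \<partial>M))" for n
  define inc where "inc n k = a (Suc k) * (\<integral>\<omega>. indicator (A k) \<omega> * f (Zn n (t (Suc k)) \<omega>) \<partial>M)
      - a k * (\<integral>\<omega>. indicator (A k) \<omega> * f (Zn n (t k) \<omega>) \<partial>M)" for n k
  have lhs_le: "lhs n \<le> f x + (\<Sum>k<K. inc n k)" for n
  proof -
    define Y where "Y k \<omega> = a k * f (Zn n (t k) \<omega>)" for k \<omega>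
    have Y0: "0 \<le> Y k \<omega>" for k \<omega> using a f0 by (simp add: Y_def)
    \<comment> \<open>The sum telescopes to the value at the first grid time not in any \<open>A k\<close>.\<close>
    have path: "(\<Sum>k<m. indicator (D k) \<omega> * Y k \<omega>) + (if m = 0 then 1 else indicator (A (m - 1)) \<omega>) * Y m \<omega>
        \<le> Y 0 \<omega> + (\<Sum>k<m. indicator (A k) \<omega> * (Y (Suc k) \<omega> - Y k \<omega>))" if w: "\<omega> \<in> space M" for m \<omega>
    proof (induction m)
      case (Suc m)
      have "indicator (A m) \<omega> + indicator (D m) \<omega> \<le> (if m = 0 then 1 else indicator (A (m - 1)) \<omega> :: real)"
      proof -
        have "\<omega> \<notin> A m \<or> \<omega> \<notin> D m" by (auto simp: A_def D_eq not_less)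
        moreover have "\<omega> \<in> A (m - 1)" if "\<omega> \<in> A m \<or> \<omega> \<in> D m" "m \<noteq> 0"
        proof -
          have le: "t (m - 1) \<le> t m" using h by (simp add: t_def mult_right_mono)
          then have "\<omega> \<in> R (t (m - 1))" using that R_antimono[OF le] by (auto simp: A_def D_eq)
          moreover have "ennreal (t (m - 1)) < T \<omega>"
            using that ennreal_leI[OF le] by (auto simp: A_def D_eq intro: le_less_trans)
          ultimately show ?thesis by (simp add: A_def)
        qed
        ultimately show ?thesis by (cases "m = 0") (auto simp: indicator_def)
      qed
      from mult_right_mono[OF this Y0[of m \<omega>]] Suc show ?case by (simp add: algebra_simps)
    qed simp
    have "lhs n = (\<integral>\<omega>. (\<Sum>k<K. indicator (D k) \<omega> * Y k \<omega>) \<partial>M)"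
    proof -
      have "(\<integral>\<omega>. (\<Sum>k<K. indicator (D k) \<omega> * Y k \<omega>) \<partial>M) = (\<integral>\<omega>. (\<Sum>k<K. a k * (indicator (D k) \<omega> * f (Zn n (t k) \<omega>))) \<partial>M)"
        by (simp add: Y_def mult_ac)
      also have "\<dots> = (\<Sum>k<K. (\<integral>\<omega>. a k * (indicator (D k) \<omega> * f (Zn n (t k) \<omega>)) \<partial>M))"
        by (intro Bochner_Integration.integral_sum integrable_mult_right int) auto
      finally show ?thesis by (simp add: lhs_def)
    qed
    also have "\<dots> \<le> (\<integral>\<omega>. f x + (\<Sum>k<K. a (Suc k) * (indicator (A k) \<omega> * f (Zn n (t (Suc k)) \<omega>)) - a k * (indicator (A k) \<omega> * f (Zn n (t k) \<omega>))) \<partial>M)"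
    proof (rule integral_mono)
      show "integrable M (\<lambda>\<omega>. \<Sum>k<K. indicator (D k) \<omega> * Y k \<omega>)"
        unfolding Y_def mult.left_commute[of "indicator _ _"] by (intro Bochner_Integration.integrable_sum integrable_mult_right int) auto
      show "integrable M (\<lambda>\<omega>. f x + (\<Sum>k<K. a (Suc k) * (indicator (A k) \<omega> * f (Zn n (t (Suc k)) \<omega>)) - a k * (indicator (A k) \<omega> * f (Zn n (t k) \<omega>))))"
        by (intro Bochner_Integration.integrable_add Bochner_Integration.integrable_sum Bochner_Integration.integrable_diff integrable_mult_right int) auto
      fix \<omega> assume w: "\<omega> \<in> space M"
      have "0 \<le> (if K = 0 then 1 else indicator (A (K - 1)) \<omega>) * Y K \<omega>" using Y0 by (auto simp: indicator_def)
      then have "(\<Sum>k<K. indicator (D k) \<omega> * Y k \<omega>) \<le> Y 0 \<omega> + (\<Sum>k<K. indicator (A k) \<omega> * (Y (Suc k) \<omega> - Y k \<omega>))"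
        using path[OF w, of K] by linarith
      moreover have "Y 0 \<omega> = f x" by (simp add: Y_def a_def t_def Z_0)
      ultimately show "(\<Sum>k<K. indicator (D k) \<omega> * Y k \<omega>) \<le> f x + (\<Sum>k<K. a (Suc k) * (indicator (A k) \<omega> * f (Zn n (t (Suc k)) \<omega>)) - a k * (indicator (A k) \<omega> * f (Zn n (t k) \<omega>)))"
        by (simp add: Y_def algebra_simps)
    qed
    also have "\<dots> = f x + (\<Sum>k<K. inc n k)"
    proof -
      have i: "integrable M (\<lambda>\<omega>. a (Suc k) * (indicator (A k) \<omega> * f (Zn n (t (Suc k)) \<omega>)) - a k * (indicator (A k) \<omega> * f (Zn n (t k) \<omega>)))" for k
        by (intro Bochner_Integration.integrable_diff integrable_mult_right int) auto
      have "(\<integral>\<omega>. a (Suc k) * (indicator (A k) \<omega> * f (Zn n (t (Suc k)) \<omega>)) - a k * (indicator (A k) \<omega> * f (Zn n (t k) \<omega>)) \<partial>M) = inc n k" for k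
        unfolding inc_def by (subst Bochner_Integration.integral_diff) (auto intro!: integrable_mult_right int)
      then have "(\<integral>\<omega>. (\<Sum>k<K. a (Suc k) * (indicator (A k) \<omega> * f (Zn n (t (Suc k)) \<omega>)) - a k * (indicator (A k) \<omega> * f (Zn n (t k) \<omega>))) \<partial>M)
        = (\<Sum>k<K. inc n k)"
        by (subst Bochner_Integration.integral_sum) (auto intro: i)
      moreover have "integrable M (\<lambda>\<omega>. \<Sum>k<K. a (Suc k) * (indicator (A k) \<omega> * f (Zn n (t (Suc k)) \<omega>)) - a k * (indicator (A k) \<omega> * f (Zn n (t k) \<omega>)))"
        by (intro Bochner_Integration.integrable_sum i)
      ultimately show ?thesis by (subst Bochner_Integration.integral_add) (auto simp: prob_space)
    qed
    finally show ?thesis .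
  qed
  define LHS where "LHS = (\<Sum>k<K. a k * (\<integral>\<omega>. indicator (D k) \<omega> * f (X (t k) \<omega>) \<partial>M))"
  have lhs_lim: "lhs \<longlonglongrightarrow> LHS"
    unfolding lhs_def LHS_def
  proof (intro tendsto_intros)
    fix k
    show "(\<lambda>n. \<integral>\<omega>. indicator (D k) \<omega> * f (Zn n (t k) \<omega>) \<partial>M) \<longlonglongrightarrow> (\<integral>\<omega>. indicator (D k) \<omega> * f (X (t k) \<omega>) \<partial>M)"
    proof (rule LIM_zero_cancel, rule Lim_null_comparison)
      show "(\<lambda>n. 2 * L * (\<integral>\<omega>. indicator (R (t k)) \<omega> * min 1 \<bar>Zn n (t k) \<omega> - X (t k) \<omega>\<bar> \<partial>M)) \<longlonglongrightarrow> 0"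
        using tendsto_mult_right_zero[OF Z_tendsto[OF t0[of k]], of "2 * L"] .
      have "norm ((\<integral>\<omega>. indicator (D k) \<omega> * f (Zn n (t k) \<omega>) \<partial>M) - (\<integral>\<omega>. indicator (D k) \<omega> * f (X (t k) \<omega>) \<partial>M))
        \<le> 2 * L * (\<integral>\<omega>. indicator (R (t k)) \<omega> * min 1 \<bar>Zn n (t k) \<omega> - X (t k) \<omega>\<bar> \<partial>M)" for n
      proof -
        have i: "integrable M (\<lambda>\<omega>. indicator (D k) \<omega> * f (Zn n (t k) \<omega>) - indicator (D k) \<omega> * f (X (t k) \<omega>))"
          by (intro Bochner_Integration.integrable_diff int) auto
        have "norm ((\<integral>\<omega>. indicator (D k) \<omega> * f (Zn n (t k) \<omega>) \<partial>M) - (\<integral>\<omega>. indicator (D k) \<omega> * f (X (t k) \<omega>) \<partial>M))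
          = norm (\<integral>\<omega>. indicator (D k) \<omega> * f (Zn n (t k) \<omega>) - indicator (D k) \<omega> * f (X (t k) \<omega>) \<partial>M)"
          by (subst Bochner_Integration.integral_diff) (auto intro!: int)
        also have "\<dots> \<le> (\<integral>\<omega>. \<bar>indicator (D k) \<omega> * f (Zn n (t k) \<omega>) - indicator (D k) \<omega> * f (X (t k) \<omega>)\<bar> \<partial>M)"
          unfolding real_norm_def
          by (rule integral_abs_bound)
        also have "\<dots> \<le> (\<integral>\<omega>. 2 * L * (indicator (R (t k)) \<omega> * min 1 \<bar>Zn n (t k) \<omega> - X (t k) \<omega>\<bar>) \<partial>M)"
        proof (rule integral_mono)
          show "integrable M (\<lambda>\<omega>. \<bar>indicator (D k) \<omega> * f (Zn n (t k) \<omega>) - indicator (D k) \<omega> * f (X (t k) \<omega>)\<bar>)" using i by (rule integrable_abs)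
          show "integrable M (\<lambda>\<omega>. 2 * L * (indicator (R (t k)) \<omega> * min 1 \<bar>Zn n (t k) \<omega> - X (t k) \<omega>\<bar>))"
            by (intro integrable_mult_right integrable_bounded[where q=1]) (auto simp: indicator_def)
          fix \<omega>
          have "\<bar>f (Zn n (t k) \<omega>) - f (X (t k) \<omega>)\<bar> \<le> 2 * L * min 1 \<bar>Zn n (t k) \<omega> - X (t k) \<omega>\<bar>"
            using f_lipschitz[of "Zn n (t k) \<omega>" "X (t k) \<omega>"] f_bound[of "Zn n (t k) \<omega>"] f_bound[of "X (t k) \<omega>"] L_nonneg
              mult_nonneg_nonneg[OF L_nonneg abs_ge_zero[of "Zn n (t k) \<omega> - X (t k) \<omega>"]]
            by (auto simp: min_def)
          then show "\<bar>indicator (D k) \<omega> * f (Zn n (t k) \<omega>) - indicator (D k) \<omega> * f (X (t k) \<omega>)\<bar>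
            \<le> 2 * L * (indicator (R (t k)) \<omega> * min 1 \<bar>Zn n (t k) \<omega> - X (t k) \<omega>\<bar>)"
            using L_nonneg by (auto simp: D_eq indicator_def)
        qed
        finally show ?thesis unfolding integral_mult_right_zero .
      qed
      then show "\<forall>\<^sub>F n in sequentially. norm ((\<integral>\<omega>. indicator (D k) \<omega> * f (Zn n (t k) \<omega>) \<partial>M) - (\<integral>\<omega>. indicator (D k) \<omega> * f (X (t k) \<omega>) \<partial>M))
        \<le> 2 * L * (\<integral>\<omega>. indicator (R (t k)) \<omega> * min 1 \<bar>Zn n (t k) \<omega> - X (t k) \<omega>\<bar> \<partial>M)" by simp
    qed
  qed
  have bound: "LHS \<le> f x + \<epsilon> * (real K * h) + Gb * h + C\<^sup>2 * \<delta> / 2 * (real K * h)" if \<delta>: "0 < \<delta>" for \<delta>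
  proof -
    obtain c0 where c0: "0 \<le> c0" "\<And>y z. \<bar>f'' y - f'' z\<bar> \<le> \<delta> + c0 * min 1 \<bar>y - z\<bar>" using f''_modulus[OF \<delta>] by metis
    define c where "c = 2 * L * C + C\<^sup>2 * c0 / 2 + 2 * r * L"
    define w where "w n k = (LBINT u:{t k<..t (Suc k)}. \<integral>\<omega>. indicator (R (t (Suc k))) \<omega> * min 1 \<bar>Zn n u \<omega> - X (max 0 u) \<omega>\<bar> \<partial>M)" for n k
    define v where "v n k = (LBINT u:{t k<..t (Suc k)}. \<integral>\<omega>. \<bar>Hn n u \<omega> - \<eta> u \<omega>\<bar> \<partial>M)" for n k
    define q where "q k = measure M (R (t k))" for k
    have inc1: "inc n k \<le> (\<epsilon> + C\<^sup>2 * \<delta> / 2 + Gb * (q k - q (Suc k))) * h + c * w n k + L * C * v n k" for n k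
      using discounted_increment_bound[OF test r \<epsilon> gen t0 tS(1) AF AR c0(2) less_imp_le[OF \<delta>] c0(1), of k n] tS(2)[of k]
      by (simp add: inc_def a_def w_def v_def q_def c_def Gb_def)
    have incs: "(\<Sum>k<K. inc n k) \<le> (\<epsilon> + C\<^sup>2 * \<delta> / 2) * (real K * h) + Gb * h * (q 0 - q K) + (\<Sum>k<K. c * w n k + L * C * v n k)" for n
    proof -
      have "(\<Sum>k<K. inc n k) \<le> (\<Sum>k<K. (\<epsilon> + C\<^sup>2 * \<delta> / 2 + Gb * (q k - q (Suc k))) * h + c * w n k + L * C * v n k)"
        by (intro sum_mono inc1)
      also have "\<dots> = (\<Sum>k<K. (\<epsilon> + C\<^sup>2 * \<delta> / 2) * h + (Gb * h * (q k - q (Suc k)) + (c * w n k + L * C * v n k)))"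
        by (intro sum.cong refl) (simp add: algebra_simps)
      also have "\<dots> = (\<Sum>k<K. (\<epsilon> + C\<^sup>2 * \<delta> / 2) * h) + (Gb * h * (\<Sum>k<K. q k - q (Suc k)) + (\<Sum>k<K. c * w n k + L * C * v n k))"
        by (simp only: sum.distrib sum_distrib_left)
      also have "(\<Sum>k<K. q k - q (Suc k)) = q 0 - q K" by (rule sum_lessThan_telescope')
      finally show ?thesis by (simp add: mult_ac)
    qed
    have "0 \<le> q K" "q 0 \<le> 1" by (simp_all add: q_def)
    then have "q 0 - q K \<le> 1" by linarith
    then have "Gb * h * (q 0 - q K) \<le> Gb * h" using Gb0 h by (simp add: mult_left_le)
    then have le: "lhs n \<le> f x + ((\<epsilon> + C\<^sup>2 * \<delta> / 2) * (real K * h) + Gb * h + (\<Sum>k<K. c * w n k + L * C * v n k))" for n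
      using lhs_le[of n] incs[of n] by linarith
    have "(\<lambda>n. f x + ((\<epsilon> + C\<^sup>2 * \<delta> / 2) * (real K * h) + Gb * h + (\<Sum>k<K. c * w n k + L * C * v n k)))
      \<longlonglongrightarrow> f x + ((\<epsilon> + C\<^sup>2 * \<delta> / 2) * (real K * h) + Gb * h + (\<Sum>k<K. c * 0 + L * C * 0))"
      unfolding w_def v_def by (intro tendsto_intros window_tendsto volatility_window_tendsto t0 tS)
    from LIMSEQ_le[OF lhs_lim this] le
    show ?thesis by (auto simp: algebra_simps)
  qed
  have "LHS \<le> f x + \<epsilon> * (real K * h) + Gb * h"
  proof (rule field_le_epsilon)
    fix e :: real assume e: "0 < e"
    define d where "d = e / (C\<^sup>2 * (real K * h) + 1)"
    have p: "0 \<le> C\<^sup>2 * (real K * h)" using h by simp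
    have d: "0 < d" using e p by (simp add: d_def)
    have "C\<^sup>2 * d / 2 * (real K * h) \<le> e"
    proof -
      have "C\<^sup>2 * d / 2 * (real K * h) = (C\<^sup>2 * (real K * h)) * d / 2" by simp
      also have "\<dots> \<le> (C\<^sup>2 * (real K * h) + 1) * d"
        using d mult_nonneg_nonneg[OF p less_imp_le[OF d]] unfolding distrib_right by linarith
      also have "\<dots> = e" using p by (simp add: d_def)
      finally show ?thesis .
    qed
    then show "LHS \<le> f x + \<epsilon> * (real K * h) + Gb * h + e" using bound[OF d] by linarith
  qed
  moreover have "(\<integral>\<omega>. (\<Sum>k<K. indicator (D k) \<omega> * (exp (- r * (real k * h)) * f (X (real k * h) \<omega>))) \<partial>M) = LHS"
  proof -
    have "(\<integral>\<omega>. (\<Sum>k<K. indicator (D k) \<omega> * (exp (- r * (real k * h)) * f (X (real k * h) \<omega>))) \<partial>M)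
      = (\<integral>\<omega>. (\<Sum>k<K. a k * (indicator (D k) \<omega> * f (X (t k) \<omega>))) \<partial>M)"
      by (simp add: a_def t_def mult_ac)
    also have "\<dots> = (\<Sum>k<K. (\<integral>\<omega>. a k * (indicator (D k) \<omega> * f (X (t k) \<omega>)) \<partial>M))"
      by (intro Bochner_Integration.integral_sum integrable_mult_right int) auto
    finally show ?thesis by (simp add: LHS_def)
  qed
  ultimately show "(\<integral>\<omega>. (\<Sum>k<K. indicator (D k) \<omega> * (exp (- r * (real k * h)) * f (X (real k * h) \<omega>))) \<partial>M)
    \<le> f x + \<epsilon> * (real K * h) + (L * C + L * C\<^sup>2 + r * L) * h" by (simp add: Gb_def)
qed

end

section \<open>The verification inequality\<close>

context brownian_basis
begin

lemma stopped_grid_bound: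
  assumes sol: "strong_solution M F B \<mu> \<sigma> x X"
    and meas: "\<mu> \<in> borel_measurable (restrict_space borel {0<..})" "\<sigma> \<in> borel_measurable (restrict_space borel {0<..})"
    and bnd: "0 \<le> C" "\<And>y. lo \<le> y \<Longrightarrow> y \<le> hi \<Longrightarrow> \<bar>\<mu> y\<bar> \<le> C" "\<And>y. lo \<le> y \<Longrightarrow> y \<le> hi \<Longrightarrow> \<bar>\<sigma> y\<bar> \<le> C"
    and test: "bounded_C2 f f' f'' L" and f0: "\<And>z. 0 \<le> f z" and r: "0 \<le> r" and \<epsilon>: "0 \<le> \<epsilon>"
    and gen: "\<And>y. lo \<le> y \<Longrightarrow> y \<le> hi \<Longrightarrow> (\<sigma> y)\<^sup>2 * f'' y / 2 + \<mu> y * f' y - r * f y \<le> \<epsilon>"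
    and T: "stopping_time F T" and h: "0 < h"
  defines "D \<equiv> \<lambda>k. {\<omega> \<in> space M. (\<forall>u\<in>{0..real k * h}. X u \<omega> \<in> {lo..hi}) \<and>
      T \<omega> \<le> ennreal (real k * h) \<and> (k = 0 \<or> ennreal (real (k - 1) * h) < T \<omega>)}"
  shows "(\<integral>\<omega>. (\<Sum>k<K. indicator (D k) \<omega> * (exp (- r * (real k * h)) * f (X (real k * h) \<omega>))) \<partial>M)
    \<le> f x + \<epsilon> * (real K * h) + (L * C + L * C\<^sup>2 + r * L) * h"
    and "D k \<in> sets M"
proof -
  obtain I where I: "ito_integral M F B (\<lambda>s \<omega>. \<sigma> (X s \<omega>)) I"
    and sde: "AE \<omega> in M. \<forall>t\<ge>0. X t \<omega> = x + (LBINT s:{0..t}. \<mu> (X s \<omega>)) + I t \<omega>"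
    using sol unfolding strong_solution_def by blast
  obtain N p \<xi> where el: "\<forall>n. elementary M F (N n) (p n) (\<xi> n)"
    and ap: "\<forall>T\<ge>0. tends_to_0_in_prob M (\<lambda>n \<omega>.
           \<integral>\<^sup>+t\<in>{0..T}. ennreal ((elem_process (N n) (p n) (\<xi> n) t \<omega> - \<sigma> (X t \<omega>))\<^sup>2) \<partial>lborel)"
    and ai: "\<forall>t\<ge>0. tends_to_0_in_prob M (\<lambda>n \<omega>.
           ennreal \<bar>elem_integral B (N n) (p n) (\<xi> n) t \<omega> - I t \<omega>\<bar>)"
    using I unfolding ito_integral_def by blast
  interpret L: localized_diffusion M F B \<mu> \<sigma> x X lo hi C N p \<xi> I
  proof
    show "\<mu> \<in> borel_measurable (restrict_space borel {0<..})" "\<sigma> \<in> borel_measurable (restrict_space borel {0<..})"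
      by (fact meas)+
    show "X t \<in> borel_measurable (F (ennreal t))" if "0 \<le> t" for t
      using sol that by (auto simp: strong_solution_def adapted_def)
    show "continuous_on {0..} (\<lambda>t. X t \<omega>)" "0 \<le> t \<Longrightarrow> 0 < X t \<omega>" if "\<omega> \<in> space M" for \<omega> t
      using sol that by (auto simp: strong_solution_def)
    show "I t \<in> borel_measurable M" if "0 \<le> t" for t
      using I that by (auto simp: ito_integral_def)
  qed (use bnd el ap ai sde in auto)
  have D: "D k = {\<omega> \<in> L.R (real k * h). T \<omega> \<le> ennreal (real k * h) \<and> (k = 0 \<or> ennreal (real (k - 1) * h) < T \<omega>)}" for k
    by (auto simp: D_def L.R_def)
  show "(\<integral>\<omega>. (\<Sum>k<K. indicator (D k) \<omega> * (exp (- r * (real k * h)) * f (X (real k * h) \<omega>))) \<partial>M)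
    \<le> f x + \<epsilon> * (real K * h) + (L * C + L * C\<^sup>2 + r * L) * h"
    unfolding D by (rule L.grid_supermartingale(1)[OF test f0 r \<epsilon> gen T h])
  show "D k \<in> sets M"
    unfolding D by (rule L.grid_supermartingale(2)[OF test f0 r \<epsilon> gen T h])
qed

lemma grid_index:
  fixes \<tau> h :: real
  assumes "0 \<le> \<tau>" "0 < h"
  obtains k :: nat where "\<tau> \<le> real k * h" "real k * h < \<tau> + h" "k = 0 \<or> real (k - 1) * h < \<tau>"
proof -
  define k where "k = nat \<lceil>\<tau> / h\<rceil>"
  have k: "real k = of_int \<lceil>\<tau> / h\<rceil>" using assms by (simp add: k_def)
  have c: "\<tau> / h \<le> real k" "real k < \<tau> / h + 1" unfolding k by linarith+
  have "\<tau> \<le> real k * h" "real k * h < \<tau> + h" using c assms by (simp_all add: field_simps)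
  moreover have "k = 0 \<or> real (k - 1) * h < \<tau>"
  proof (cases k)
    case (Suc m)
    then have "real m < \<tau> / h" using c(2) by simp
    then show ?thesis using Suc assms by (simp add: field_simps)
  qed simp
  ultimately show thesis using that by blast
qed

text \<open>
  A path is bounded away from \<open>0\<close> and infinity up to time \<open>T + 1\<close>, so it eventually stays in the growing
  windows, and the grid times at which it is stopped converge to \<open>T\<close>.
\<close>

lemma stopped_payoff_limit:
  fixes X :: "real \<Rightarrow> 'a \<Rightarrow> real" and f :: "nat \<Rightarrow> real \<Rightarrow> real"
  assumes cont: "continuous_on {0..} (\<lambda>t. X t \<omega>)" and pos: "\<And>t. 0 \<le> t \<Longrightarrow> 0 < X t \<omega>" and \<omega>: "\<omega> \<in> space M"
    and h: "\<And>j. 0 < h j" "\<And>j. h j \<le> 1 / real (Suc j)" and K: "\<And>j. real (K j) * h j = real (Suc j)"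
    and f0: "\<And>j z. 0 \<le> f j z"
    and fW: "\<And>j y. 1 / real (Suc j) \<le> y \<Longrightarrow> y \<le> real (Suc j) \<Longrightarrow> max 0 (q - y) - 1 / real (Suc j) \<le> f j y"
    and Tfin: "T \<omega> < \<infinity>"
  defines "D \<equiv> \<lambda>j k. {\<omega> \<in> space M. (\<forall>u\<in>{0..real k * h j}. X u \<omega> \<in> {1 / real (Suc j)..real (Suc j)}) \<and>
      T \<omega> \<le> ennreal (real k * h j) \<and> (k = 0 \<or> ennreal (real (k - 1) * h j) < T \<omega>)}"
  shows "ennreal (put_payoff r q X T \<omega>)
    \<le> liminf (\<lambda>j. ennreal (\<Sum>k<K j. indicator (D j k) \<omega> * (exp (- r * (real k * h j)) * f j (X (real k * h j) \<omega>))))"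
proof -
  define \<tau> where "\<tau> = enn2real (T \<omega>)"
  have \<tau>: "0 \<le> \<tau>" "T \<omega> = ennreal \<tau>" using Tfin by (auto simp: \<tau>_def less_top)
  have "\<exists>k. \<tau> \<le> real k * h j \<and> real k * h j < \<tau> + h j \<and> (k = 0 \<or> real (k - 1) * h j < \<tau>)" for j
    using grid_index[OF \<tau>(1) h(1)[of j]] by metis
  then obtain k where k: "\<And>j. \<tau> \<le> real (k j) * h j" "\<And>j. real (k j) * h j < \<tau> + h j"
    "\<And>j. k j = 0 \<or> real (k j - 1) * h j < \<tau>" by metis
  define s where "s j = real (k j) * h j" for j
  have slim: "s \<longlonglongrightarrow> \<tau>"
  proof (rule tendsto_sandwich[where f="\<lambda>_. \<tau>" and h="\<lambda>j. \<tau> + 1 / real (Suc j)"])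
    show "\<forall>\<^sub>F j in sequentially. \<tau> \<le> s j" using k by (simp add: s_def)
    show "\<forall>\<^sub>F j in sequentially. s j \<le> \<tau> + 1 / real (Suc j)"
    proof (intro always_eventually allI)
      show "s j \<le> \<tau> + 1 / real (Suc j)" for j using k(2)[of j] h(2)[of j] unfolding s_def by linarith
    qed
    show "(\<lambda>j. \<tau> + 1 / real (Suc j)) \<longlonglongrightarrow> \<tau>"
      using tendsto_add[OF tendsto_const[of \<tau>] LIMSEQ_inverse_real_of_nat] by (simp add: inverse_eq_divide)
  qed simp
  have s0: "0 \<le> s j" and s1: "s j \<le> \<tau> + 1" for j
  proof -
    show "0 \<le> s j" using k(1)[of j] \<tau> by (simp add: s_def)
    have "h j \<le> 1" using h(2)[of j] by (rule order_trans) simp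
    then show "s j \<le> \<tau> + 1" using k(2)[of j] by (simp add: s_def)
  qed
  have Xlim: "(\<lambda>j. X (s j) \<omega>) \<longlonglongrightarrow> X \<tau> \<omega>"
    using cont s0 \<tau>(1) slim by (intro continuous_on_tendsto_compose[where f="\<lambda>t. X t \<omega>" and s="{0..}"]) auto
  have comp: "compact ((\<lambda>t. X t \<omega>) ` {0..\<tau> + 1})"
    by (intro compact_continuous_image continuous_on_subset[OF cont]) auto
  have ne: "(\<lambda>t. X t \<omega>) ` {0..\<tau> + 1} \<noteq> {}" using \<tau> by auto
  obtain tm where tm: "tm \<in> {0..\<tau> + 1}" "\<And>t. t \<in> {0..\<tau> + 1} \<Longrightarrow> X tm \<omega> \<le> X t \<omega>"
    using compact_attains_inf[OF comp ne] by auto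
  obtain tM where tM: "tM \<in> {0..\<tau> + 1}" "\<And>t. t \<in> {0..\<tau> + 1} \<Longrightarrow> X t \<omega> \<le> X tM \<omega>"
    using compact_attains_sup[OF comp ne] by auto
  have mp: "0 < X tm \<omega>" using tm pos by auto
  \<comment> \<open>A lower bound of the stopped reward that converges to the payoff.\<close>
  define b where "b j = exp (- r * s j) * max 0 (q - X (s j) \<omega>) - exp (- r * s j) * (1 / real (Suc j))" for j
  have blim: "b \<longlonglongrightarrow> exp (- r * \<tau>) * max 0 (q - X \<tau> \<omega>) - exp (- r * \<tau>) * 0"
    unfolding b_def using slim Xlim LIMSEQ_inverse_real_of_nat[unfolded inverse_eq_divide] by (intro tendsto_intros)
  have pay: "put_payoff r q X T \<omega> = exp (- r * \<tau>) * max 0 (q - X \<tau> \<omega>)"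
    using Tfin by (simp add: put_payoff_def discount_def \<tau>_def less_top)
  let ?g = "\<lambda>j. \<Sum>k<K j. indicator (D j k) \<omega> * (exp (- r * (real k * h j)) * f j (X (real k * h j) \<omega>))"
  have ev: "\<forall>\<^sub>F j in sequentially. b j \<le> ?g j"
  proof -
    obtain n :: nat where n: "max (1 / X tm \<omega>) (max (X tM \<omega>) (\<tau> + 1)) < real n" using reals_Archimedean2 by blast
    show ?thesis
    proof (rule eventually_sequentiallyI[of n])
      fix j assume j: "n \<le> j"
      have j': "1 / X tm \<omega> < real (Suc j)" "X tM \<omega> < real (Suc j)" "\<tau> + 1 < real (Suc j)"
        using n j by auto
      have in_K: "1 / real (Suc j) \<le> X u \<omega> \<and> X u \<omega> \<le> real (Suc j)" if "u \<in> {0..\<tau> + 1}" for u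
      proof -
        have "1 / real (Suc j) \<le> X tm \<omega>" using j'(1) mp by (simp add: field_simps)
        then show ?thesis using tm(2)[OF that] tM(2)[OF that] j'(2) by auto
      qed
      have "s j < real (K j) * h j" using s1[of j] j'(3) K[of j] by simp
      then have kK: "k j < K j" using h(1)[of j] by (simp add: s_def)
      have "\<omega> \<in> D j (k j)"
        unfolding D_def
      proof (intro CollectI conjI \<omega> ballI)
        fix u assume "u \<in> {0..real (k j) * h j}"
        then show "X u \<omega> \<in> {1 / real (Suc j)..real (Suc j)}" using in_K[of u] s1[of j] by (simp add: s_def)
      next
        show "T \<omega> \<le> ennreal (real (k j) * h j)" using k(1) \<tau> by (simp add: ennreal_leI)
        show "k j = 0 \<or> ennreal (real (k j - 1) * h j) < T \<omega>"
          using k(3)[of j] h(1)[of j] \<tau> by (auto simp: ennreal_less_iff)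
      qed
      moreover have "max 0 (q - X (s j) \<omega>) - 1 / real (Suc j) \<le> f j (X (s j) \<omega>)"
        using in_K[of "s j"] s0 s1 by (intro fW) auto
      then have "b j \<le> exp (- r * s j) * f j (X (s j) \<omega>)"
        unfolding b_def right_diff_distrib[symmetric] by (intro mult_left_mono) auto
      ultimately have "b j \<le> indicator (D j (k j)) \<omega> * (exp (- r * (real (k j) * h j)) * f j (X (real (k j) * h j) \<omega>))"
        by (simp add: s_def)
      also have "\<dots> \<le> ?g j"
        using kK f0 by (intro member_le_sum[where f="\<lambda>k. indicator (D j k) \<omega> * (exp (- r * (real k * h j)) * f j (X (real k * h j) \<omega>))"])
          (auto simp: indicator_def)
      finally show "b j \<le> ?g j" .
    qed
  qed
  have "(\<lambda>j. ennreal (b j)) \<longlonglongrightarrow> ennreal (put_payoff r q X T \<omega>)"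
    using blim pay by (intro tendsto_ennrealI) simp
  then have "ennreal (put_payoff r q X T \<omega>) = liminf (\<lambda>j. ennreal (b j))"
    using lim_imp_Liminf[OF trivial_limit_sequentially] by metis
  also have "\<dots> \<le> liminf (\<lambda>j. ennreal (?g j))"
    using ev by (intro Liminf_mono) (auto elim!: eventually_mono intro: ennreal_leI)
  finally show ?thesis .
qed

text \<open>
  The window, the time horizon and the accuracy are all driven by one index \<open>j\<close>; the grid is chosen last,
  so fine that the error caused by leaving the window is at most \<open>1 / (j + 1)\<close>. Fatou's lemma then gives
  the bound for the payoff itself.
\<close>

lemma verification:
  assumes sol: "strong_solution M F B \<mu> \<sigma> x X" and x: "0 < x" and r: "0 \<le> r"
    and meas: "\<mu> \<in> borel_measurable (restrict_space borel {0<..})" "\<sigma> \<in> borel_measurable (restrict_space borel {0<..})"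
    and bnd: "\<And>lo hi. 0 < lo \<Longrightarrow> \<exists>C\<ge>0. \<forall>y\<in>{lo..hi}. \<bar>\<mu> y\<bar> \<le> C \<and> \<bar>\<sigma> y\<bar> \<le> C"
    and approx: "\<And>lo hi \<epsilon>. 0 < lo \<Longrightarrow> lo \<le> hi \<Longrightarrow> 0 < \<epsilon> \<Longrightarrow> \<exists>f f' f'' L. bounded_C2 f f' f'' L \<and> (\<forall>z. 0 \<le> f z) \<and>
      (\<forall>y\<in>{lo..hi}. (\<sigma> y)\<^sup>2 * f'' y / 2 + \<mu> y * f' y - r * f y \<le> \<epsilon> \<and> \<bar>f y - W y\<bar> \<le> \<epsilon>)"
    and W: "\<And>y. 0 < y \<Longrightarrow> max 0 (q - y) \<le> W y"
    and T: "stopping_time F T"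
  shows "(\<integral>\<omega>. put_payoff r q X T \<omega> \<partial>M) \<le> W x"
proof -
  have W0: "0 \<le> W x" using W[OF x] by simp
  define lo where "lo j = 1 / real (Suc j)" for j
  define hi where "hi j = real (Suc j)" for j
  have lh: "0 < lo j" "lo j \<le> hi j" for j
    by (auto simp: lo_def hi_def intro: order_trans[of _ 1])
  have "\<exists>C. 0 \<le> C \<and> (\<forall>y\<in>{lo j..hi j}. \<bar>\<mu> y\<bar> \<le> C \<and> \<bar>\<sigma> y\<bar> \<le> C)" for j
    using bnd[OF lh(1)[of j], of "hi j"] by auto
  then obtain C where C: "\<And>j. 0 \<le> C j" "\<And>j y. lo j \<le> y \<Longrightarrow> y \<le> hi j \<Longrightarrow> \<bar>\<mu> y\<bar> \<le> C j"
    "\<And>j y. lo j \<le> y \<Longrightarrow> y \<le> hi j \<Longrightarrow> \<bar>\<sigma> y\<bar> \<le> C j" by (metis atLeastAtMost_iff)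
  \<comment> \<open>Over the horizon \<open>j + 1\<close> an accuracy of this order adds up to \<open>1 / (j + 1)\<close>.\<close>
  define e where "e j = 1 / (real (Suc j))\<^sup>2" for j
  have e0: "0 < e j" for j by (simp add: e_def)
  have e1: "e j \<le> 1 / real (Suc j)" for j
    unfolding e_def by (intro divide_left_mono) (auto simp: power2_eq_square)
  have "\<exists>f f' f'' L. bounded_C2 f f' f'' L \<and> (\<forall>z. 0 \<le> f z) \<and>
      (\<forall>y\<in>{lo j..hi j}. (\<sigma> y)\<^sup>2 * f'' y / 2 + \<mu> y * f' y - r * f y \<le> e j \<and> \<bar>f y - W y\<bar> \<le> e j)" for j
    by (rule approx[OF lh e0])
  then obtain f f' f'' L where f: "\<And>j. bounded_C2 (f j) (f' j) (f'' j) (L j)" "\<And>j z. 0 \<le> f j z"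
    "\<And>j y. lo j \<le> y \<Longrightarrow> y \<le> hi j \<Longrightarrow> (\<sigma> y)\<^sup>2 * f'' j y / 2 + \<mu> y * f' j y - r * f j y \<le> e j"
    "\<And>j y. lo j \<le> y \<Longrightarrow> y \<le> hi j \<Longrightarrow> \<bar>f j y - W y\<bar> \<le> e j" by (metis atLeastAtMost_iff)
  define Gb where "Gb j = L j * C j + L j * (C j)\<^sup>2 + r * L j" for j
  have L0: "0 \<le> L j" for j using bounded_C2.L_nonneg[OF f(1)] .
  have Gb0: "0 \<le> Gb j" for j using L0 C r by (simp add: Gb_def)
  have "\<exists>K::nat. 0 < K \<and> (real (Suc j))\<^sup>2 * (Gb j + 1) \<le> real K" for j
  proof -
    obtain K :: nat where "(real (Suc j))\<^sup>2 * (Gb j + 1) < real K" using reals_Archimedean2 by blast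
    moreover have "0 \<le> (real (Suc j))\<^sup>2 * (Gb j + 1)" using Gb0[of j] by simp
    ultimately show ?thesis by (intro exI[of _ K]) (auto intro: gr0I)
  qed
  then obtain K :: "nat \<Rightarrow> nat" where K: "\<And>j. 0 < K j" "\<And>j. (real (Suc j))\<^sup>2 * (Gb j + 1) \<le> real (K j)" by metis
  define h where "h j = real (Suc j) / real (K j)" for j
  have h0: "0 < h j" and Kh: "real (K j) * h j = real (Suc j)" for j using K(1)[of j] by (auto simp: h_def)
  have hG: "(Gb j + 1) * h j \<le> 1 / real (Suc j)" for j
  proof -
    have "(Gb j + 1) * (real (Suc j) * real (Suc j)) \<le> real (K j)" using K(2)[of j] by (simp add: power2_eq_square mult_ac)
    then show ?thesis using K(1)[of j] by (simp add: h_def field_simps)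
  qed
  have h1: "h j \<le> 1 / real (Suc j)" and hGb: "Gb j * h j \<le> 1 / real (Suc j)" for j
    using hG[of j] h0[of j] mult_nonneg_nonneg[OF Gb0[of j] less_imp_le[OF h0[of j]]] unfolding distrib_right
    by linarith+
  define D where "D j k = {\<omega> \<in> space M. (\<forall>u\<in>{0..real k * h j}. X u \<omega> \<in> {lo j..hi j}) \<and>
      T \<omega> \<le> ennreal (real k * h j) \<and> (k = 0 \<or> ennreal (real (k - 1) * h j) < T \<omega>)}" for j k
  define g where "g j \<omega> = (\<Sum>k<K j. indicator (D j k) \<omega> * (exp (- r * (real k * h j)) * f j (X (real k * h j) \<omega>)))" for j \<omega>
  have DM[measurable]: "D j k \<in> sets M"
    and grid: "(\<integral>\<omega>. g j \<omega> \<partial>M) \<le> f j x + e j * (real (K j) * h j) + Gb j * h j" for j k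
  proof -
    note * = stopped_grid_bound[OF sol meas C(1)[of j], of "lo j" "hi j" "f j" "f' j" "f'' j" "L j" r "e j" T "h j"]
    show "D j k \<in> sets M"
      unfolding D_def by (rule *(2)) (assumption | rule C(2) C(3) f(1) f(2) f(3) r less_imp_le[OF e0] T h0)+
    show "(\<integral>\<omega>. g j \<omega> \<partial>M) \<le> f j x + e j * (real (K j) * h j) + Gb j * h j"
      unfolding g_def D_def Gb_def
      by (rule *(1)) (assumption | rule C(2) C(3) f(1) f(2) f(3) r less_imp_le[OF e0] T h0)+
  qed
  have Xm: "X t \<in> borel_measurable M" if "0 \<le> t" for t
    using sol that measurable_F_M by (auto simp: strong_solution_def adapted_def)
  have gi: "integrable M (g j)" for j
    unfolding g_def
  proof (intro Bochner_Integration.integrable_sum integrable_bounded[where q="L j"])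
    fix k \<omega>
    have "exp (- r * (real k * h j)) \<le> 1" using r h0[of j] by simp
    then have "exp (- r * (real k * h j)) * \<bar>f j (X (real k * h j) \<omega>)\<bar> \<le> 1 * L j"
      using bounded_C2.f_bound[OF f(1)] by (intro mult_mono) auto
    then show "\<bar>indicator (D j k) \<omega> * (exp (- r * (real k * h j)) * f j (X (real k * h j) \<omega>))\<bar> \<le> L j"
      using L0[of j] by (auto simp: indicator_def abs_mult)
  next
    fix k
    have [measurable]: "X (real k * h j) \<in> borel_measurable M" using h0[of j] by (intro Xm) simp
    have [measurable]: "f j \<in> borel_measurable borel" by (rule bounded_C2.f_measurable[OF f(1)])
    show "(\<lambda>\<omega>. indicator (D j k) \<omega> * (exp (- r * (real k * h j)) * f j (X (real k * h j) \<omega>))) \<in> borel_measurable M"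
      by measurable
  qed
  have g0: "0 \<le> g j \<omega>" for j \<omega> unfolding g_def using f(2) by (intro sum_nonneg) auto
  obtain j0 :: nat where j0: "max x (1 / x) < real j0" using reals_Archimedean2 by blast
  have Eg: "(\<integral>\<omega>. g j \<omega> \<partial>M) \<le> W x + 3 / real (Suc j)" if j: "j0 \<le> j" for j
  proof -
    have "x \<le> hi j" "1 / x \<le> hi j" using j j0 by (auto simp: hi_def)
    then have xin: "lo j \<le> x" "x \<le> hi j" using x by (auto simp: lo_def hi_def field_simps)
    note grid[of j]
    also have "e j * (real (K j) * h j) = 1 / real (Suc j)" unfolding Kh by (simp add: e_def power2_eq_square)
    also have "f j x \<le> W x + 1 / real (Suc j)" using f(4)[OF xin] e1[of j] by linarith
    finally show ?thesis using hGb[of j] by simp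
  qed
  have "(\<integral>\<^sup>+\<omega>. ennreal (put_payoff r q X T \<omega>) \<partial>M) \<le> (\<integral>\<^sup>+\<omega>. liminf (\<lambda>j. ennreal (g j \<omega>)) \<partial>M)"
  proof (rule nn_integral_mono)
    fix \<omega> assume w: "\<omega> \<in> space M"
    show "ennreal (put_payoff r q X T \<omega>) \<le> liminf (\<lambda>j. ennreal (g j \<omega>))"
    proof (cases "T \<omega> < \<infinity>")
      case True
      show ?thesis
        unfolding g_def D_def lo_def hi_def
      proof (rule stopped_payoff_limit[where X=X and \<omega>=\<omega> and h=h and K=K and f=f and q=q and T=T and r=r, OF _ _ w h0 h1 Kh f(2) _ True])
        show "continuous_on {0..} (\<lambda>t. X t \<omega>)" "0 \<le> t \<Longrightarrow> 0 < X t \<omega>" for t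
          using sol w by (auto simp: strong_solution_def)
        fix j y assume y: "1 / real (Suc j) \<le> y" "y \<le> real (Suc j)"
        have y0: "0 < y" using lh(1)[of j] y(1) unfolding lo_def by linarith
        show "max 0 (q - y) - 1 / real (Suc j) \<le> f j y"
          using f(4)[of j y, unfolded lo_def hi_def, OF y] e1[of j] W[OF y0] by linarith
      qed
    next
      case False
      then have "put_payoff r q X T \<omega> = 0" by (simp add: put_payoff_def discount_def less_top)
      then show ?thesis by simp
    qed
  qed
  also have "\<dots> \<le> liminf (\<lambda>j. (\<integral>\<^sup>+\<omega>. ennreal (g j \<omega>) \<partial>M))"
    using gi by (intro nn_integral_liminf) auto
  also have "\<dots> \<le> liminf (\<lambda>j. ennreal (W x + 3 / real (Suc j)))"
  proof (rule Liminf_mono, rule eventually_sequentiallyI[of j0])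
    fix j assume "j0 \<le> j"
    then show "(\<integral>\<^sup>+\<omega>. ennreal (g j \<omega>) \<partial>M) \<le> ennreal (W x + 3 / real (Suc j))"
      using nn_integral_eq_integral[OF gi] g0 Eg by (auto intro!: ennreal_leI)
  qed
  also have "\<dots> = ennreal (W x)"
  proof (rule lim_imp_Liminf)
    have "(\<lambda>j. W x + 3 * inverse (real (Suc j))) \<longlonglongrightarrow> W x + 3 * 0"
      by (intro tendsto_intros LIMSEQ_inverse_real_of_nat)
    then show "(\<lambda>j. ennreal (W x + 3 / real (Suc j))) \<longlonglongrightarrow> ennreal (W x)"
      by (intro tendsto_ennrealI) (simp add: divide_inverse)
  qed simp
  finally have nn: "(\<integral>\<^sup>+\<omega>. ennreal (put_payoff r q X T \<omega>) \<partial>M) \<le> ennreal (W x)" .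
  have pp: "0 \<le> put_payoff r q X T \<omega>" for \<omega> by (simp add: put_payoff_def discount_def)
  show ?thesis
  proof (cases "integrable M (put_payoff r q X T)")
    case True
    then have "ennreal (\<integral>\<omega>. put_payoff r q X T \<omega> \<partial>M) \<le> ennreal (W x)"
      using nn nn_integral_eq_integral[OF True] pp by auto
    then show ?thesis using W0 by (simp add: ennreal_le_iff)
  next
    case False
    then show ?thesis using W0 by (simp add: not_integrable_integral_eq)
  qed
qed

end

section \<open>Extension of functions from a window\<close>

text \<open>
  Gluing with the zero function at a point where \<open>g\<close> vanishes together with its derivative.
\<close>

lemma DERIV_positive_part:
  fixes g g' :: "real \<Rightarrow> real"
  assumes g: "\<And>y. (g has_real_derivative g' y) (at y)" and "g 0 = 0" "g' 0 = 0"
  shows "((\<lambda>y. g (max y 0)) has_real_derivative g' (max y 0)) (at y)"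
proof (cases y "0::real" rule: linorder_cases)
  case less
  have "((\<lambda>y. g (max y 0)) has_real_derivative 0) (at y)"
    by (rule has_field_derivative_transform_within_open[of "\<lambda>_. 0" _ _ "{..<0}"])
      (use less assms in \<open>auto simp: max_absorb2\<close>)
  then show ?thesis using less assms by (simp add: max_absorb2)
next
  case greater
  have "((\<lambda>y. g (max y 0)) has_real_derivative g' y) (at y)"
    by (rule has_field_derivative_transform_within_open[of g _ _ "{0<..}"])
      (use greater g in \<open>auto simp: max_absorb1\<close>)
  then show ?thesis using greater by (simp add: max_absorb1)
next
  case equal
  have "(\<lambda>y. g y / y) \<midarrow>0\<rightarrow> 0"
    using g[of 0] assms by (simp add: has_field_derivative_iff)
  then have "(\<lambda>y. \<bar>g y / y\<bar>) \<midarrow>0\<rightarrow> 0" by (rule tendsto_rabs_zero)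
  moreover have "\<forall>\<^sub>F y in at 0. norm (g (max y 0) / y) \<le> \<bar>g y / y\<bar>"
  proof (intro always_eventually allI)
    show "norm (g (max y 0) / y) \<le> \<bar>g y / y\<bar>" for y
    proof (cases "y \<le> 0")
      case True
      then have "g (max y 0) = 0" using assms by (simp add: max_absorb2)
      then show ?thesis by (simp only: div_0 norm_zero abs_ge_zero)
    qed (simp add: max_absorb1)
  qed
  ultimately have "(\<lambda>y. g (max y 0) / y) \<midarrow>0\<rightarrow> 0" by (rule Lim_null_comparison[rotated])
  then show ?thesis using equal assms by (simp add: has_field_derivative_iff)
qed

lemma uniformly_continuous_on_mult_bounded:
  fixes f g :: "real \<Rightarrow> real"
  assumes f: "uniformly_continuous_on UNIV f" "\<And>z. \<bar>f z\<bar> \<le> K"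
    and g: "uniformly_continuous_on UNIV g" "\<And>z. \<bar>g z\<bar> \<le> K"
  shows "uniformly_continuous_on UNIV (\<lambda>z. f z * g z)"
  unfolding uniformly_continuous_on_sequentially
proof (intro allI impI)
  fix x y :: "nat \<Rightarrow> real"
  assume "(\<forall>n. x n \<in> UNIV) \<and> (\<forall>n. y n \<in> UNIV) \<and> (\<lambda>n. dist (x n) (y n)) \<longlonglongrightarrow> 0"
  then have "(\<lambda>n. dist (f (x n)) (f (y n))) \<longlonglongrightarrow> 0" "(\<lambda>n. dist (g (x n)) (g (y n))) \<longlonglongrightarrow> 0"
    using f(1) g(1) unfolding uniformly_continuous_on_sequentially by blast+
  then have "(\<lambda>n. K * dist (f (x n)) (f (y n)) + K * dist (g (x n)) (g (y n))) \<longlonglongrightarrow> K * 0 + K * 0"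
    by (intro tendsto_intros)
  moreover have "norm (dist (f (x n) * g (x n)) (f (y n) * g (y n)))
      \<le> K * dist (f (x n)) (f (y n)) + K * dist (g (x n)) (g (y n))" for n
  proof -
    have "f (x n) * g (x n) - f (y n) * g (y n) = g (x n) * (f (x n) - f (y n)) + f (y n) * (g (x n) - g (y n))"
      by (simp add: algebra_simps)
    also have "\<bar>\<dots>\<bar> \<le> \<bar>g (x n)\<bar> * \<bar>f (x n) - f (y n)\<bar> + \<bar>f (y n)\<bar> * \<bar>g (x n) - g (y n)\<bar>"
      by (metis abs_mult abs_triangle_ineq)
    also have "\<dots> \<le> K * \<bar>f (x n) - f (y n)\<bar> + K * \<bar>g (x n) - g (y n)\<bar>"
      using f(2) g(2) by (intro add_mono mult_right_mono) auto
    finally show ?thesis by (simp add: dist_real_def)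
  qed
  ultimately show "(\<lambda>n. dist (f (x n) * g (x n)) (f (y n) * g (y n))) \<longlonglongrightarrow> 0"
    by (intro Lim_null_comparison[of "\<lambda>n. dist (f (x n) * g (x n)) (f (y n) * g (y n))"]) auto
qed

lemma lipschitz_uniformly_continuous:
  fixes f :: "real \<Rightarrow> real"
  assumes "\<And>y z. \<bar>f y - f z\<bar> \<le> K * \<bar>y - z\<bar>" "0 \<le> K"
  shows "uniformly_continuous_on UNIV f"
  using assms by (intro lipschitz_on_uniformly_continuous[of K] lipschitz_onI) (auto simp: dist_real_def)

lemma bounded_derivative_lipschitz:
  fixes f f' :: "real \<Rightarrow> real"
  assumes "\<And>z. (f has_real_derivative f' z) (at z)" "\<And>z. \<bar>f' z\<bar> \<le> K"
  shows "\<bar>f y - f z\<bar> \<le> K * \<bar>y - z\<bar>"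
  using field_differentiable_bound[of UNIV f f' K y z] assms
  by (auto intro: has_field_derivative_at_within)

text \<open>
  \<open>z + arctan_excess z\<close> is the identity up to \<open>0\<close> and \<open>arctan\<close> afterwards. As \<open>arctan\<close> agrees with the
  identity to second order at \<open>0\<close>, this is a \<open>C\<^sup>2\<close> function that is bounded above. The next two functions
  are its derivatives.
\<close>

definition arctan_excess :: "real \<Rightarrow> real" where "arctan_excess z = arctan (max z 0) - max z 0"
definition arctan_excess' :: "real \<Rightarrow> real" where "arctan_excess' z = 1 / (1 + (max z 0)\<^sup>2) - 1"
definition arctan_excess'' :: "real \<Rightarrow> real" where "arctan_excess'' z = - 2 * max z 0 / (1 + (max z 0)\<^sup>2)\<^sup>2"

lemma sq1_pos: "0 < 1 + (y::real)\<^sup>2"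
  by (rule add_pos_nonneg) auto

lemma arctan_excess_deriv: "(arctan_excess has_real_derivative arctan_excess' z) (at z)"
  unfolding arctan_excess_def[abs_def] arctan_excess'_def
  by (rule DERIV_positive_part[of "\<lambda>y. arctan y - y" "\<lambda>y. 1 / (1 + y\<^sup>2) - 1"])
    (auto intro!: derivative_eq_intros simp: field_simps)

lemma arctan_excess'_deriv: "(arctan_excess' has_real_derivative arctan_excess'' z) (at z)"
  unfolding arctan_excess'_def[abs_def] arctan_excess''_def
proof (rule DERIV_positive_part[of "\<lambda>y. 1 / (1 + y\<^sup>2) - 1" "\<lambda>y. - 2 * y / (1 + y\<^sup>2)\<^sup>2"])
  show "((\<lambda>y. 1 / (1 + y\<^sup>2) - 1) has_real_derivative - 2 * y / (1 + y\<^sup>2)\<^sup>2) (at y)" for y :: real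
    using sq1_pos[of y] by (auto intro!: derivative_eq_intros simp: power2_eq_square)
qed auto

lemma arctan_excess'_bounds: "- 1 \<le> arctan_excess' z" "arctan_excess' z \<le> 0" "z \<le> 0 \<Longrightarrow> arctan_excess' z = 0"
  using sq1_pos[of "max z 0"] by (auto simp: arctan_excess'_def field_simps max_def)

lemma arctan_excess''_bound: "\<bar>arctan_excess'' z\<bar> \<le> 1" and arctan_excess''_neg: "z \<le> 0 \<Longrightarrow> arctan_excess'' z = 0" and arctan_excess_neg: "z \<le> 0 \<Longrightarrow> arctan_excess z = 0"
proof -
  define m where "m = max z 0"
  have "0 \<le> m" by (simp add: m_def)
  have p: "1 \<le> 1 + m\<^sup>2" by simp
  have "2 * m \<le> 1 + m\<^sup>2" using sum_squares_bound[of 1 m] by simp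
  also have "\<dots> \<le> (1 + m\<^sup>2)\<^sup>2" using mult_right_mono[OF p, of "1 + m\<^sup>2"] p by (simp add: power2_eq_square)
  finally have "2 * m \<le> (1 + m\<^sup>2)\<^sup>2" .
  then show "\<bar>arctan_excess'' z\<bar> \<le> 1" using sq1_pos[of m] \<open>0 \<le> m\<close>
    by (simp add: arctan_excess''_def m_def[symmetric] abs_mult abs_divide divide_le_eq)
qed (auto simp: arctan_excess''_def arctan_excess_def max_absorb2)

lemma arctan_excess''_lipschitz: "\<bar>arctan_excess'' y - arctan_excess'' z\<bar> \<le> 10 * \<bar>y - z\<bar>"
proof -
  define g where "g y = - 2 * y / (1 + y\<^sup>2)\<^sup>2" for y :: real
  have d: "(g has_real_derivative (- 2 / (1 + y\<^sup>2)\<^sup>2 + 8 * y\<^sup>2 / (1 + y\<^sup>2) ^ 3)) (at y)" for y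
  proof -
    have q: "(- 2 * p\<^sup>2 - (- 2 * y) * (2 * p * (2 * y))) / (p\<^sup>2 * p\<^sup>2) = - 2 / p\<^sup>2 + 8 * y\<^sup>2 / p ^ 3" if "0 < p" for p :: real
      using that by (simp add: divide_simps power2_eq_square power3_eq_cube) (simp add: algebra_simps)
    have "(g has_real_derivative (- 2 * (1 + y\<^sup>2)\<^sup>2 - (- 2 * y) * (2 * (1 + y\<^sup>2) * (2 * y))) / ((1 + y\<^sup>2)\<^sup>2 * (1 + y\<^sup>2)\<^sup>2)) (at y)"
      unfolding g_def using sq1_pos[of y] by (intro DERIV_divide) (auto intro!: derivative_eq_intros)
    then show ?thesis unfolding q[OF sq1_pos] .
  qed
  have b: "\<bar>- 2 / (1 + y\<^sup>2)\<^sup>2 + 8 * y\<^sup>2 / (1 + y\<^sup>2) ^ 3\<bar> \<le> 10" for y :: real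
  proof -
    have p: "1 \<le> 1 + y\<^sup>2" by simp
    have "1 \<le> (1 + y\<^sup>2)\<^sup>2" using p by (rule one_le_power)
    then have 1: "2 / (1 + y\<^sup>2)\<^sup>2 \<le> 2" "0 \<le> 2 / (1 + y\<^sup>2)\<^sup>2" by (auto simp: divide_le_eq)
    have "y\<^sup>2 \<le> (1 + y\<^sup>2) ^ 1" by simp
    also have "\<dots> \<le> (1 + y\<^sup>2) ^ 3" using p by (intro power_increasing) auto
    finally have 2: "8 * y\<^sup>2 / (1 + y\<^sup>2) ^ 3 \<le> 8" "0 \<le> 8 * y\<^sup>2 / (1 + y\<^sup>2) ^ 3"
      using sq1_pos[of y] by (auto simp: divide_le_eq)
    show ?thesis using 1 2 by linarith
  qed
  have "\<bar>g (max y 0) - g (max z 0)\<bar> \<le> 10 * \<bar>max y 0 - max z 0\<bar>"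
    by (rule bounded_derivative_lipschitz[OF d b])
  also have "\<dots> \<le> 10 * \<bar>y - z\<bar>" by (auto simp: max_def)
  finally show ?thesis by (simp add: arctan_excess''_def g_def)
qed

lemma continuous_on_Icc_bounded:
  fixes v :: "real \<Rightarrow> real"
  assumes "continuous_on {a..b} v"
  shows "\<exists>K. \<forall>z\<in>{a..b}. \<bar>v z\<bar> \<le> K"
proof -
  have "bounded (v ` {a..b})"
    by (intro compact_imp_bounded compact_continuous_image assms) simp
  then obtain K where "\<forall>x\<in>v ` {a..b}. norm x \<le> K" unfolding bounded_iff by blast
  then show ?thesis by (intro exI[of _ K]) simp
qed

text \<open>
  Composition with a bounded \<open>C\<^sup>2\<close> map \<open>\<Psi>\<close> that is the identity on \<open>[lo, hi]\<close>. The values of \<open>f\<close> remain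
  values of \<open>u\<close> at positive arguments, so positivity is inherited from the positive half line. Below \<open>lo\<close>
  the map is rescaled by \<open>lo / 2\<close>, which keeps its range above \<open>lo * (1 - pi / 4)\<close>.
\<close>

lemma bounded_C2_localization:
  fixes u u' u'' :: "real \<Rightarrow> real"
  assumes u: "\<And>z. (u has_real_derivative u' z) (at z)" and u': "\<And>z. (u' has_real_derivative u'' z) (at z)"
    and u'': "continuous_on UNIV u''" and lo: "0 < lo" "lo \<le> hi"
  obtains f f' f'' L where "bounded_C2 f f' f'' L"
    "\<And>z. lo \<le> z \<Longrightarrow> z \<le> hi \<Longrightarrow> f z = u z \<and> f' z = u' z \<and> f'' z = u'' z"
    "\<And>z. \<exists>y. lo * (1 - pi / 4) \<le> y \<and> y \<le> hi + pi / 2 \<and> f z = u y"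
proof -
  define d where "d = lo / 2"
  have d: "0 < d" using lo by (simp add: d_def)
  define \<Psi> where "\<Psi> z = z + arctan_excess (z - hi) - d * arctan_excess ((lo - z) / d)" for z
  define \<Psi>1 where "\<Psi>1 z = 1 + arctan_excess' (z - hi) + arctan_excess' ((lo - z) / d)" for z
  define \<Psi>2 where "\<Psi>2 z = arctan_excess'' (z - hi) - arctan_excess'' ((lo - z) / d) / d" for z
  have \<Psi>d: "(\<Psi> has_real_derivative \<Psi>1 z) (at z)" for z
    unfolding \<Psi>_def \<Psi>1_def using d
    by (auto intro!: derivative_eq_intros DERIV_chain2[OF arctan_excess_deriv])
  have \<Psi>1d: "(\<Psi>1 has_real_derivative \<Psi>2 z) (at z)" for z
    unfolding \<Psi>1_def \<Psi>2_def using d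
    by (auto intro!: derivative_eq_intros DERIV_chain2[OF arctan_excess'_deriv])
  have \<Psi>1b: "\<bar>\<Psi>1 z\<bar> \<le> 1" for z
    using arctan_excess'_bounds[of "z - hi"] arctan_excess'_bounds[of "(lo - z) / d"] by (simp add: \<Psi>1_def)
  have \<Psi>2b: "\<bar>\<Psi>2 z\<bar> \<le> 1 + 1 / d" for z
  proof -
    have "\<bar>arctan_excess'' ((lo - z) / d) / d\<bar> \<le> 1 / d" using arctan_excess''_bound[of "(lo - z) / d"] d by (simp add: abs_divide divide_right_mono)
    then show ?thesis using arctan_excess''_bound[of "z - hi"] unfolding \<Psi>2_def by linarith
  qed
  define lo1 where "lo1 = lo * (1 - pi / 4)"
  define hi1 where "hi1 = hi + pi / 2"
  have \<Psi>_id: "\<Psi> z = z" "\<Psi>1 z = 1" "\<Psi>2 z = 0" if "lo \<le> z" "z \<le> hi" for z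
    using that d by (auto simp: \<Psi>_def \<Psi>1_def \<Psi>2_def arctan_excess_neg arctan_excess'_bounds arctan_excess''_neg divide_nonpos_pos)
  have \<Psi>_range: "lo1 \<le> \<Psi> z \<and> \<Psi> z \<le> hi1" for z
  proof -
    have l: "lo1 \<le> lo" using lo by (simp add: lo1_def mult_left_le)
    have h: "hi \<le> hi1" by (simp add: hi1_def)
    consider "z < lo" | "lo \<le> z" "z \<le> hi" | "hi < z" by linarith
    then show ?thesis
    proof cases
      case 1
      then have "\<Psi> z = lo - d * arctan ((lo - z) / d)"
        using lo d by (simp add: \<Psi>_def arctan_excess_neg) (simp add: arctan_excess_def max_absorb1 field_simps)
      moreover have "0 < arctan ((lo - z) / d)" using 1 d by simp
      moreover have "d * arctan ((lo - z) / d) \<le> d * (pi / 2)"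
        using arctan_ubound[of "(lo - z) / d"] d by (intro mult_left_mono) auto
      moreover have "lo - d * (pi / 2) = lo1" by (simp add: lo1_def d_def algebra_simps)
      ultimately show ?thesis using lo h d by (auto intro: order_trans[of _ lo])
    next
      case 2
      then show ?thesis using \<Psi>_id l h by simp
    next
      case 3
      then have "\<Psi> z = hi + arctan (z - hi)"
        using lo d by (simp add: \<Psi>_def arctan_excess_neg divide_nonpos_pos) (simp add: arctan_excess_def max_absorb1)
      moreover have "0 < arctan (z - hi)" using 3 by simp
      ultimately show ?thesis using arctan_ubound[of "z - hi"] l lo unfolding hi1_def by linarith
    qed
  qed
  have cu: "continuous_on {lo1..hi1} u" "continuous_on {lo1..hi1} u'"
    by (rule DERIV_continuous_on[OF has_field_derivative_at_within[OF u]],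
        rule DERIV_continuous_on[OF has_field_derivative_at_within[OF u']])
  have cu'': "continuous_on {lo1..hi1} u''" by (rule continuous_on_subset[OF u'']) simp
  obtain K0 where "\<forall>z\<in>{lo1..hi1}. \<bar>u z\<bar> \<le> K0" using continuous_on_Icc_bounded[OF cu(1)] ..
  moreover obtain K1 where "\<forall>z\<in>{lo1..hi1}. \<bar>u' z\<bar> \<le> K1" using continuous_on_Icc_bounded[OF cu(2)] ..
  moreover obtain K2 where "\<forall>z\<in>{lo1..hi1}. \<bar>u'' z\<bar> \<le> K2" using continuous_on_Icc_bounded[OF cu''] ..
  ultimately have K: "\<And>z. z \<in> {lo1..hi1} \<Longrightarrow> \<bar>u z\<bar> \<le> K0" "\<And>z. z \<in> {lo1..hi1} \<Longrightarrow> \<bar>u' z\<bar> \<le> K1"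
    "\<And>z. z \<in> {lo1..hi1} \<Longrightarrow> \<bar>u'' z\<bar> \<le> K2" by blast+
  have \<Psi>in: "\<Psi> z \<in> {lo1..hi1}" for z using \<Psi>_range by simp
  have Kpos: "0 \<le> K0" "0 \<le> K1" "0 \<le> K2"
    using K(1)[OF \<Psi>in[of 0]] K(2)[OF \<Psi>in[of 0]] K(3)[OF \<Psi>in[of 0]] by linarith+
  define f where "f z = u (\<Psi> z)" for z
  define f' where "f' z = u' (\<Psi> z) * \<Psi>1 z" for z
  define f'' where "f'' z = u'' (\<Psi> z) * (\<Psi>1 z * \<Psi>1 z) + u' (\<Psi> z) * \<Psi>2 z" for z
  define L where "L = K0 + K1 * (1 + 1 / d) + K2"
  have "bounded_C2 f f' f'' L"
  proof
    fix z
    show "(f has_real_derivative f' z) (at z)"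
      unfolding f_def f'_def by (rule DERIV_chain2[OF u \<Psi>d])
    show "(f' has_real_derivative f'' z) (at z)"
      unfolding f'_def f''_def
      by (auto intro!: derivative_eq_intros DERIV_chain2[OF u' \<Psi>d] \<Psi>1d)
    have d1: "0 \<le> 1 / d" using d by simp
    have k1: "K1 \<le> K1 * (1 + 1 / d)" using mult_nonneg_nonneg[OF Kpos(2) d1] by (simp add: distrib_left)
    show "\<bar>f z\<bar> \<le> L" using K(1)[OF \<Psi>in[of z]] Kpos k1 by (simp add: f_def L_def)
    have a: "\<bar>u' (\<Psi> z) * \<Psi>1 z\<bar> \<le> K1 * 1"
      unfolding abs_mult using K(2)[OF \<Psi>in[of z]] \<Psi>1b Kpos by (intro mult_mono) auto
    show "\<bar>f' z\<bar> \<le> L" using a Kpos k1 by (simp add: f'_def L_def)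
    have "\<bar>\<Psi>1 z * \<Psi>1 z\<bar> \<le> 1 * 1" unfolding abs_mult using \<Psi>1b by (intro mult_mono) auto
    then have b: "\<bar>u'' (\<Psi> z) * (\<Psi>1 z * \<Psi>1 z)\<bar> \<le> K2 * 1"
      unfolding abs_mult[of "u'' (\<Psi> z)"] using K(3)[OF \<Psi>in[of z]] Kpos by (intro mult_mono) auto
    have "\<bar>u' (\<Psi> z) * \<Psi>2 z\<bar> \<le> K1 * (1 + 1 / d)"
      unfolding abs_mult using K(2)[OF \<Psi>in[of z]] \<Psi>2b Kpos by (intro mult_mono) auto
    then show "\<bar>f'' z\<bar> \<le> L" using b Kpos unfolding f''_def L_def by linarith
  next
    define P where "P = max (K1 + K2) (2 + 1 / d)"
    have "0 \<le> 1 / d" using d by simp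
    then have P: "K1 \<le> P" "K2 \<le> P" "1 \<le> P" "1 + 1 / d \<le> P"
      using Kpos unfolding P_def le_max_iff_disj by linarith+
    have \<Psi>u: "uniformly_continuous_on UNIV \<Psi>"
      by (rule lipschitz_uniformly_continuous[OF bounded_derivative_lipschitz[OF \<Psi>d \<Psi>1b]]) simp
    have \<Psi>1u: "uniformly_continuous_on UNIV \<Psi>1"
      by (rule lipschitz_uniformly_continuous[OF bounded_derivative_lipschitz[OF \<Psi>1d \<Psi>2b]]) (use d in simp)
    have \<Psi>2u: "uniformly_continuous_on UNIV \<Psi>2"
    proof (rule lipschitz_uniformly_continuous)
      fix y z
      have "\<bar>arctan_excess'' ((lo - y) / d) / d - arctan_excess'' ((lo - z) / d) / d\<bar> = \<bar>arctan_excess'' ((lo - y) / d) - arctan_excess'' ((lo - z) / d)\<bar> / d"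
        using d by (simp add: diff_divide_distrib[symmetric] abs_divide)
      also have "\<dots> \<le> (10 * \<bar>(lo - y) / d - (lo - z) / d\<bar>) / d"
        using d by (intro divide_right_mono arctan_excess''_lipschitz) auto
      also have "\<bar>(lo - y) / d - (lo - z) / d\<bar> = \<bar>y - z\<bar> / d"
        using d by (simp add: diff_divide_distrib[symmetric] abs_divide abs_minus_commute)
      finally have "\<bar>arctan_excess'' ((lo - y) / d) / d - arctan_excess'' ((lo - z) / d) / d\<bar> \<le> 10 / d\<^sup>2 * \<bar>y - z\<bar>"
        by (simp add: power2_eq_square)
      moreover have "\<bar>arctan_excess'' (y - hi) - arctan_excess'' (z - hi)\<bar> \<le> 10 * \<bar>y - z\<bar>"
        using arctan_excess''_lipschitz[of "y - hi" "z - hi"] by simp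
      ultimately show "\<bar>\<Psi>2 y - \<Psi>2 z\<bar> \<le> (10 + 10 / d\<^sup>2) * \<bar>y - z\<bar>"
        unfolding \<Psi>2_def distrib_right by linarith
    qed simp
    have comp: "uniformly_continuous_on UNIV (\<lambda>z. v (\<Psi> z))" if "continuous_on {lo1..hi1} v" for v :: "real \<Rightarrow> real"
    proof (rule uniformly_continuous_on_compose[OF \<Psi>u, unfolded o_def])
      have "uniformly_continuous_on {lo1..hi1} v" by (rule compact_uniformly_continuous[OF that compact_Icc])
      moreover have "range \<Psi> \<subseteq> {lo1..hi1}" using \<Psi>in by blast
      ultimately show "uniformly_continuous_on (range \<Psi>) v"
        unfolding uniformly_continuous_on_def by (meson subset_eq)
    qed
    have sq: "uniformly_continuous_on UNIV (\<lambda>z. \<Psi>1 z * \<Psi>1 z)"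
      by (rule uniformly_continuous_on_mult_bounded[OF \<Psi>1u \<Psi>1b \<Psi>1u \<Psi>1b])
    have sqb: "\<bar>\<Psi>1 z * \<Psi>1 z\<bar> \<le> P" for z
      using mult_mono[OF \<Psi>1b \<Psi>1b, of z z] P by (simp add: abs_mult)
    show "uniformly_continuous_on UNIV f''"
      unfolding f''_def
      by (intro uniformly_continuous_on_add uniformly_continuous_on_mult_bounded[where K=P] comp cu cu'' \<Psi>2u sq sqb
          order_trans[OF K(2)[OF \<Psi>in] P(1)] order_trans[OF K(3)[OF \<Psi>in] P(2)] order_trans[OF \<Psi>2b P(4)])
  qed
  moreover have "f z = u z \<and> f' z = u' z \<and> f'' z = u'' z" if "lo \<le> z" "z \<le> hi" for z
    using \<Psi>_id[OF that] by (simp add: f_def f'_def f''_def)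
  moreover have "\<exists>y. lo * (1 - pi / 4) \<le> y \<and> y \<le> hi + pi / 2 \<and> f z = u y" for z
    using \<Psi>_range[of z] by (auto simp: f_def lo1_def hi1_def)
  ultimately show thesis using that by blast
qed

lemma continuous_antiderivative:
  fixes g :: "real \<Rightarrow> real"
  assumes "continuous_on UNIV g"
  obtains G where "\<And>z. (G has_real_derivative g z) (at z)" "G a = c"
proof -
  have "\<exists>F. \<forall>x::real. - \<infinity> < ereal x \<longrightarrow> ereal x < \<infinity> \<longrightarrow> (F has_vector_derivative g x) (at x)"
    by (rule einterval_antiderivative) (use assms in \<open>auto simp: continuous_on_eq_continuous_at\<close>)
  then obtain F where F: "\<And>x. (F has_real_derivative g x) (at x)"
    by (auto simp: has_real_derivative_iff_has_vector_derivative)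
  show thesis
  proof (rule that[of "\<lambda>z. F z - F a + c"])
    show "((\<lambda>z. F z - F a + c) has_real_derivative g z) (at z)" for z
      by (auto intro!: derivative_eq_intros F)
  qed simp
qed

section \<open>The candidate for the value function\<close>

text \<open>
  The analytic content of the assumptions on one volatility, with the probability space removed.
\<close>

locale decreasing_harmonic =
  fixes r :: real and \<mu> \<sigma> \<phi> :: "real \<Rightarrow> real"
  assumes harmonic: "r_harmonic r \<mu> \<sigma> \<phi>"
    and pos: "0 < x \<Longrightarrow> 0 < \<phi> x"
    and strict_anti: "strict_antimono_on {0<..} \<phi>"
    and convex: "convex_on {0<..} \<phi>"
    and theta: "mono_on {0<..} (\<lambda>x. r * x - \<mu> x)"
    and r_pos: "0 < r"
begin

abbreviation "\<phi>' \<equiv> deriv \<phi>"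
abbreviation "\<phi>'' \<equiv> deriv (deriv \<phi>)"

lemma phi_deriv: "0 < x \<Longrightarrow> (\<phi> has_real_derivative \<phi>' x) (at x)"
  and phi_deriv2: "0 < x \<Longrightarrow> (\<phi>' has_real_derivative \<phi>'' x) (at x)"
  and phi_cont2: "continuous_on {0<..} \<phi>''"
  using harmonic unfolding r_harmonic_def C2_pos_def
  by (auto simp: DERIV_deriv_iff_field_differentiable)

lemma equation: "0 < x \<Longrightarrow> (\<sigma> x)\<^sup>2 * \<phi>'' x / 2 + \<mu> x * \<phi>' x = r * \<phi> x"
  using harmonic unfolding r_harmonic_def generator_def by auto


lemma phi'_nonpos: assumes x: "0 < x" shows "\<phi>' x \<le> 0"
proof -
  have "mono_on {0<..} (\<lambda>x. - \<phi> x)"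
    using strict_anti by (intro mono_onI) (force simp: monotone_on_def order_le_less)
  moreover have "((\<lambda>x. - \<phi> x) has_real_derivative - \<phi>' x) (at x)"
    by (intro DERIV_minus phi_deriv x)
  ultimately have "0 \<le> - \<phi>' x"
    by (rule mono_on_imp_deriv_nonneg) (use x in \<open>auto simp: interior_open\<close>)
  then show ?thesis by simp
qed

lemma tangent: assumes "0 < x" "0 < y" shows "\<phi> x + \<phi>' x * (y - x) \<le> \<phi> y"
  using convex_on_imp_above_tangent[OF convex, of x y "\<phi>' x"] assms phi_deriv[OF assms(1)]
  by (auto simp: interior_open has_field_derivative_at_within)

lemma phi'_mono: assumes "0 < x" "x \<le> y" shows "\<phi>' x \<le> \<phi>' y"
proof (cases "x = y")
  case False
  then have "x < y" using assms by simp
  moreover have "\<phi>' x * (y - x) \<le> \<phi>' y * (y - x)"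
    using tangent[of x y] tangent[of y x] assms by (simp add: algebra_simps)
  ultimately show ?thesis by simp
qed simp

lemma phi''_nonneg: assumes x: "0 < x" shows "0 \<le> \<phi>'' x"
  by (rule mono_on_imp_deriv_nonneg[OF _ phi_deriv2[OF x], of "{0<..}"])
    (use x phi'_mono in \<open>auto simp: interior_open intro!: mono_onI\<close>)

text \<open>
  Monotonicity of \<open>r * x - \<mu> x\<close> bounds it on an interval by its values at the end points.
\<close>

lemma mu_locally_bounded:
  assumes "0 < lo" "lo \<le> y" "y \<le> hi"
  shows "\<bar>\<mu> y\<bar> \<le> r * hi + (\<bar>\<mu> lo\<bar> + \<bar>\<mu> hi\<bar> + r * hi)"
proof -
  have "r * lo - \<mu> lo \<le> r * y - \<mu> y" "r * y - \<mu> y \<le> r * hi - \<mu> hi"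
    using mono_onD[OF theta, of lo y] mono_onD[OF theta, of y hi] assms by auto
  moreover have "0 \<le> r * lo" "r * lo \<le> r * y" "r * y \<le> r * hi" using assms r_pos by auto
  ultimately show ?thesis by linarith
qed

end

text \<open>
  The reward of stopping at the first visit to \<open>(0, a]\<close>; for an optimal level \<open>a\<close> this is the value function
  of the put.
\<close>

definition put_candidate :: "real \<Rightarrow> (real \<Rightarrow> real) \<Rightarrow> real \<Rightarrow> real \<Rightarrow> real" where
  "put_candidate q \<phi> a x = (if x \<le> a then q - x else (q - a) * \<phi> x / \<phi> a)"

context decreasing_harmonic
begin

context
  fixes q a :: real
  assumes level: "optimal_level q \<phi> a"
begin

lemma level_pos: "0 < a" "a < q"
  using level by (auto simp: optimal_level_def)

definition scale where "scale = (q - a) / \<phi> a"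

lemma scale_pos: "0 < scale" using level_pos pos[of a] by (simp add: scale_def)
lemma scale_phi: "scale * \<phi> a = q - a" using pos[of a] level_pos by (simp add: scale_def)

lemma scale_phi': "scale * \<phi>' a = - 1"
proof -
  have "(q - a) * \<phi>' a = - \<phi> a" using level by (simp add: optimal_level_def)
  then have "scale * \<phi>' a = - \<phi> a / \<phi> a" by (simp add: scale_def)
  then show ?thesis using pos[of a] level_pos by simp
qed

text \<open>
  At \<open>a\<close> the scaled equation has \<open>\<phi>\<close> and \<open>\<phi>'\<close> replaced by the values \<open>q - a\<close> and \<open>- 1\<close> of the payoff, so
  convexity of \<open>\<phi>\<close> gives \<open>r * a - \<mu> a \<le> r * q\<close>; monotonicity extends this to the left. It says that the
  payoff is a supersolution below \<open>a\<close>.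
\<close>

lemma theta_level: assumes "0 < y" "y \<le> a" shows "r * y - \<mu> y \<le> r * q"
proof -
  have "scale * ((\<sigma> a)\<^sup>2 * \<phi>'' a / 2 + \<mu> a * \<phi>' a) = scale * (r * \<phi> a)" using equation[of a] level_pos by simp
  then have "scale * ((\<sigma> a)\<^sup>2 * \<phi>'' a / 2) + \<mu> a * (scale * \<phi>' a) = r * (scale * \<phi> a)" by (simp add: algebra_simps)
  moreover have "0 \<le> scale * ((\<sigma> a)\<^sup>2 * \<phi>'' a / 2)" using scale_pos phi''_nonneg level_pos by simp
  ultimately have "r * a - \<mu> a \<le> r * q" unfolding scale_phi scale_phi' by (simp add: algebra_simps)
  moreover have "r * y - \<mu> y \<le> r * a - \<mu> a" using mono_onD[OF theta, of y a] assms by auto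
  ultimately show ?thesis by simp
qed

text \<open>
  Smooth fit: the line \<open>q - y\<close> is the tangent of the convex function \<open>scale * \<phi>\<close> at \<open>a\<close>.
\<close>

lemma scale_tangent: assumes "0 < y" shows "q - y \<le> scale * \<phi> y"
proof -
  have "scale * (\<phi> a + \<phi>' a * (y - a)) \<le> scale * \<phi> y"
    using tangent[of a y] level_pos assms scale_pos by (intro mult_left_mono) auto
  also have "scale * (\<phi> a + \<phi>' a * (y - a)) = scale * \<phi> a + (scale * \<phi>' a) * (y - a)" by (simp add: algebra_simps)
  finally show ?thesis unfolding scale_phi scale_phi' by simp
qed

lemma candidate_eq: "put_candidate q \<phi> a y = (if y \<le> a then q - y else scale * \<phi> y)"
  by (simp add: put_candidate_def scale_def)

lemma candidate_ge: assumes y: "0 < y" shows "max 0 (q - y) \<le> put_candidate q \<phi> a y"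
  using scale_tangent[OF y] pos[OF y] scale_pos level_pos by (auto simp: candidate_eq)

text \<open>
  This is where the volatilities are compared: since the candidate is convex, replacing \<open>\<sigma>\<close> by a smaller
  \<open>\<sigma>1\<close> decreases the second order term of the generator, so a supersolution for \<open>\<sigma>\<close> is one for \<open>\<sigma>1\<close>. The
  candidate is only \<open>C\<^sup>1\<close> at \<open>a\<close>. Its second derivative \<open>scale * \<phi>''\<close> is therefore switched on linearly over
  \<open>[a, a + \<kappa>]\<close> and integrated back twice. This makes the second derivative smaller, which is the
  favourable direction, and changes the function and its first derivative by a multiple of \<open>\<kappa>\<close>.
\<close>

lemma candidate_approximation:
  assumes \<sigma>1: "\<And>y. 0 < y \<Longrightarrow> 0 \<le> \<sigma>1 y" "\<And>y. 0 < y \<Longrightarrow> \<sigma>1 y \<le> \<sigma> y"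
    and lo: "0 < lo" "lo \<le> hi" and \<epsilon>: "0 < \<epsilon>"
  shows "\<exists>f f' f'' L. bounded_C2 f f' f'' L \<and> (\<forall>z. 0 \<le> f z) \<and>
      (\<forall>y\<in>{lo..hi}. (\<sigma>1 y)\<^sup>2 * f'' y / 2 + \<mu> y * f' y - r * f y \<le> \<epsilon> \<and> \<bar>f y - put_candidate q \<phi> a y\<bar> \<le> \<epsilon>)"
proof -
  define lo1 where "lo1 = lo * (1 - pi / 4)"
  define hi1 where "hi1 = hi + pi / 2"
  have lo1: "0 < lo1" using lo pi_less_4 by (simp add: lo1_def)
  have hi1: "0 < hi1" "hi \<le> hi1" using lo pi_gt_zero by (auto simp: hi1_def intro!: add_pos_pos)
  have "continuous_on {a..a + 1} \<phi>''"
    using level_pos by (intro continuous_on_subset[OF phi_cont2]) auto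
  then obtain M where Mb: "\<forall>y\<in>{a..a + 1}. \<bar>\<phi>'' y\<bar> \<le> M" using continuous_on_Icc_bounded by blast
  have M: "\<phi>'' y \<le> M" if "a \<le> y" "y \<le> a + 1" for y
    using bspec[OF Mb, of y] that by simp
  have M0: "0 \<le> M" using M[of a] phi''_nonneg[of a] level_pos by simp
  define m where "m = r * hi + (\<bar>\<mu> lo\<bar> + \<bar>\<mu> hi\<bar> + r * hi)"
  have mb: "\<bar>\<mu> y\<bar> \<le> m" if "lo \<le> y" "y \<le> hi" for y
    unfolding m_def using mu_locally_bounded[OF lo(1) that] .
  have m0: "0 \<le> m" using mb[of lo] lo by simp
  define \<kappa> where "\<kappa> = min 1 (\<epsilon> / (scale * (M + 1) * (hi1 + m + 1)))"
  have den: "0 < scale * (M + 1) * (hi1 + m + 1)" using scale_pos M0 hi1 m0 by (intro mult_pos_pos) auto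
  have \<kappa>: "0 < \<kappa>" "\<kappa> \<le> 1" using \<epsilon> den by (auto simp: \<kappa>_def)
  define \<rho> where "\<rho> = scale * M * \<kappa>"
  have \<rho>0: "0 \<le> \<rho>" using scale_pos M0 \<kappa> by (simp add: \<rho>_def)
  have \<rho>\<epsilon>: "\<rho> * (hi1 + m + 1) \<le> \<epsilon>"
  proof -
    have "\<rho> * (hi1 + m + 1) \<le> (scale * (M + 1) * \<kappa>) * (hi1 + m + 1)"
      unfolding \<rho>_def using scale_pos \<kappa> hi1 m0 by (intro mult_right_mono mult_left_mono) auto
    also have "\<dots> = (scale * (M + 1) * (hi1 + m + 1)) * \<kappa>" by (simp add: mult_ac)
    also have "\<dots> \<le> (scale * (M + 1) * (hi1 + m + 1)) * (\<epsilon> / (scale * (M + 1) * (hi1 + m + 1)))"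
      using den by (intro mult_left_mono) (auto simp: \<kappa>_def)
    also have "\<dots> = \<epsilon>" by (subst times_divide_eq_right, rule nonzero_mult_div_cancel_left)
        (rule less_imp_neq[OF den, symmetric])
    finally show ?thesis .
  qed
  define ramp where "ramp y = max 0 (min 1 ((y - a) / \<kappa>))" for y
  have ramp: "0 \<le> ramp y" "ramp y \<le> 1" for y by (auto simp: ramp_def)
  have ramp_left: "ramp y = 0" if "y \<le> a" for y
  proof -
    have "(y - a) / \<kappa> \<le> 0" using that \<kappa> by (simp add: divide_nonpos_pos)
    then show ?thesis by (simp add: ramp_def)
  qed
  have ramp_right: "ramp y = 1" if "a + \<kappa> \<le> y" for y
  proof -
    have "1 \<le> (y - a) / \<kappa>" using that \<kappa> by (simp add: le_divide_eq)
    then show ?thesis by (simp add: ramp_def)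
  qed
  define g where "g y = ramp y * (scale * \<phi>'' (max y a))" for y
  have gc: "continuous_on UNIV g"
  proof -
    have "continuous_on UNIV (\<lambda>y. \<phi>'' (max y a))"
      by (rule continuous_on_compose2[OF phi_cont2]) (use level_pos in \<open>auto intro!: continuous_intros\<close>)
    then show ?thesis unfolding g_def ramp_def using \<kappa> by (intro continuous_intros) auto
  qed
  obtain u' where u': "\<And>z. (u' has_real_derivative g z) (at z)" "u' a = - 1"
    using continuous_antiderivative[OF gc] by metis
  have u'c: "continuous_on UNIV u'"
    by (rule DERIV_continuous_on[where D=g]) (auto intro: has_field_derivative_at_within u')
  obtain u where u: "\<And>z. (u has_real_derivative u' z) (at z)" "u a = q - a"
    using continuous_antiderivative[OF u'c] by metis
  have left': "u' y = - 1" if "y \<le> a" for y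
  proof (cases "y = a")
    case False
    then have "y < a" using that by simp
    then obtain z where "y < z" "z < a" "u' a - u' y = (a - y) * g z"
      using MVT2[OF \<open>y < a\<close>, of u' g] u'(1) by blast
    then show ?thesis using ramp_left[of z] u' by (simp add: g_def)
  qed (use u' in simp)
  have left: "u y = q - y" if "y \<le> a" for y
  proof (cases "y = a")
    case False
    then have "y < a" using that by simp
    then obtain z where "y < z" "z < a" "u a - u y = (a - y) * u' z"
      using MVT2[OF \<open>y < a\<close>, of u u'] u(1) by blast
    then show ?thesis using left'[of z] u by simp
  qed (use u in simp)
  have right': "0 \<le> scale * \<phi>' y - u' y \<and> scale * \<phi>' y - u' y \<le> \<rho>" if y: "a \<le> y" for y
  proof
    define e where "e z = scale * \<phi>' z - u' z" for z
    have ed: "(e has_real_derivative (1 - ramp z) * (scale * \<phi>'' z)) (at z)" if "a \<le> z" for z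
      unfolding e_def using that level_pos
      by (auto intro!: derivative_eq_intros phi_deriv2 u' simp: g_def max_absorb1 algebra_simps)
    have e0: "e a = 0" using scale_phi' u' by (simp add: e_def)
    have "e a \<le> e y"
    proof (rule DERIV_nonneg_imp_nondecreasing[OF y])
      fix z assume z: "a \<le> z" "z \<le> y"
      have "0 \<le> (1 - ramp z) * (scale * \<phi>'' z)" using ramp[of z] scale_pos phi''_nonneg[of z] z level_pos by simp
      then show "\<exists>D. (e has_real_derivative D) (at z) \<and> 0 \<le> D" using ed[OF z(1)] by blast
    qed
    then show "0 \<le> scale * \<phi>' y - u' y" using e0 by (simp add: e_def)
    have near: "e z \<le> scale * M * (z - a)" if z: "a \<le> z" "z \<le> a + \<kappa>" for z
    proof -
      have "scale * M * (a - a) - e a \<le> scale * M * (z - a) - e z"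
      proof (rule DERIV_nonneg_imp_nondecreasing[OF z(1)])
        fix v assume v: "a \<le> v" "v \<le> z"
        have "((\<lambda>v. scale * M * (v - a) - e v) has_real_derivative scale * M - (1 - ramp v) * (scale * \<phi>'' v)) (at v)"
          using v by (auto intro!: derivative_eq_intros ed)
        moreover have "(1 - ramp v) * (scale * \<phi>'' v) \<le> 1 * (scale * M)"
          using ramp[of v] scale_pos M[of v] phi''_nonneg[of v] v z \<kappa> level_pos by (intro mult_mono) auto
        ultimately show "\<exists>D. ((\<lambda>v. scale * M * (v - a) - e v) has_real_derivative D) (at v) \<and> 0 \<le> D" by force
      qed
      then show ?thesis using e0 by simp
    qed
    show "scale * \<phi>' y - u' y \<le> \<rho>"
    proof (cases "y \<le> a + \<kappa>")
      case True
      have "scale * M * (y - a) \<le> scale * M * \<kappa>" using True scale_pos M0 by (intro mult_left_mono) auto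
      then show ?thesis using near[OF y True] by (simp add: e_def \<rho>_def)
    next
      case False
      then obtain z where z: "a + \<kappa> < z" "z < y" "e y - e (a + \<kappa>) = (y - (a + \<kappa>)) * ((1 - ramp z) * (scale * \<phi>'' z))"
        using MVT2[of "a + \<kappa>" y e "\<lambda>z. (1 - ramp z) * (scale * \<phi>'' z)"] ed \<kappa> by auto
      then have "e y = e (a + \<kappa>)" using ramp_right[of z] by simp
      then show ?thesis using near[of "a + \<kappa>"] \<kappa> by (simp add: e_def \<rho>_def)
    qed
  qed
  have right: "0 \<le> scale * \<phi> y - u y \<and> scale * \<phi> y - u y \<le> \<rho> * (y - a)" if y: "a \<le> y" for y
  proof
    have ed: "((\<lambda>z. scale * \<phi> z - u z) has_real_derivative scale * \<phi>' z - u' z) (at z)" if "a \<le> z" for z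
      using that level_pos by (auto intro!: derivative_eq_intros phi_deriv u)
    have "scale * \<phi> a - u a \<le> scale * \<phi> y - u y"
      by (rule DERIV_nonneg_imp_nondecreasing[OF y]) (use ed right' in blast)
    then show "0 \<le> scale * \<phi> y - u y" using scale_phi u by simp
    have "\<rho> * (a - a) - (scale * \<phi> a - u a) \<le> \<rho> * (y - a) - (scale * \<phi> y - u y)"
    proof (rule DERIV_nonneg_imp_nondecreasing[OF y])
      fix z assume z: "a \<le> z" "z \<le> y"
      have "((\<lambda>z. \<rho> * (z - a) - (scale * \<phi> z - u z)) has_real_derivative \<rho> - (scale * \<phi>' z - u' z)) (at z)"
        using z level_pos by (auto intro!: derivative_eq_intros phi_deriv u)
      then show "\<exists>D. ((\<lambda>z. \<rho> * (z - a) - (scale * \<phi> z - u z)) has_real_derivative D) (at z) \<and> 0 \<le> D"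
        using right'[OF z(1)] by force
    qed
    then show "scale * \<phi> y - u y \<le> \<rho> * (y - a)" using scale_phi u by simp
  qed
  \<comment> \<open>Added to \<open>u\<close>, this restores nonnegativity on the enlarged window.\<close>
  define \<eta> where "\<eta> = \<rho> * hi1"
  have \<eta>0: "0 \<le> \<eta>" using \<rho>0 hi1 by (simp add: \<eta>_def)
  have \<eta>\<epsilon>: "\<eta> \<le> \<epsilon>" "m * \<rho> \<le> \<epsilon>"
  proof -
    have "\<rho> * hi1 \<le> \<rho> * (hi1 + m + 1)" "\<rho> * m \<le> \<rho> * (hi1 + m + 1)"
      using \<rho>0 m0 hi1 by (auto intro!: mult_left_mono)
    then show "\<eta> \<le> \<epsilon>" "m * \<rho> \<le> \<epsilon>" using \<rho>\<epsilon> by (auto simp: \<eta>_def mult.commute)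
  qed
  have close: "0 \<le> put_candidate q \<phi> a y - u y \<and> put_candidate q \<phi> a y - u y \<le> \<eta>" if "y \<le> hi1" for y
  proof (cases "y \<le> a")
    case True
    then show ?thesis using left \<eta>0 by (simp add: candidate_eq)
  next
    case False
    then have "\<rho> * (y - a) \<le> \<eta>" unfolding \<eta>_def using that level_pos \<rho>0 by (intro mult_left_mono) auto
    then show ?thesis using False right[of y] by (simp add: candidate_eq)
  qed
  have v: "((\<lambda>z. u z + \<eta>) has_real_derivative u' z) (at z)" for z
    by (auto intro!: derivative_eq_intros u)
  obtain f f' f'' L where f: "bounded_C2 f f' f'' L"
    "\<And>z. lo \<le> z \<Longrightarrow> z \<le> hi \<Longrightarrow> f z = u z + \<eta> \<and> f' z = u' z \<and> f'' z = g z"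
    "\<And>z. \<exists>y. lo1 \<le> y \<and> y \<le> hi1 \<and> f z = u y + \<eta>"
    by (rule bounded_C2_localization[OF v u'(1) gc lo, folded lo1_def hi1_def]) (rule that)
  have "0 \<le> f z" for z
  proof -
    obtain y where y: "lo1 \<le> y" "y \<le> hi1" "f z = u y + \<eta>" using f(3) by blast
    then show ?thesis using close[OF y(2)] candidate_ge[of y] lo1 by simp
  qed
  moreover have "\<bar>f y - put_candidate q \<phi> a y\<bar> \<le> \<epsilon>" if "lo \<le> y" "y \<le> hi" for y
    using f(2)[OF that] close[of y] that hi1 \<eta>\<epsilon> by simp
  moreover have "(\<sigma>1 y)\<^sup>2 * f'' y / 2 + \<mu> y * f' y - r * f y \<le> \<epsilon>" if y: "lo \<le> y" "y \<le> hi" for y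
  proof (cases "y \<le> a")
    case True
    then have "g y = 0" using ramp_left by (simp add: g_def)
    moreover have "r * y - \<mu> y \<le> r * q" using theta_level True y lo by simp
    moreover have "0 \<le> r * \<eta>" using r_pos \<eta>0 by simp
    moreover have "f y = q - y + \<eta>" "f' y = - 1" "f'' y = g y"
      using f(2)[OF y] left[OF True] left'[OF True] by auto
    ultimately show ?thesis using \<epsilon> by (simp only:) (simp add: algebra_simps)
  next
    case False
    then have ay: "a \<le> y" and y0: "0 < y" using level_pos by auto
    have "(\<sigma>1 y)\<^sup>2 * g y \<le> (\<sigma> y)\<^sup>2 * (scale * \<phi>'' y)"
    proof (rule mult_mono)
      show "(\<sigma>1 y)\<^sup>2 \<le> (\<sigma> y)\<^sup>2" using \<sigma>1[OF y0] by (intro power_mono) auto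
      show "g y \<le> scale * \<phi>'' y"
        using ramp[of y] scale_pos phi''_nonneg[OF y0] ay by (simp add: g_def max_absorb1 mult_left_le_one_le)
      show "0 \<le> g y" using ramp[of y] scale_pos phi''_nonneg[OF y0] ay by (simp add: g_def max_absorb1)
    qed simp
    moreover have "(\<sigma> y)\<^sup>2 * (scale * \<phi>'' y) / 2 + \<mu> y * (scale * \<phi>' y) = r * (scale * \<phi> y)"
      using arg_cong[OF equation[OF y0], of "(*) scale"] by (simp add: algebra_simps)
    moreover have "\<mu> y * (u' y - scale * \<phi>' y) \<le> \<epsilon>"
    proof -
      have "\<bar>\<mu> y * (u' y - scale * \<phi>' y)\<bar> \<le> m * \<rho>"
        unfolding abs_mult using mb[OF y] right'[OF ay] m0 by (intro mult_mono) auto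
      then show ?thesis using \<eta>\<epsilon> by linarith
    qed
    moreover have "r * (scale * \<phi> y) \<le> r * (u y + \<eta>)"
      using close[of y] False y hi1 r_pos by (intro mult_left_mono) (auto simp: candidate_eq)
    ultimately have "(\<sigma>1 y)\<^sup>2 * g y / 2 + \<mu> y * u' y - r * (u y + \<eta>) \<le> \<epsilon>"
      by (simp add: right_diff_distrib)
    then show ?thesis using f(2)[OF y] by simp
  qed
  ultimately show ?thesis using f(1) by (metis atLeastAtMost_iff)
qed

end

end

section \<open>Hitting times and lower bounds of the value\<close>

text \<open>
  The set of times at which a continuous path is at \<open>k\<close> is closed, so it contains its infimum.
\<close>

lemma hitting_time_attained:
  assumes cont: "continuous_on {0..} (\<lambda>t. X t \<omega>)" and fin: "hitting_time X k \<omega> < \<infinity>"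
  obtains u where "0 \<le> u" "hitting_time X k \<omega> = ennreal u" "X u \<omega> = k"
proof -
  define S where "S = {u. 0 \<le> u \<and> X u \<omega> = k}"
  have ht: "hitting_time X k \<omega> = Inf (ennreal ` S)"
    unfolding hitting_time_def S_def by (rule arg_cong[where f=Inf]) auto
  have "S \<noteq> {}" using fin ht by auto
  have "S = {0..} \<inter> (\<lambda>t. X t \<omega>) -` {k}" by (auto simp: S_def)
  then have "closed S" using continuous_closed_preimage[OF cont, of "{k}"] by simp
  have bdd: "bdd_below S" by (rule bdd_belowI[of _ 0]) (simp add: S_def)
  have "Inf S \<in> S" by (rule closed_contains_Inf) fact+
  moreover have "hitting_time X k \<omega> = ennreal (Inf S)"
    unfolding ht
  proof (rule antisym)
    show "Inf (ennreal ` S) \<le> ennreal (Inf S)" using \<open>Inf S \<in> S\<close> by (intro Inf_lower) auto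
    show "ennreal (Inf S) \<le> Inf (ennreal ` S)"
      using bdd by (intro Inf_greatest) (auto intro!: ennreal_leI cInf_lower)
  qed
  ultimately show thesis using that[of "Inf S"] by (simp add: S_def)
qed

lemma hitting_time_le_iff:
  assumes cont: "continuous_on {0..} (\<lambda>t. X t \<omega>)" and s: "0 \<le> s"
  shows "hitting_time X k \<omega> \<le> ennreal s \<longleftrightarrow> (\<exists>u\<in>{0..s}. X u \<omega> = k)"
proof
  assume le: "hitting_time X k \<omega> \<le> ennreal s"
  then have "hitting_time X k \<omega> < \<infinity>" by (rule le_less_trans) simp
  then obtain u where "0 \<le> u" "hitting_time X k \<omega> = ennreal u" "X u \<omega> = k"
    by (rule hitting_time_attained[where X=X and \<omega>=\<omega>, OF cont])
  then show "\<exists>u\<in>{0..s}. X u \<omega> = k" using le s by (intro bexI[of _ u]) (auto simp: ennreal_le_iff)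
next
  assume "\<exists>u\<in>{0..s}. X u \<omega> = k"
  then obtain u where u: "0 \<le> u" "u \<le> s" "X u \<omega> = k" by auto
  then have "hitting_time X k \<omega> \<le> ennreal u" unfolding hitting_time_def by (intro Inf_lower) auto
  also have "\<dots> \<le> ennreal s" using u by (intro ennreal_leI)
  finally show "hitting_time X k \<omega> \<le> ennreal s" .
qed

context brownian_basis
begin

text \<open>
  On a compact time interval the path reaches \<open>k\<close> if and only if it comes arbitrarily close to \<open>k\<close> at
  rational times.
\<close>

lemma stopping_time_hitting_time:
  assumes X: "\<And>t. 0 \<le> t \<Longrightarrow> X t \<in> borel_measurable (F (ennreal t))"
    and cont: "\<And>\<omega>. \<omega> \<in> space M \<Longrightarrow> continuous_on {0..} (\<lambda>t. X t \<omega>)"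
  shows "stopping_time F (hitting_time X k)"
proof
  fix t :: ennreal
  show "Measurable.pred (F t) (\<lambda>\<omega>. hitting_time X k \<omega> \<le> t)"
  proof (cases t)
    case top
    then show ?thesis by simp
  next
    case (real s)
    define g where "g v = X (max 0 (min s v))" for v
    have gm: "g v \<in> borel_measurable (F (ennreal s))" for v
      unfolding g_def using real(1) by (intro measurable_F_mono[OF _ X]) auto
    have gc: "continuous_on UNIV (\<lambda>v. g v \<omega>)" if "\<omega> \<in> space M" for \<omega>
      unfolding g_def by (rule continuous_on_compose2[OF cont[OF that]]) (auto intro!: continuous_intros)
    have "hitting_time X k \<omega> \<le> ennreal s \<longleftrightarrow> (\<forall>n::nat. \<exists>p::rat. \<bar>g (of_rat p) \<omega> - k\<bar> < 1 / real (Suc n))"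
      if \<omega>: "\<omega> \<in> space M" for \<omega>
    proof
      assume "hitting_time X k \<omega> \<le> ennreal s"
      then obtain u where u: "0 \<le> u" "u \<le> s" "X u \<omega> = k"
        using hitting_time_le_iff[where X=X and \<omega>=\<omega>, OF cont[OF \<omega>] real(1)] by auto
      show "\<forall>n::nat. \<exists>p::rat. \<bar>g (of_rat p) \<omega> - k\<bar> < 1 / real (Suc n)"
      proof (rule ccontr)
        assume "\<not> ?thesis"
        then obtain n :: nat where n: "\<And>p::rat. 1 / real (Suc n) \<le> \<bar>g (of_rat p) \<omega> - k\<bar>" by (auto simp: not_less)
        have "(\<lambda>v. \<bar>g v \<omega> - k\<bar>) u \<in> {1 / real (Suc n)..}"
          by (rule continuous_closed_rational) (use n gc[OF \<omega>] in \<open>auto intro!: continuous_intros\<close>)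
        then show False using u by (simp add: g_def)
      qed
    next
      assume r: "\<forall>n::nat. \<exists>p::rat. \<bar>g (of_rat p) \<omega> - k\<bar> < 1 / real (Suc n)"
      have cX: "continuous_on {0..s} (\<lambda>u. \<bar>X u \<omega> - k\<bar>)"
        using continuous_on_subset[OF cont[OF \<omega>], of "{0..s}"] by (auto intro!: continuous_intros)
      obtain u where u: "u \<in> {0..s}" "\<And>v. v \<in> {0..s} \<Longrightarrow> \<bar>X u \<omega> - k\<bar> \<le> \<bar>X v \<omega> - k\<bar>"
        using continuous_attains_inf[OF compact_Icc _ cX] real(1) by auto
      have "\<bar>X u \<omega> - k\<bar> < 1 / real (Suc n)" for n
      proof -
        obtain p :: rat where p: "\<bar>g (of_rat p) \<omega> - k\<bar> < 1 / real (Suc n)" using r by blast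
        have "\<bar>X u \<omega> - k\<bar> \<le> \<bar>g (of_rat p) \<omega> - k\<bar>" unfolding g_def using real(1) by (intro u(2)) auto
        then show ?thesis using p by linarith
      qed
      then have "\<not> 0 < \<bar>X u \<omega> - k\<bar>" using nat_approx_posE by (metis less_asym)
      then have "X u \<omega> = k" by simp
      then show "hitting_time X k \<omega> \<le> ennreal s"
        using hitting_time_le_iff[where X=X and \<omega>=\<omega>, OF cont[OF \<omega>] real(1)] u by auto
    qed
    then have eq: "\<omega> \<in> space (F t) \<Longrightarrow> hitting_time X k \<omega> \<le> t \<longleftrightarrow> (\<forall>n::nat. \<exists>p::rat. \<bar>g (of_rat p) \<omega> - k\<bar> < 1 / real (Suc n))" for \<omega>
      using real(2) by (simp add: space_F)
    note [measurable] = gm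
    have "Measurable.pred (F (ennreal s)) (\<lambda>\<omega>. \<forall>n::nat. \<exists>p::rat. \<bar>g (of_rat p) \<omega> - k\<bar> < 1 / real (Suc n))"
      by measurable
    moreover have "Measurable.pred (F t) (\<lambda>\<omega>. hitting_time X k \<omega> \<le> t)
        \<longleftrightarrow> Measurable.pred (F t) (\<lambda>\<omega>. \<forall>n::nat. \<exists>p::rat. \<bar>g (of_rat p) \<omega> - k\<bar> < 1 / real (Suc n))"
      by (rule measurable_cong) (rule eq)
    ultimately show ?thesis using real(2) by simp
  qed
qed

lemma put_value_least:
  assumes "\<And>T. stopping_time F T \<Longrightarrow> (\<integral>\<omega>. put_payoff r q (X x) T \<omega> \<partial>M) \<le> w"
  shows "put_value M F r q X x \<le> w"
proof -
  have "stopping_time F (\<lambda>_. 0)" by (rule stopping_time_const)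
  then show ?thesis unfolding put_value_def using assms by (intro cSUP_least) auto
qed

text \<open>
  The payoffs are bounded by \<open>q\<close>, so the supremum that defines the value is one over a bounded set.
\<close>

lemma put_value_ge:
  assumes T: "stopping_time F T" and r: "0 \<le> r" and q: "0 \<le> q"
    and pos: "\<And>\<omega> t. \<omega> \<in> space M \<Longrightarrow> 0 \<le> t \<Longrightarrow> 0 < X x t \<omega>"
  shows "(\<integral>\<omega>. put_payoff r q (X x) T \<omega> \<partial>M) \<le> put_value M F r q X x"
  unfolding put_value_def
proof (rule cSUP_upper)
  show "T \<in> {T. stopping_time F T}" using T by simp
  show "bdd_above ((\<lambda>T. \<integral>\<omega>. put_payoff r q (X x) T \<omega> \<partial>M) ` {T. stopping_time F T})"
  proof (intro bdd_aboveI2[where M=q])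
    fix T
    have le: "put_payoff r q (X x) T \<omega> \<le> q" if "\<omega> \<in> space M" for \<omega>
    proof -
      have "discount r (T \<omega>) \<le> 1" "0 \<le> discount r (T \<omega>)" using r by (auto simp: discount_def)
      moreover have "max 0 (q - X x (enn2real (T \<omega>)) \<omega>) \<le> q" using pos[OF that, of "enn2real (T \<omega>)"] q by auto
      ultimately show ?thesis unfolding put_payoff_def
        using mult_mono[of "discount r (T \<omega>)" 1 "max 0 (q - X x (enn2real (T \<omega>)) \<omega>)" q] by simp
    qed
    show "(\<integral>\<omega>. put_payoff r q (X x) T \<omega> \<partial>M) \<le> q"
    proof (cases "integrable M (put_payoff r q (X x) T)")
      case True
      then have "(\<integral>\<omega>. put_payoff r q (X x) T \<omega> \<partial>M) \<le> (\<integral>\<omega>. q \<partial>M)" using le by (intro integral_mono) auto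
      then show ?thesis by (simp add: prob_space)
    next
      case False
      then show ?thesis using q by (simp add: not_integrable_integral_eq)
    qed
  qed
qed

end

context admissible_diffusion
begin

lemma solution_props:
  assumes "0 < x"
  shows "strong_solution M F B \<mu> \<sigma> x (X x)"
    and "0 \<le> t \<Longrightarrow> X x t \<in> borel_measurable (F (ennreal t))"
    and "\<omega> \<in> space M \<Longrightarrow> continuous_on {0..} (\<lambda>t. X x t \<omega>)"
    and "\<omega> \<in> space M \<Longrightarrow> 0 \<le> t \<Longrightarrow> 0 < X x t \<omega>"
  using solution[OF assms] by (auto simp: unique_strong_solution_def strong_solution_def adapted_def)

lemma hitting_stopping: "0 < x \<Longrightarrow> stopping_time F (hitting_time (X x) k)"
  using solution_props by (intro stopping_time_hitting_time) auto

text \<open>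
  At the first visit to \<open>k\<close> the payoff is the constant \<open>q - k\<close>, discounted. For \<open>k = x\<close> this gives \<open>q - x\<close>.
\<close>

lemma put_value_ge_hitting:
  assumes \<phi>: "decreasing_fundamental M r \<mu> \<sigma> X \<phi>" and r: "0 \<le> r" and k: "0 < k" "k \<le> x" "k \<le> q"
  shows "(q - k) * \<phi> x / \<phi> k \<le> put_value M F r q X x"
proof -
  have x: "0 < x" using k by simp
  have "(\<integral>\<omega>. put_payoff r q (X x) (hitting_time (X x) k) \<omega> \<partial>M) = (\<integral>\<omega>. discount r (hitting_time (X x) k \<omega>) * (q - k) \<partial>M)"
  proof (rule Bochner_Integration.integral_cong[OF refl])
    fix \<omega> assume \<omega>: "\<omega> \<in> space M"
    show "put_payoff r q (X x) (hitting_time (X x) k) \<omega> = discount r (hitting_time (X x) k \<omega>) * (q - k)"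
    proof (cases "hitting_time (X x) k \<omega> < \<infinity>")
      case True
      then obtain u where "0 \<le> u" "hitting_time (X x) k \<omega> = ennreal u" "X x u \<omega> = k"
        by (rule hitting_time_attained[where X="X x" and \<omega>=\<omega>, OF solution_props(3)[OF x \<omega>]])
      then show ?thesis using k by (simp add: put_payoff_def)
    next
      case False
      then show ?thesis by (simp add: put_payoff_def discount_def less_top)
    qed
  qed
  also have "\<dots> = \<phi> x / \<phi> k * (q - k)"
    using \<phi> k by (simp add: decreasing_fundamental_def)
  finally have "(q - k) * \<phi> x / \<phi> k = (\<integral>\<omega>. put_payoff r q (X x) (hitting_time (X x) k) \<omega> \<partial>M)" by simp
  also have "\<dots> \<le> put_value M F r q X x"
    using k x solution_props(4)[OF x] by (intro put_value_ge hitting_stopping r) auto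
  finally show ?thesis .
qed

text \<open>
  Since \<open>0\<close> is not reached in finite time, low levels are reached late, so the expected discount factor
  \<open>\<phi> x / \<phi> y\<close> tends to \<open>0\<close> as \<open>y\<close> does.
\<close>

lemma decreasing_fundamental_unbounded:
  assumes \<phi>: "decreasing_fundamental M r \<mu> \<sigma> X \<phi>" and r: "0 < r" and x: "0 < x"
  shows "\<exists>y. 0 < y \<and> y < x \<and> b < \<phi> y"
proof -
  have \<phi>pos: "0 < \<phi> y" if "0 < y" for y using \<phi> that by (auto simp: decreasing_fundamental_def)
  define e where "e = \<phi> x / (2 * (\<bar>b\<bar> + 1))"
  have e: "0 < e" using \<phi>pos[OF x] by (simp add: e_def)
  define t where "t = max 0 (- ln (e / 2) / r)"
  have t: "0 \<le> t" by (simp add: t_def)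
  have et: "exp (- r * t) \<le> e / 2"
  proof -
    have "- ln (e / 2) / r \<le> t" by (simp add: t_def)
    then have "- r * t \<le> ln (e / 2)" using r by (simp add: field_simps)
    then show ?thesis using e by (metis exp_le_cancel_iff exp_ln half_gt_zero)
  qed
  have "((\<lambda>y. measure M {\<omega> \<in> space M. hitting_time (X x) y \<omega> \<le> ennreal t}) \<longlongrightarrow> 0) (at_right 0)"
    using natural_boundary x t by (auto simp: natural_at_0_def)
  then have "\<forall>\<^sub>F y in at_right 0. measure M {\<omega> \<in> space M. hitting_time (X x) y \<omega> \<le> ennreal t} < e / 2"
    using e by (intro order_tendstoD(2)[of _ 0]) auto
  moreover have "\<forall>\<^sub>F y in at_right 0. 0 < y \<and> y < x"
    using x by (auto simp: eventually_at_right_field)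
  ultimately have "\<forall>\<^sub>F y in at_right (0::real). measure M {\<omega> \<in> space M. hitting_time (X x) y \<omega> \<le> ennreal t} < e / 2 \<and> 0 < y \<and> y < x"
    by eventually_elim auto
  then obtain y where y: "measure M {\<omega> \<in> space M. hitting_time (X x) y \<omega> \<le> ennreal t} < e / 2" "0 < y" "y < x"
    using eventually_happens'[OF trivial_limit_at_right_real] by blast
  define S where "S = {\<omega> \<in> space M. hitting_time (X x) y \<omega> \<le> ennreal t}"
  have S: "S \<in> sets M"
  proof -
    have "{\<omega> \<in> space (F (ennreal t)). hitting_time (X x) y \<omega> \<le> ennreal t} \<in> sets (F (ennreal t))"
      using stopping_timeD[OF hitting_stopping[OF x, of y], of "ennreal t"] by (simp add: pred_def)
    from sets_F_M[OF this] show ?thesis by (simp add: S_def space_F)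
  qed
  have "\<phi> x / \<phi> y = (\<integral>\<omega>. discount r (hitting_time (X x) y \<omega>) \<partial>M)"
    using \<phi> y by (simp add: decreasing_fundamental_def)
  also have "\<dots> \<le> (\<integral>\<omega>. indicator S \<omega> + exp (- r * t) \<partial>M)"
  proof (rule integral_mono')
    show "integrable M (\<lambda>\<omega>. indicator S \<omega> + exp (- r * t))" using S by (auto simp: emeasure_eq_measure)
    fix \<omega> assume \<omega>: "\<omega> \<in> space M"
    show "discount r (hitting_time (X x) y \<omega>) \<le> indicator S \<omega> + exp (- r * t)"
    proof (cases "\<omega> \<in> S")
      case True
      have "discount r (hitting_time (X x) y \<omega>) \<le> 1" using r by (simp add: discount_def)
      then show ?thesis using True by (simp add: add_increasing2)
    next
      case False
      then have lt: "ennreal t < hitting_time (X x) y \<omega>" using \<omega> by (auto simp: S_def not_le)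
      show ?thesis
      proof (cases "hitting_time (X x) y \<omega>")
        case (real u)
        then have "t \<le> u" using lt t by (simp add: ennreal_less_iff)
        then show ?thesis using real False r by (simp add: discount_def)
      qed (simp add: discount_def)
    qed
    show "0 \<le> indicator S \<omega> + exp (- r * t)" by simp
  qed
  also have "\<dots> = measure M S + exp (- r * t)" using S by (simp add: prob_space emeasure_eq_measure)
  also have "\<dots> < e" using y(1) et by (simp add: S_def)
  finally have "\<phi> x < e * \<phi> y" using \<phi>pos[OF y(2)] by (simp add: divide_less_eq)
  also have "\<dots> = \<phi> x * (\<phi> y / (2 * (\<bar>b\<bar> + 1)))" by (simp add: e_def)
  finally have "\<phi> x * 1 < \<phi> x * (\<phi> y / (2 * (\<bar>b\<bar> + 1)))" by simp
  then have "1 < \<phi> y / (2 * (\<bar>b\<bar> + 1))"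
    using \<phi>pos[OF x] by (rule mult_left_less_imp_less[OF _ less_imp_le])
  moreover have "0 < 2 * (\<bar>b\<bar> + 1)" by simp
  ultimately have "2 * (\<bar>b\<bar> + 1) < \<phi> y" by (simp only: less_divide_eq_1_pos)
  then show ?thesis using y by (intro exI[of _ y]) auto
qed

end

section \<open>Existence of optimal levels and absence of affine pieces\<close>

context decreasing_harmonic
begin

text \<open>
  The defining expression of an optimal level is the value at \<open>q\<close> of the tangent of \<open>\<phi>\<close> at \<open>x\<close>. It is
  positive for \<open>x = q\<close>; it is not positive for small \<open>x\<close>, where the convex and unbounded \<open>\<phi>\<close> is steep.
\<close>

lemma optimal_level_exists:
  assumes q: "0 < q" and unb: "\<And>x b. 0 < x \<Longrightarrow> \<exists>y. 0 < y \<and> y < x \<and> b < \<phi> y"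
  obtains a where "optimal_level q \<phi> a"
proof -
  define h where "h x = \<phi> x + (q - x) * \<phi>' x" for x
  obtain x where x: "0 < x" "x < q / 2" "2 * \<phi> (q / 2) < \<phi> x" using unb[of "q / 2"] q by force
  have "h x \<le> 0"
  proof -
    \<comment> \<open>The tangent at \<open>x\<close>, evaluated at \<open>q = 2 * y\<close>, is split at \<open>y\<close>; both pieces are estimated by convexity.\<close>
    define y where "y = q / 2"
    have y: "0 < y" "x < y" "q = 2 * y" using q x by (auto simp: y_def)
    have t: "\<phi> x + \<phi>' x * (y - x) \<le> \<phi> y" using tangent[OF x(1) y(1)] .
    have "\<phi>' x * y \<le> \<phi>' x * (y - x)"
      using phi'_nonpos[OF x(1)] x(1) by (intro mult_left_mono_neg) auto
    then have "\<phi>' x * y \<le> - \<phi> y" using t x(3) by (simp add: y_def)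
    moreover have "h x = (\<phi> x + \<phi>' x * (y - x)) + \<phi>' x * y" by (simp add: h_def y(3) algebra_simps)
    ultimately show ?thesis using t by linarith
  qed
  moreover have "0 < h q" using pos[OF q] by (simp add: h_def)
  moreover have "continuous_on {x..q} h"
  proof -
    have "continuous_on {x..q} \<phi>"
      by (rule DERIV_continuous_on[OF has_field_derivative_at_within[OF phi_deriv]]) (use x in simp)
    moreover have "continuous_on {x..q} \<phi>'"
      by (rule DERIV_continuous_on[OF has_field_derivative_at_within[OF phi_deriv2]]) (use x in simp)
    ultimately show ?thesis unfolding h_def by (intro continuous_intros)
  qed
  ultimately obtain a where a: "x \<le> a" "a \<le> q" "h a = 0"
    using IVT'[of h x 0 q] x q by auto
  moreover have "a \<noteq> q" using a \<open>0 < h q\<close> by auto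
  ultimately have "optimal_level q \<phi> a" using x by (auto simp: optimal_level_def h_def)
  then show thesis by (rule that)
qed

context
  fixes \<psi> :: "real \<Rightarrow> real"
  assumes \<psi>: "r_harmonic r \<mu> \<sigma> \<psi>" and \<psi>_pos: "\<And>x. 0 < x \<Longrightarrow> 0 < \<psi> x" and \<psi>_mono: "strict_mono_on {0<..} \<psi>"
begin

lemma psi_deriv: "0 < x \<Longrightarrow> (\<psi> has_real_derivative deriv \<psi> x) (at x)"
  and psi_deriv2: "0 < x \<Longrightarrow> (deriv \<psi> has_real_derivative deriv (deriv \<psi>) x) (at x)"
  and psi_cont2: "continuous_on {0<..} (deriv (deriv \<psi>))"
  using \<psi> unfolding r_harmonic_def C2_pos_def
  by (auto simp: DERIV_deriv_iff_field_differentiable)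

lemma psi_equation: "0 < x \<Longrightarrow> (\<sigma> x)\<^sup>2 * deriv (deriv \<psi>) x / 2 + \<mu> x * deriv \<psi> x = r * \<psi> x"
  using \<psi> unfolding r_harmonic_def generator_def by auto

lemma psi'_nonneg: assumes x: "0 < x" shows "0 \<le> deriv \<psi> x"
  by (rule mono_on_imp_deriv_nonneg[OF strict_mono_on_imp_mono_on[OF \<psi>_mono] psi_deriv[OF x]])
    (use x in \<open>auto simp: interior_open\<close>)

text \<open>
  The volatility is the quotient of \<open>r * \<phi> - \<mu> * \<phi>'\<close> and \<open>\<phi>'' / 2\<close>, and likewise for \<open>\<psi>\<close>. The two second
  derivatives cannot vanish at the same point, since this would force \<open>\<mu>\<close> to be negative by the equation
  for the decreasing \<open>\<phi>\<close> and positive by the equation for the increasing \<open>\<psi>\<close>.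
\<close>

lemma coefficients_locally_bounded:
  assumes lo: "0 < lo"
  shows "\<exists>C\<ge>0. \<forall>y\<in>{lo..hi}. \<bar>\<mu> y\<bar> \<le> C \<and> \<bar>\<sigma> y\<bar> \<le> C"
proof (cases "lo \<le> hi")
  case False
  then show ?thesis by auto
next
  case le: True
  have sub: "{lo..hi} \<subseteq> {0<..}" using lo by auto
  define s where "s y = \<bar>\<phi>'' y\<bar> + \<bar>deriv (deriv \<psi>) y\<bar>" for y
  have "continuous_on {lo..hi} s"
    unfolding s_def by (intro continuous_intros continuous_on_subset[OF phi_cont2 sub] continuous_on_subset[OF psi_cont2 sub])
  then obtain z where z: "z \<in> {lo..hi}" "\<And>y. y \<in> {lo..hi} \<Longrightarrow> s z \<le> s y"
    using continuous_attains_inf[of "{lo..hi}" s] le by auto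
  have spos: "0 < s z"
  proof (rule ccontr)
    assume "\<not> 0 < s z"
    then have "\<phi>'' z = 0" "deriv (deriv \<psi>) z = 0" by (auto simp: s_def add_nonneg_eq_0_iff not_less le_less)
    moreover have z0: "0 < z" using z lo by auto
    ultimately have 1: "\<mu> z * \<phi>' z = r * \<phi> z" and 2: "\<mu> z * deriv \<psi> z = r * \<psi> z"
      using equation psi_equation by fastforce+
    have "0 < \<mu> z * \<phi>' z" "0 < \<mu> z * deriv \<psi> z" unfolding 1 2 using r_pos pos \<psi>_pos z0 by auto
    then show False using phi'_nonpos[OF z0] psi'_nonneg[OF z0] by (auto simp: zero_less_mult_iff)
  qed
  have cont: "continuous_on {lo..hi} \<phi>" "continuous_on {lo..hi} \<phi>'" "continuous_on {lo..hi} \<psi>" "continuous_on {lo..hi} (deriv \<psi>)"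
    using lo by (auto intro!: DERIV_continuous_on[OF has_field_derivative_at_within] intro: phi_deriv phi_deriv2 psi_deriv psi_deriv2)
  obtain k1 k2 k3 k4 where k: "\<forall>y\<in>{lo..hi}. \<bar>\<phi> y\<bar> \<le> k1" "\<forall>y\<in>{lo..hi}. \<bar>\<phi>' y\<bar> \<le> k2"
    "\<forall>y\<in>{lo..hi}. \<bar>\<psi> y\<bar> \<le> k3" "\<forall>y\<in>{lo..hi}. \<bar>deriv \<psi> y\<bar> \<le> k4"
    using continuous_on_Icc_bounded[OF cont(1)] continuous_on_Icc_bounded[OF cont(2)]
      continuous_on_Icc_bounded[OF cont(3)] continuous_on_Icc_bounded[OF cont(4)] by blast
  define m where "m = r * hi + (\<bar>\<mu> lo\<bar> + \<bar>\<mu> hi\<bar> + r * hi)"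
  have mb: "\<bar>\<mu> y\<bar> \<le> m" if "y \<in> {lo..hi}" for y
    unfolding m_def using mu_locally_bounded[OF lo] that by auto
  define Q where "Q = (r * k1 + m * k2) + (r * k3 + m * k4)"
  have \<sigma>b: "\<bar>\<sigma> y\<bar> \<le> 1 + 2 * Q / s z" if y: "y \<in> {lo..hi}" for y
  proof -
    have y0: "0 < y" using y lo by auto
    have m0: "0 \<le> m" using mb[OF y] by simp
    have A: "\<bar>(\<sigma> y)\<^sup>2 * v2 / 2\<bar> \<le> r * kv + m * kv'"
      if "(\<sigma> y)\<^sup>2 * v2 / 2 + \<mu> y * v1 = r * v" "\<bar>v\<bar> \<le> kv" "\<bar>v1\<bar> \<le> kv'" for v v1 v2 kv kv'
    proof -
      have "\<bar>r * v\<bar> \<le> r * kv" "\<bar>\<mu> y * v1\<bar> \<le> m * kv'"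
        unfolding abs_mult using that mb[OF y] r_pos m0 by (auto intro!: mult_mono)
      then show ?thesis using that(1) by linarith
    qed
    have "\<bar>(\<sigma> y)\<^sup>2 * \<phi>'' y / 2\<bar> + \<bar>(\<sigma> y)\<^sup>2 * deriv (deriv \<psi>) y / 2\<bar> \<le> Q"
      unfolding Q_def using A[OF equation[OF y0]] A[OF psi_equation[OF y0]] k y by (intro add_mono) auto
    then have "(\<sigma> y)\<^sup>2 * s y \<le> 2 * Q" by (simp add: s_def abs_mult distrib_left)
    moreover have "(\<sigma> y)\<^sup>2 * s z \<le> (\<sigma> y)\<^sup>2 * s y" using z(2)[OF y] by (intro mult_left_mono) auto
    ultimately have "(\<sigma> y)\<^sup>2 \<le> 2 * Q / s z" using spos by (simp add: pos_le_divide_eq)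
    moreover have "\<bar>\<sigma> y\<bar> \<le> 1 + (\<sigma> y)\<^sup>2" using abs_le_add_square[of 1 "\<sigma> y"] by simp
    ultimately show ?thesis by simp
  qed
  show ?thesis
  proof (intro exI[of _ "max m (1 + 2 * Q / s z)"] conjI ballI)
    show "0 \<le> max m (1 + 2 * Q / s z)" using mb[of lo] le by (auto simp: le_max_iff_disj)
    show "\<bar>\<mu> y\<bar> \<le> max m (1 + 2 * Q / s z)" "\<bar>\<sigma> y\<bar> \<le> max m (1 + 2 * Q / s z)" if "y \<in> {lo..hi}" for y
      using mb[OF that] \<sigma>b[OF that] by (auto simp: le_max_iff_disj)
  qed
qed

text \<open>
  If \<open>\<phi>\<close> were proportional to \<open>q - y\<close> on an interval, the equation would give \<open>r * y - \<mu> y = r * q\<close> there,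
  hence \<open>r * y - \<mu> y \<ge> r * q\<close> to the right of it. The excess \<open>D\<close> of \<open>\<gamma> * \<phi>\<close> over the line then satisfies
  \<open>\<sigma>\<^sup>2 * D'' / 2 \<le> r * D - \<mu> * D'\<close> with zero initial data. As \<open>\<mu> \<le> 0\<close> up to \<open>q\<close>, the equation of the
  increasing solution bounds \<open>\<sigma>\<close> away from \<open>0\<close>, and Gronwall's argument gives \<open>D = 0\<close> up to \<open>q\<close>, where the
  line vanishes but \<open>\<phi>\<close> does not.
\<close>

lemma no_linear_piece:
  assumes \<gamma>: "0 < \<gamma>" and ab: "0 < a" "a < b" "b < q"
    and lin: "\<And>y. a < y \<Longrightarrow> y < b \<Longrightarrow> \<gamma> * \<phi> y = q - y"
  shows False
proof -
  define e where "e = (a + b) / 2"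
  have e: "a < e" "e < b" "0 < e" "e < q" using ab by (auto simp: e_def)
  have \<phi>_lin: "\<phi> y = (q - y) / \<gamma>" if "y \<in> {a<..<b}" for y using lin[of y] that \<gamma> by (simp add: field_simps)
  have d1: "\<phi>' y = - 1 / \<gamma>" if y: "y \<in> {a<..<b}" for y
  proof -
    have "(\<phi> has_real_derivative - 1 / \<gamma>) (at y)"
    proof (rule has_field_derivative_transform_within_open[of "\<lambda>y. (q - y) / \<gamma>" "- 1 / \<gamma>" y "{a<..<b}"])
      show "((\<lambda>y. (q - y) / \<gamma>) has_real_derivative - 1 / \<gamma>) (at y)" using \<gamma> by (auto intro!: derivative_eq_intros)
    qed (use y \<phi>_lin in auto)
    then show ?thesis by (rule DERIV_imp_deriv)
  qed
  have d2: "\<phi>'' e = 0"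
  proof -
    have "(\<phi>' has_real_derivative 0) (at e)"
      by (rule has_field_derivative_transform_within_open[of "\<lambda>_. - 1 / \<gamma>" 0 e "{a<..<b}"])
        (use e d1 in auto)
    then show ?thesis by (rule DERIV_imp_deriv)
  qed
  have "\<mu> e * (- 1 / \<gamma>) = r * ((q - e) / \<gamma>)" using equation[OF e(3)] d2 d1[of e] \<phi>_lin[of e] e by simp
  then have \<mu>e: "- \<mu> e = r * (q - e)" using \<gamma> by (simp add: field_simps)
  have \<mu>_le: "\<mu> y + r * (q - y) \<le> 0" if "e \<le> y" for y
    using mono_onD[OF theta, of e y] that e \<mu>e by (auto simp: algebra_simps)
  have \<mu>_neg: "\<mu> y \<le> 0" if "e \<le> y" "y \<le> q" for y
    using \<mu>_le[OF that(1)] mult_nonneg_nonneg[of r "q - y"] that r_pos by linarith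
  define D where "D y = \<gamma> * \<phi> y - (q - y)" for y
  define D' where "D' y = \<gamma> * \<phi>' y + 1" for y
  have De: "D e = 0" "D' e = 0" using \<phi>_lin[of e] d1[of e] e \<gamma> by (auto simp: D_def D'_def)
  have D'0: "0 \<le> D' y" if "e \<le> y" for y
  proof -
    have "\<gamma> * \<phi>' e \<le> \<gamma> * \<phi>' y" using phi'_mono[OF e(3) that] \<gamma> by (intro mult_left_mono) auto
    then show ?thesis using De(2) by (simp add: D'_def)
  qed
  have Dd: "(D has_real_derivative D' y) (at y)" if "e \<le> y" for y
    unfolding D_def D'_def using that e by (auto intro!: derivative_eq_intros phi_deriv)
  have D'd: "(D' has_real_derivative \<gamma> * \<phi>'' y) (at y)" if "e \<le> y" for y
    unfolding D'_def using that e by (auto intro!: derivative_eq_intros phi_deriv2)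
  have D0: "0 \<le> D y" if y: "e \<le> y" for y
  proof -
    have "D e \<le> D y" by (rule DERIV_nonneg_imp_nondecreasing[OF y]) (use Dd D'0 in blast)
    then show ?thesis using De by simp
  qed
  have "continuous_on {e..q} (deriv (deriv \<psi>))" using e by (intro continuous_on_subset[OF psi_cont2]) auto
  then obtain p0 where p0: "\<forall>y\<in>{e..q}. \<bar>deriv (deriv \<psi>) y\<bar> \<le> p0" using continuous_on_Icc_bounded by blast
  define p where "p = \<bar>p0\<bar> + 1"
  have p: "0 < p" "\<And>y. e \<le> y \<Longrightarrow> y \<le> q \<Longrightarrow> deriv (deriv \<psi>) y \<le> p"
  proof -
    show "0 < p" by (simp add: p_def)
    show "deriv (deriv \<psi>) y \<le> p" if "e \<le> y" "y \<le> q" for y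
      using bspec[OF p0, of y] that unfolding p_def by simp
  qed
  define s0 where "s0 = r * \<psi> e / p"
  have s0: "0 < s0" using r_pos \<psi>_pos[OF e(3)] p by (simp add: s0_def)
  have \<sigma>_low: "s0 \<le> (\<sigma> y)\<^sup>2 / 2" if y: "e \<le> y" "y \<le> q" for y
  proof -
    have y0: "0 < y" using y e by simp
    have "\<psi> e \<le> \<psi> y" using strict_mono_on_imp_mono_on[OF \<psi>_mono] y e by (auto simp: mono_on_def)
    then have "r * \<psi> e \<le> r * \<psi> y" using r_pos by simp
    moreover have "\<mu> y * deriv \<psi> y \<le> 0" using \<mu>_neg[OF y] psi'_nonneg[OF y0] by (simp add: mult_nonpos_nonneg)
    ultimately have "r * \<psi> e \<le> (\<sigma> y)\<^sup>2 / 2 * deriv (deriv \<psi>) y" using psi_equation[OF y0] by simp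
    also have "\<dots> \<le> (\<sigma> y)\<^sup>2 / 2 * p" using p(2)[OF y] by (intro mult_left_mono) auto
    finally show ?thesis using p(1) by (simp add: s0_def pos_divide_le_eq)
  qed
  define m where "m = r * q + (\<bar>\<mu> e\<bar> + \<bar>\<mu> q\<bar> + r * q)"
  have mb: "\<bar>\<mu> y\<bar> \<le> m" if "e \<le> y" "y \<le> q" for y
    unfolding m_def using mu_locally_bounded[OF e(3) that] .
  define k where "k = (r + m) / s0"
  have k_bound: "\<gamma> * \<phi>'' y \<le> k * (D y + D' y)" if y: "e \<le> y" "y \<le> q" for y
  proof -
    have y0: "0 < y" using y e by simp
    have "s0 * (\<gamma> * \<phi>'' y) \<le> (\<sigma> y)\<^sup>2 / 2 * (\<gamma> * \<phi>'' y)"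
      using \<sigma>_low[OF y] \<gamma> phi''_nonneg[OF y0] by (intro mult_right_mono) auto
    also have "\<dots> = \<gamma> * ((\<sigma> y)\<^sup>2 * \<phi>'' y / 2)" by simp
    also have "(\<sigma> y)\<^sup>2 * \<phi>'' y / 2 = r * \<phi> y - \<mu> y * \<phi>' y" using equation[OF y0] by simp
    also have "\<gamma> * (r * \<phi> y - \<mu> y * \<phi>' y) = r * D y - \<mu> y * D' y + (\<mu> y + r * (q - y))"
      by (simp add: D_def D'_def algebra_simps)
    also have "\<dots> \<le> r * D y + m * D' y"
    proof -
      have "- \<mu> y * D' y \<le> m * D' y" using mb[OF y] D'0[OF y(1)] by (intro mult_right_mono) auto
      then show ?thesis using \<mu>_le[OF y(1)] by simp
    qed
    also have "\<dots> \<le> (r + m) * (D y + D' y)"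
      using D0[OF y(1)] D'0[OF y(1)] r_pos mb[OF y] by (simp add: algebra_simps)
    finally show ?thesis using s0 by (simp add: k_def field_simps)
  qed
  \<comment> \<open>Gronwall: the derivative of \<open>D + D'\<close> is at most \<open>(k + 1) * (D + D')\<close>.\<close>
  define E where "E y = exp (- (k + 1) * y) * (D y + D' y)" for y
  have "E q \<le> E e"
  proof (rule DERIV_nonpos_imp_nonincreasing[of e q E])
    show "e \<le> q" using e by simp
    fix y assume y: "e \<le> y" "y \<le> q"
    have "(E has_real_derivative exp (- (k + 1) * y) * (D' y + \<gamma> * \<phi>'' y) + - (k + 1) * exp (- (k + 1) * y) * (D y + D' y)) (at y)"
      unfolding E_def by (auto intro!: derivative_eq_intros Dd[OF y(1)] D'd[OF y(1)])
    moreover have "exp (- (k + 1) * y) * (D' y + \<gamma> * \<phi>'' y) + - (k + 1) * exp (- (k + 1) * y) * (D y + D' y)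
        = exp (- (k + 1) * y) * ((\<gamma> * \<phi>'' y - k * (D y + D' y)) - D y)" by (simp add: algebra_simps)
    moreover have "(\<gamma> * \<phi>'' y - k * (D y + D' y)) - D y \<le> 0" using k_bound[OF y] D0[OF y(1)] by simp
    ultimately show "\<exists>v. (E has_real_derivative v) (at y) \<and> v \<le> 0"
      by (metis exp_ge_zero mult_nonneg_nonpos)
  qed
  moreover have "E e = 0" using De by (simp add: E_def)
  moreover have "0 < D q + D' q" using D'0[of q] e \<gamma> pos[of q] by (simp add: D_def add_pos_nonneg)
  ultimately show False by (simp add: E_def mult_le_0_iff)
qed

end

end

section \<open>Comparison of two volatilities\<close>

lemma admissible_decreasing_harmonic:
  assumes "admissible_diffusion M F B r \<mu> \<sigma> X" "decreasing_fundamental M r \<mu> \<sigma> X \<phi>" "convex_on {0<..} \<phi>" "0 < r"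
  shows "decreasing_harmonic r \<mu> \<sigma> \<phi>"
  using assms admissible_diffusion.theta_mono[OF assms(1)]
  by unfold_locales (auto simp: decreasing_fundamental_def)

lemma put_value_le_candidate:
  fixes \<mu> \<sigma>1 \<sigma>2 :: "real \<Rightarrow> real"
  assumes r: "0 < r" and q: "0 < q"
    and adm1: "admissible_diffusion M F B r \<mu> \<sigma>1 X1" and adm2: "admissible_diffusion M F B r \<mu> \<sigma>2 X2"
    and \<psi>1: "increasing_fundamental M r \<mu> \<sigma>1 X1 \<psi>1" and \<phi>1: "decreasing_fundamental M r \<mu> \<sigma>1 X1 \<phi>1" "convex_on {0<..} \<phi>1"
    and \<phi>2: "decreasing_fundamental M r \<mu> \<sigma>2 X2 \<phi>2" "convex_on {0<..} \<phi>2"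
    and le: "\<forall>x>0. \<sigma>1 x \<le> \<sigma>2 x" and a: "optimal_level q \<phi>2 a" and x: "0 < x"
  shows "put_value M F r q X1 x \<le> put_candidate q \<phi>2 a x"
proof -
  interpret A1: admissible_diffusion M F B r \<mu> \<sigma>1 X1 by (rule adm1)
  interpret H1: decreasing_harmonic r \<mu> \<sigma>1 \<phi>1 by (rule admissible_decreasing_harmonic[OF adm1 \<phi>1 r])
  interpret H2: decreasing_harmonic r \<mu> \<sigma>2 \<phi>2 by (rule admissible_decreasing_harmonic[OF adm2 \<phi>2 r])
  show ?thesis
  proof (rule A1.put_value_least)
    fix T assume T: "stopping_time F T"
    show "(\<integral>\<omega>. put_payoff r q (X1 x) T \<omega> \<partial>M) \<le> put_candidate q \<phi>2 a x"
    proof (rule A1.verification[OF A1.solution_props(1)[OF x] x less_imp_le[OF r] A1.drift_measurable A1.volatility_measurable _ _ _ T])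
      show "\<exists>C\<ge>0. \<forall>y\<in>{lo..hi}. \<bar>\<mu> y\<bar> \<le> C \<and> \<bar>\<sigma>1 y\<bar> \<le> C" if "0 < lo" for lo hi
        by (rule H1.coefficients_locally_bounded[of \<psi>1, OF _ _ _ that]) (use \<psi>1 in \<open>auto simp: increasing_fundamental_def\<close>)
      show "\<exists>f f' f'' L. bounded_C2 f f' f'' L \<and> (\<forall>z. 0 \<le> f z) \<and>
        (\<forall>y\<in>{lo..hi}. (\<sigma>1 y)\<^sup>2 * f'' y / 2 + \<mu> y * f' y - r * f y \<le> \<epsilon> \<and> \<bar>f y - put_candidate q \<phi>2 a y\<bar> \<le> \<epsilon>)"
        if "0 < lo" "lo \<le> hi" "0 < \<epsilon>" for lo hi \<epsilon>
        by (rule H2.candidate_approximation[OF a _ _ that]) (use A1.volatility_pos le in \<open>auto intro: less_imp_le\<close>)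
      show "max 0 (q - y) \<le> put_candidate q \<phi>2 a y" if "0 < y" for y by (rule H2.candidate_ge[OF a that])
    qed
  qed
qed

theorem proposition4p6:
  fixes M :: "'a measure" and F :: "ennreal \<Rightarrow> 'a measure" and B :: "real \<Rightarrow> 'a \<Rightarrow> real"
    and r q :: real and \<mu> \<sigma>1 \<sigma>2 :: "real \<Rightarrow> real"
    and X1 X2 :: "real \<Rightarrow> real \<Rightarrow> 'a \<Rightarrow> real"
    and \<psi>1 \<psi>2 \<phi>1 \<phi>2 :: "real \<Rightarrow> real"
  assumes "r > 0" and "q > 0"
    and "admissible_diffusion M F B r \<mu> \<sigma>1 X1"
    and "admissible_diffusion M F B r \<mu> \<sigma>2 X2"
    and "increasing_fundamental M r \<mu> \<sigma>1 X1 \<psi>1" and "decreasing_fundamental M r \<mu> \<sigma>1 X1 \<phi>1"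
    and "increasing_fundamental M r \<mu> \<sigma>2 X2 \<psi>2" and "decreasing_fundamental M r \<mu> \<sigma>2 X2 \<phi>2"
    and "convex_on {0<..} \<phi>1" and "convex_on {0<..} \<phi>2"
    and "\<forall>x>0. \<sigma>1 x \<le> \<sigma>2 x"
  shows "(\<forall>x>0. put_value M F r q X1 x \<le> put_value M F r q X2 x) \<and>
         (\<forall>a1 a2. optimal_level q \<phi>1 a1 \<longrightarrow> optimal_level q \<phi>2 a2 \<longrightarrow> a2 \<le> a1)"
proof -
  note r = assms(1) and q = assms(2)
  interpret A1: admissible_diffusion M F B r \<mu> \<sigma>1 X1 by (rule assms(3))
  interpret A2: admissible_diffusion M F B r \<mu> \<sigma>2 X2 by (rule assms(4))
  interpret H1: decreasing_harmonic r \<mu> \<sigma>1 \<phi>1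
    by (rule admissible_decreasing_harmonic[OF assms(3,6,9) r])
  interpret H2: decreasing_harmonic r \<mu> \<sigma>2 \<phi>2
    by (rule admissible_decreasing_harmonic[OF assms(4,8,10) r])
  note upper = put_value_le_candidate[OF r q assms(3,4,5,6,9,8,10,11)]
  show ?thesis
  proof (intro conjI allI impI)
    fix x :: real assume x: "0 < x"
    obtain a where a: "optimal_level q \<phi>2 a"
      using H2.optimal_level_exists[OF q A2.decreasing_fundamental_unbounded[OF assms(8) r]] by blast
    have a': "0 < a" "a < q" using a by (auto simp: optimal_level_def)
    have "put_value M F r q X1 x \<le> put_candidate q \<phi>2 a x" by (rule upper[OF a x])
    \<comment> \<open>The candidate is the reward of stopping at the first visit to \<open>min x a\<close>.\<close>
    also have "\<dots> = (q - min x a) * \<phi>2 x / \<phi>2 (min x a)"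
      using H2.pos[OF x] by (auto simp: put_candidate_def min_def)
    also have "\<dots> \<le> put_value M F r q X2 x"
      using x a' r by (intro A2.put_value_ge_hitting[OF assms(8)]) auto
    finally show "put_value M F r q X1 x \<le> put_value M F r q X2 x" .
  next
    fix a1 a2 assume a1: "optimal_level q \<phi>1 a1" and a2: "optimal_level q \<phi>2 a2"
    show "a2 \<le> a1"
    proof (rule ccontr)
      assume "\<not> a2 \<le> a1"
      then have lt: "a1 < a2" by simp
      have b: "0 < a1" "a1 < q" "a2 < q" using a1 a2 by (auto simp: optimal_level_def)
      define c where "c = (q - a1) / \<phi>1 a1"
      have "0 < c" using b H1.pos[of a1] by (simp add: c_def)
      \<comment> \<open>Between the two levels the tangent bound from below meets the upper bound from the first claim.\<close>
      have lin: "c * \<phi>1 y = q - y" if y: "a1 < y" "y < a2" for y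
      proof (rule antisym)
        have y0: "0 < y" using y b by simp
        have "c * \<phi>1 y = (q - a1) * \<phi>1 y / \<phi>1 a1" by (simp add: c_def)
        also have "\<dots> \<le> put_value M F r q X1 y"
          using b y r by (intro A1.put_value_ge_hitting[OF assms(6)]) auto
        also have "\<dots> \<le> put_candidate q \<phi>2 a2 y" by (rule upper[OF a2 y0])
        also have "\<dots> = q - y" using y by (simp add: put_candidate_def)
        finally show "c * \<phi>1 y \<le> q - y" .
        show "q - y \<le> c * \<phi>1 y"
          using H1.scale_tangent[OF a1 y0] by (simp add: H1.scale_def[OF a1] c_def)
      qed
      have \<psi>: "r_harmonic r \<mu> \<sigma>1 \<psi>1" "\<And>x. 0 < x \<Longrightarrow> 0 < \<psi>1 x" "strict_mono_on {0<..} \<psi>1"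
        using assms(5) by (auto simp: increasing_fundamental_def)
      show False by (rule H1.no_linear_piece[OF \<psi> \<open>0 < c\<close> b(1) lt b(3) lin])
    qed
  qed
qed

end
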